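(* Let $G$ be a separable locally compact unimodular group of type I and let $a:G\to\mathbb C$ be continuous, bounded and square-integrable with $\|a\|_{L^2(G)}=1$. For each $\pi\in\widehat G$ let $(\varphi_k(\pi))_{k\in I_\pi}$, $I_\pi\subset\mathbb N$, be an orthonormal basis of $\mathcal H_\pi$, and for $(x,\pi)\in G\times\widehat G$ and $k,\ell\in I_\pi$ set $$g_{x,\pi,k,\ell}(y)=\big(\mathscr F_{x,\pi}(y)^*\varphi_k(\pi),\varphi_\ell(\pi)\big)_{\mathcal H_\pi},\quad y\in G,\qquad\text{where } \mathscr F_{x,\pi}(y)=a(x^{-1}y)\,\pi(y)^*.$$ Then every $f\in L^2(G)$ decomposes in $L^2(G)$ as $$f=\int_{G\times\widehat G}\sum_{k,\ell\in I_\pi}(f,g_{x,\pi,k,\ell})_{L^2(G)}\;g_{x,\pi,k,\ell}\;dx\,d\mu(\pi),$$ in the sense that $$\|f\|_{L^2(G)}^2=\int_{G\times\widehat G}\sum_{k,\ell\in I_\pi}\big|(f,g_{x,\pi,k,\ell})_{L^2(G)}\big|^2\,dx\,d\mu(\pi),$$ or equivalently, for any $f_1,f_2\in L^2(G)$, $$(f_1,f_2)_{L^2(G)}=\int_{G\times\widehat G}\sum_{k,\ell\in I_\pi}(f_1,g_{x,\pi,k,\ell})_{L^2(G)}\,\overline{(f_2,g_{x,\pi,k,\ell})_{L^2(G)}}\,dx\,d\mu(\pi).$$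
   Context: $dx$ is a fixed Haar measure on $G$. $\widehat G$ is the set of equivalence classes of irreducible strongly continuous unitary representations $\pi$ of $G$ on separable Hilbert spaces $\mathcal H_\pi$ (inner products are linear in the first variable). The group Fourier transform is $\widehat f(\pi)=\int_Gf(z)\pi(z)^*dz$. $\mu$ is the Plancherel measure on $\widehat G$: the unique positive Borel measure such that $\|f\|_{L^2(G)}^2=\int_{\widehat G}\|\widehat f(\pi)\|_{HS(\mathcal H_\pi)}^2d\mu(\pi)$ for all continuous compactly supported $f$. The bases $(\varphi_k(\pi))_k$ are understood to depend measurably on $\pi$, as is usual for measurable fields of Hilbert spaces. *)

theory Defs
  imports "HOL-Analysis.Analysis" "HOL-Algebra.Module"
begin

section \<open>Complex Hilbert spaces with an explicit carrier\<close>

text \<open>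
  The spaces of a field over the unitary dual vary with the point, so they are records with a
  carrier set rather than types. The record extends the library's modules, whose inherited ring
  fields \<open>mult\<close> and \<open>one\<close> have no meaning here and are ignored by all notions below.
\<close>

record 'h hilb = "(complex, 'h) module" +
  hinner :: "'h \<Rightarrow> 'h \<Rightarrow> complex"

definition complex_ring :: "complex ring" where
  "complex_ring = \<lparr>carrier = UNIV, mult = (*), one = 1, zero = 0, add = (+)\<rparr>"

definition hnorm :: "'h hilb \<Rightarrow> 'h \<Rightarrow> real" where
  "hnorm H u = sqrt (Re (hinner H u u))"

definition hdist :: "'h hilb \<Rightarrow> 'h \<Rightarrow> 'h \<Rightarrow> real" where
  "hdist H u v = hnorm H (u \<ominus>\<^bsub>H\<^esub> v)"

locale hilbert_space = Module.module complex_ring H for H :: "'h hilb" (structure) +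
  assumes hinner_add_left: "\<lbrakk>u \<in> carrier H; v \<in> carrier H; w \<in> carrier H\<rbrakk> \<Longrightarrow>
      hinner H (u \<oplus> v) w = hinner H u w + hinner H v w"
    and hinner_smult_left: "\<lbrakk>u \<in> carrier H; v \<in> carrier H\<rbrakk> \<Longrightarrow>
      hinner H (c \<odot> u) v = c * hinner H u v"
    and hinner_commute: "\<lbrakk>u \<in> carrier H; v \<in> carrier H\<rbrakk> \<Longrightarrow>
      hinner H v u = cnj (hinner H u v)"
    and hinner_nonneg: "u \<in> carrier H \<Longrightarrow> 0 \<le> Re (hinner H u u)"
    and hinner_definite: "\<lbrakk>u \<in> carrier H; hinner H u u = 0\<rbrakk> \<Longrightarrow> u = \<zero>"
    and hcomplete: "\<lbrakk>range s \<subseteq> carrier H;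
        \<forall>\<epsilon>>0. \<exists>N::nat. \<forall>m\<ge>N. \<forall>n\<ge>N. hdist H (s m) (s n) < \<epsilon>\<rbrakk> \<Longrightarrow>
      \<exists>u\<in>carrier H. (\<lambda>n. hdist H (s n) u) \<longlonglongrightarrow> 0"

definition separable_hilbert :: "'h hilb \<Rightarrow> bool" where
  "separable_hilbert H \<longleftrightarrow> hilbert_space H \<and>
     (\<exists>D. countable D \<and> D \<subseteq> carrier H \<and>
       (\<forall>u\<in>carrier H. \<forall>\<epsilon>>0. \<exists>d\<in>D. hdist H u d < \<epsilon>))"

definition total_in :: "'h hilb \<Rightarrow> 'h set \<Rightarrow> bool" where
  "total_in H S \<longleftrightarrow> S \<subseteq> carrier H \<and>
     (\<forall>u\<in>carrier H. \<forall>\<epsilon>>0. \<exists>F c. finite F \<and> F \<subseteq> S \<and>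
        hdist H u (\<Oplus>\<^bsub>H\<^esub>v\<in>F. c v \<odot>\<^bsub>H\<^esub> v) < \<epsilon>)"

definition orthonormal_basis :: "'h hilb \<Rightarrow> nat set \<Rightarrow> (nat \<Rightarrow> 'h) \<Rightarrow> bool" where
  "orthonormal_basis H J b \<longleftrightarrow>
     (\<forall>j\<in>J. \<forall>k\<in>J. hinner H (b j) (b k) = (if j = k then 1 else 0)) \<and> total_in H (b ` J)"

definition closed_subspace :: "'h hilb \<Rightarrow> 'h set \<Rightarrow> bool" where
  "closed_subspace H W \<longleftrightarrow> submodule W complex_ring H \<and>
     (\<forall>s u. range s \<subseteq> W \<and> u \<in> carrier H \<and> (\<lambda>n::nat. hdist H (s n) u) \<longlonglongrightarrow> 0 \<longrightarrow> u \<in> W)"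

definition linear_map :: "'h hilb \<Rightarrow> 'k hilb \<Rightarrow> ('h \<Rightarrow> 'k) \<Rightarrow> bool" where
  "linear_map H K T \<longleftrightarrow> T \<in> carrier H \<rightarrow> carrier K \<and>
     (\<forall>u\<in>carrier H. \<forall>v\<in>carrier H. T (u \<oplus>\<^bsub>H\<^esub> v) = T u \<oplus>\<^bsub>K\<^esub> T v) \<and>
     (\<forall>c. \<forall>u\<in>carrier H. T (c \<odot>\<^bsub>H\<^esub> u) = c \<odot>\<^bsub>K\<^esub> T u)"

definition bounded_operator :: "'h hilb \<Rightarrow> ('h \<Rightarrow> 'h) \<Rightarrow> bool" where
  "bounded_operator H T \<longleftrightarrow> linear_map H H T \<and> (\<exists>B. \<forall>u\<in>carrier H. hnorm H (T u) \<le> B * hnorm H u)"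

definition unitary_map :: "'h hilb \<Rightarrow> 'k hilb \<Rightarrow> ('h \<Rightarrow> 'k) \<Rightarrow> bool" where
  "unitary_map H K U \<longleftrightarrow> linear_map H K U \<and> bij_betw U (carrier H) (carrier K) \<and>
     (\<forall>u\<in>carrier H. \<forall>v\<in>carrier H. hinner K (U u) (U v) = hinner H u v)"

definition hadjoint :: "'h hilb \<Rightarrow> ('h \<Rightarrow> 'h) \<Rightarrow> 'h \<Rightarrow> 'h" where
  "hadjoint H T u = (THE w. w \<in> carrier H \<and> (\<forall>v\<in>carrier H. hinner H (T v) u = hinner H v w))"

text \<open>
  The squared Hilbert--Schmidt norm, infinite if the operator is not Hilbert--Schmidt. It is
  computed in some orthonormal basis; the value does not depend on which one.
\<close>

definition hs_norm_sq :: "'h hilb \<Rightarrow> ('h \<Rightarrow> 'h) \<Rightarrow> ennreal" where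
  "hs_norm_sq H T = (case SOME (J, b). orthonormal_basis H J b of
     (J, b) \<Rightarrow> \<Sum>\<^sub>\<infinity>j\<in>J. ennreal ((hnorm H (T (b j)))\<^sup>2))"


section \<open>Unitary representations\<close>

text \<open>
  Groups are written additively, after the class \<^class>\<open>topological_group_add\<close>, which does not
  assume commutativity: \<open>x + y\<close>, \<open>- x\<close> and \<open>0\<close> are the product, the inverse and the
  neutral element.
\<close>

definition unitary_rep :: "'h hilb \<Rightarrow> ('g::topological_group_add \<Rightarrow> 'h \<Rightarrow> 'h) \<Rightarrow> bool" where
  "unitary_rep H \<pi> \<longleftrightarrow> hilbert_space H \<and>
     (\<forall>x. unitary_map H H (\<pi> x)) \<and>
     (\<forall>u\<in>carrier H. \<pi> 0 u = u) \<and>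
     (\<forall>x y. \<forall>u\<in>carrier H. \<pi> (x + y) u = \<pi> x (\<pi> y u)) \<and>
     (\<forall>u\<in>carrier H. \<forall>x. ((\<lambda>y. hdist H (\<pi> y u) (\<pi> x u)) \<longlongrightarrow> 0) (at x))"

definition invariant_subspace :: "'h hilb \<Rightarrow> ('g \<Rightarrow> 'h \<Rightarrow> 'h) \<Rightarrow> 'h set \<Rightarrow> bool" where
  "invariant_subspace H \<pi> W \<longleftrightarrow> closed_subspace H W \<and> (\<forall>x. \<pi> x ` W \<subseteq> W)"

definition irreducible_rep :: "'h hilb \<Rightarrow> ('g::topological_group_add \<Rightarrow> 'h \<Rightarrow> 'h) \<Rightarrow> bool" where
  "irreducible_rep H \<pi> \<longleftrightarrow> unitary_rep H \<pi> \<and> carrier H \<noteq> {\<zero>\<^bsub>H\<^esub>} \<and>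
     (\<forall>W. invariant_subspace H \<pi> W \<longrightarrow> W = {\<zero>\<^bsub>H\<^esub>} \<or> W = carrier H)"

definition unitarily_equivalent ::
    "'h hilb \<Rightarrow> ('g \<Rightarrow> 'h \<Rightarrow> 'h) \<Rightarrow> 'k hilb \<Rightarrow> ('g \<Rightarrow> 'k \<Rightarrow> 'k) \<Rightarrow> bool" where
  "unitarily_equivalent H \<pi> K \<sigma> \<longleftrightarrow>
     (\<exists>U. unitary_map H K U \<and> (\<forall>x. \<forall>u\<in>carrier H. U (\<pi> x u) = \<sigma> x (U u)))"

definition commutant :: "'h hilb \<Rightarrow> ('g \<Rightarrow> 'h \<Rightarrow> 'h) \<Rightarrow> ('h \<Rightarrow> 'h) set" where
  "commutant H \<pi> = {T. bounded_operator H T \<and> (\<forall>x. \<forall>u\<in>carrier H. T (\<pi> x u) = \<pi> x (T u))}"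

definition primary_rep :: "'h hilb \<Rightarrow> ('g::topological_group_add \<Rightarrow> 'h \<Rightarrow> 'h) \<Rightarrow> bool" where
  "primary_rep H \<pi> \<longleftrightarrow> unitary_rep H \<pi> \<and> carrier H \<noteq> {\<zero>\<^bsub>H\<^esub>} \<and>
     (\<forall>T\<in>commutant H \<pi>. (\<forall>S\<in>commutant H \<pi>. \<forall>u\<in>carrier H. T (S u) = S (T u)) \<longrightarrow>
        (\<exists>c. \<forall>u\<in>carrier H. T u = c \<odot>\<^bsub>H\<^esub> u))"

text \<open>An internal direct sum; countably many summands suffice on a separable space.\<close>

definition multiple_of_irreducible ::
    "'h hilb \<Rightarrow> ('g::topological_group_add \<Rightarrow> 'h \<Rightarrow> 'h) \<Rightarrow> bool" where
  "multiple_of_irreducible H \<pi> \<longleftrightarrow>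
     (\<exists>(K :: 'h hilb) \<sigma> (J :: nat set) W. irreducible_rep K \<sigma> \<and>
        (\<forall>j\<in>J. invariant_subspace H \<pi> (W j) \<and>
                 unitarily_equivalent (H\<lparr>carrier := W j\<rparr>) \<pi> K \<sigma>) \<and>
        (\<forall>i\<in>J. \<forall>j\<in>J. i \<noteq> j \<longrightarrow> (\<forall>u\<in>W i. \<forall>v\<in>W j. hinner H u v = 0)) \<and>
        total_in H (\<Union>j\<in>J. W j))"

text \<open>
  A separable Hilbert space has at most continuum many vectors, so up to isomorphism its carrier
  is a set of complex sequences (with arbitrary operations). Hence nothing is lost by taking the
  vectors of all separable Hilbert spaces from one type.
\<close>

type_synonym vec = "nat \<Rightarrow> complex"
type_synonym 'g rep = "vec hilb \<times> ('g \<Rightarrow> vec \<Rightarrow> vec)"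

definition irreps :: "'g::topological_group_add rep set" where
  "irreps = {(H, \<pi>). separable_hilbert H \<and> irreducible_rep H \<pi>}"

definition unitary_dual :: "'g::topological_group_add rep set set" where
  "unitary_dual = irreps // {((H, \<pi>), (K, \<sigma>)).
     (H, \<pi>) \<in> irreps \<and> (K, \<sigma>) \<in> irreps \<and> unitarily_equivalent H \<pi> K \<sigma>}"

definition type_I :: "'g::topological_group_add itself \<Rightarrow> bool" where
  "type_I _ \<longleftrightarrow> (\<forall>(H :: vec hilb) (\<pi> :: 'g \<Rightarrow> vec \<Rightarrow> vec).
     separable_hilbert H \<and> primary_rep H \<pi> \<longrightarrow> multiple_of_irreducible H \<pi>)"


section \<open>The Borel structure of the unitary dual\<close>

text \<open>
  Mackey's Borel structure: the irreducible representations on the model spaces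
  $\mathbb{C}^n = \ell^2(\{0,\dots,n-1\})$ and $\ell^2(\mathbb{N})$ carry the smallest
  sigma-algebra for which all $\pi \mapsto (\pi(x)u,v)$ are measurable, and the dual carries the
  quotient structure. For second countable groups of type I it coincides with the sigma-algebra
  generated by the Fell topology.
\<close>

definition l2_space :: "nat set \<Rightarrow> vec hilb" where
  "l2_space J =
     \<lparr>carrier = {u. (\<forall>n. n \<notin> J \<longrightarrow> u n = 0) \<and> (\<lambda>n. (cmod (u n))\<^sup>2) summable_on UNIV},
      mult = undefined, one = undefined,
      zero = (\<lambda>_. 0), add = (\<lambda>u v n. u n + v n), smult = (\<lambda>c u n. c * u n),
      hinner = (\<lambda>u v. \<Sum>\<^sub>\<infinity>n. u n * cnj (v n))\<rparr>"

definition model_spaces :: "vec hilb set" where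
  "model_spaces = insert (l2_space UNIV) (range (\<lambda>n. l2_space {..<n}))"

definition model_irreps :: "'g::topological_group_add rep measure" where
  "model_irreps = sigma {(H, \<pi>). H \<in> model_spaces \<and> irreducible_rep H \<pi>}
     {{(K, \<pi>). K = H \<and> irreducible_rep K \<pi> \<and> hinner H (\<pi> x u) v \<in> B} | H x u v B.
        H \<in> model_spaces \<and> u \<in> carrier H \<and> v \<in> carrier H \<and> open B}"

definition dual_borel :: "'g::topological_group_add rep set measure" where
  "dual_borel = sigma unitary_dual
     {A. A \<subseteq> unitary_dual \<and> {r \<in> space model_irreps. r \<in> \<Union>A} \<in> sets model_irreps}"


section \<open>Measurable fields of Hilbert spaces\<close>

text \<open>
  A field \<open>p \<mapsto> H p\<close> of Hilbert spaces with fundamental sequence \<open>e\<close> of sections; a section is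
  measurable if its inner products with the fundamental sections are, and a field of operators is
  measurable if it maps measurable sections to measurable sections.
\<close>

definition measurable_hilbert_field ::
    "'p measure \<Rightarrow> ('p \<Rightarrow> 'h hilb) \<Rightarrow> (nat \<Rightarrow> 'p \<Rightarrow> 'h) \<Rightarrow> bool" where
  "measurable_hilbert_field \<mu> H e \<longleftrightarrow>
     (\<forall>p\<in>space \<mu>. separable_hilbert (H p) \<and> total_in (H p) (range (\<lambda>j. e j p))) \<and>
     (\<forall>i j. (\<lambda>p. hinner (H p) (e i p) (e j p)) \<in> borel_measurable \<mu>)"

definition measurable_section ::
    "'p measure \<Rightarrow> ('p \<Rightarrow> 'h hilb) \<Rightarrow> (nat \<Rightarrow> 'p \<Rightarrow> 'h) \<Rightarrow> ('p \<Rightarrow> 'h) \<Rightarrow> bool" where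
  "measurable_section \<mu> H e s \<longleftrightarrow> (\<forall>p\<in>space \<mu>. s p \<in> carrier (H p)) \<and>
     (\<forall>j. (\<lambda>p. hinner (H p) (s p) (e j p)) \<in> borel_measurable \<mu>)"

definition measurable_rep_field ::
    "'p measure \<Rightarrow> ('p \<Rightarrow> 'h hilb) \<Rightarrow> (nat \<Rightarrow> 'p \<Rightarrow> 'h) \<Rightarrow> ('p \<Rightarrow> 'g \<Rightarrow> 'h \<Rightarrow> 'h) \<Rightarrow> bool" where
  "measurable_rep_field \<mu> H e \<pi> \<longleftrightarrow> measurable_hilbert_field \<mu> H e \<and>
     (\<forall>x s. measurable_section \<mu> H e s \<longrightarrow> measurable_section \<mu> H e (\<lambda>p. \<pi> p x (s p)))"


section \<open>Haar measure, square-integrable functions, Plancherel measure\<close>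

text \<open>
  Regularity is not required separately: it is automatic for Borel measures that are finite on
  compact sets of a second countable locally compact Hausdorff space.
\<close>

definition haar_measure :: "'g::topological_group_add measure \<Rightarrow> bool" where
  "haar_measure M \<longleftrightarrow> sets M = sets borel \<and> emeasure M UNIV \<noteq> 0 \<and>
     (\<forall>K. compact K \<longrightarrow> emeasure M K < \<infinity>) \<and>
     (\<forall>x. distr M borel (\<lambda>y. x + y) = M)"

definition unimodular :: "'g::topological_group_add itself \<Rightarrow> bool" where
  "unimodular _ \<longleftrightarrow>
     (\<forall>M :: 'g measure. haar_measure M \<longrightarrow> (\<forall>x. distr M borel (\<lambda>y. y + x) = M))"

definition L2 :: "'a measure \<Rightarrow> ('a \<Rightarrow> complex) set" where
  "L2 M = {f \<in> borel_measurable M. integrable M (\<lambda>x. (cmod (f x))\<^sup>2)}"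

definition L2_norm :: "'a measure \<Rightarrow> ('a \<Rightarrow> complex) \<Rightarrow> real" where
  "L2_norm M f = sqrt (\<integral>x. (cmod (f x))\<^sup>2 \<partial>M)"

definition L2_inner :: "'a measure \<Rightarrow> ('a \<Rightarrow> complex) \<Rightarrow> ('a \<Rightarrow> complex) \<Rightarrow> complex" where
  "L2_inner M f h = (\<integral>x. f x * cnj (h x) \<partial>M)"

text \<open>The integral of $f(z)\pi(z)^*$, in the weak sense.\<close>

definition fourier_transform ::
    "'g measure \<Rightarrow> ('g \<Rightarrow> complex) \<Rightarrow> 'h hilb \<Rightarrow> ('g \<Rightarrow> 'h \<Rightarrow> 'h) \<Rightarrow> 'h \<Rightarrow> 'h" where
  "fourier_transform M f H \<pi> u = (THE w. w \<in> carrier H \<and>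
     (\<forall>v\<in>carrier H. hinner H w v = (\<integral>z. f z * hinner H (hadjoint H (\<pi> z) u) v \<partial>M)))"

text \<open>
  \<open>(H p, \<pi> p)\<close> is the representative by which a class \<open>p\<close> is replaced in formulas; the
  Hilbert--Schmidt norms do not depend on its choice.
\<close>

definition plancherel_measure ::
    "'g::topological_group_add measure \<Rightarrow> ('g rep set \<Rightarrow> vec hilb) \<Rightarrow>
     ('g rep set \<Rightarrow> 'g \<Rightarrow> vec \<Rightarrow> vec) \<Rightarrow> 'g rep set measure \<Rightarrow> bool" where
  "plancherel_measure M H \<pi> \<mu> \<longleftrightarrow> sets \<mu> = sets dual_borel \<and>
     (\<forall>f. continuous_on UNIV f \<and> compact (closure {x. f x \<noteq> 0}) \<longrightarrow>
        ennreal ((L2_norm M f)\<^sup>2) =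
          (\<integral>\<^sup>+p. hs_norm_sq (H p) (fourier_transform M f (H p) (\<pi> p)) \<partial>\<mu>))"


section \<open>The frame\<close>

definition localized_rep ::
    "('g::group_add \<Rightarrow> complex) \<Rightarrow> 'h hilb \<Rightarrow> ('g \<Rightarrow> 'h \<Rightarrow> 'h) \<Rightarrow> 'g \<Rightarrow> 'g \<Rightarrow> 'h \<Rightarrow> 'h" where
  "localized_rep a H \<pi> x y = (\<lambda>u. a (- x + y) \<odot>\<^bsub>H\<^esub> hadjoint H (\<pi> y) u)"

definition frame_fun ::
    "('g::group_add \<Rightarrow> complex) \<Rightarrow> 'h hilb \<Rightarrow> ('g \<Rightarrow> 'h \<Rightarrow> 'h) \<Rightarrow> (nat \<Rightarrow> 'h) \<Rightarrow>
     'g \<Rightarrow> nat \<Rightarrow> nat \<Rightarrow> 'g \<Rightarrow> complex" where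
  "frame_fun a H \<pi> b x k l y = hinner H (hadjoint H (localized_rep a H \<pi> x y) (b k)) (b l)"

end

theory Submission
  imports Defs
begin

text \<open>
  Unfolding the adjoints, \<open>g\<^bsub>x,p,k,l\<^esub>(y)\<close> is the product of the complex conjugate of \<open>a(x\<^sup>-\<^sup>1y)\<close> and
  the matrix coefficient \<open>(\<pi>\<^sub>p(y) \<phi>\<^sub>k, \<phi>\<^sub>l)\<close>. Hence \<open>(f, g\<^bsub>x,p,k,l\<^esub>)\<close> is the matrix entry
  \<open>(F(p) \<phi>\<^sub>l, \<phi>\<^sub>k)\<close> of the group Fourier transform \<open>F\<close> of the windowed function
  \<open>f\<^sub>x(y) = f(y) a(x\<^sup>-\<^sup>1y)\<close>, and the sum of the squared absolute values over
  \<open>k\<close> and \<open>l\<close> is the squared Hilbert--Schmidt norm of that transform at \<open>p\<close>. If the Plancherel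
  formula may be applied to \<open>f\<^sub>x\<close>, integrating over \<open>p\<close> leaves \<open>\<integral>|f(y)|\<^sup>2 |a(x\<^sup>-\<^sup>1y)|\<^sup>2 dy\<close>, and
  integrating over \<open>x\<close> leaves \<open>\<parallel>f\<parallel>\<^sup>2 \<parallel>a\<parallel>\<^sup>2 = \<parallel>f\<parallel>\<^sup>2\<close>, because the Haar measure of a unimodular group is
  also invariant under inversion.

  The Plancherel formula is given for continuous functions of compact support. Since \<open>a\<close> is
  continuous, \<open>f\<^sub>x\<close> is such a function for every \<open>x\<close> as soon as \<open>f\<close> is, so the identity holds on a
  dense subspace of \<open>L\<^sup>2\<close> (\<open>nn_integral_analysis_cont_compact_support\<close>,
  \<open>cont_compact_support_dense_L2\<close>). The coefficients depend continuously on \<open>f \<in> L\<^sup>2\<close>, uniformly in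
  \<open>(x, p, k, l)\<close>; Fatou's lemma then gives the inequality \<open>\<le>\<close> for all \<open>f\<close>, and the parallelogram law
  turns it into equality (\<open>analysis_isometry\<close>). The bilinear identity is the polarized form of this
  isometry, followed by Fubini's theorem.

  Integrating over the product with the Plancherel measure \<open>\<mu>\<close> needs two facts about it. First,
  matrix coefficients are jointly measurable, being continuous on the group and measurable in \<open>p\<close>;
  the latter rests on the measurability of inner products of measurable sections
  (\<open>measurable_section_hinner\<close>). Second, \<open>\<mu>\<close> is \<open>\<sigma>\<close>-finite (\<open>sigma_finite_mu\<close>): by the Plancherel
  formula the transforms of countably many bump functions near the neutral element have finite
  integral, while at every \<open>p\<close> one of them is non-zero.
\<close>


section \<open>Sums of extended nonnegative reals\<close>

text \<open>
  Tonelli's theorem for unconditional sums is taken from the counting measure. The two notions agree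
  because the countable index set is exhausted by the finite sets \<open>F n\<close> of its elements with code
  below \<open>n\<close>, to which monotone convergence applies.
\<close>

lemma infsum_ennreal_eq_nn_integral:
  fixes f :: "'i::countable \<Rightarrow> ennreal"
  shows "(\<Sum>\<^sub>\<infinity>j\<in>J. f j) = (\<integral>\<^sup>+j. f j * indicator J j \<partial>count_space UNIV)"
proof -
  have sup: "(\<Sum>\<^sub>\<infinity>j\<in>J. f j) = (SUP F\<in>{F. finite F \<and> F \<subseteq> J}. sum f F)"
    by (rule nonneg_infsum_complete) simp
  define F where "F n = {j\<in>J. to_nat j < n}" for n
  have fin: "finite (F n)" for n
    by (rule finite_imageD[of to_nat]) (auto simp: F_def intro: finite_subset[of _ "{..<n}"])
  have ind: "(\<integral>\<^sup>+j. f j * indicator A j \<partial>count_space UNIV) = sum f A" if "finite A" for A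
    using that by (subst nn_integral_count_space'[of A]) (auto simp: indicator_def)
  have "(\<integral>\<^sup>+j. f j * indicator J j \<partial>count_space UNIV)
      = (\<integral>\<^sup>+j. (SUP n. f j * indicator (F n) j) \<partial>count_space UNIV)"
  proof (intro nn_integral_cong antisym)
    fix j
    show "f j * indicator J j \<le> (SUP n. f j * indicator (F n) j)"
      by (rule SUP_upper2[of "Suc (to_nat j)"]) (auto simp: F_def indicator_def)
    show "(SUP n. f j * indicator (F n) j) \<le> f j * indicator J j"
      by (rule SUP_least) (auto simp: F_def indicator_def)
  qed
  also have "\<dots> = (SUP n. \<integral>\<^sup>+j. f j * indicator (F n) j \<partial>count_space UNIV)"
    by (rule nn_integral_monotone_convergence_SUP)
      (auto simp: incseq_def le_fun_def F_def indicator_def)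
  also have "\<dots> = (SUP n. sum f (F n))" by (simp add: ind fin)
  finally have eq: "(\<integral>\<^sup>+j. f j * indicator J j \<partial>count_space UNIV) = (SUP n. sum f (F n))" .
  show ?thesis
  proof (rule antisym)
    show "(\<Sum>\<^sub>\<infinity>j\<in>J. f j) \<le> (\<integral>\<^sup>+j. f j * indicator J j \<partial>count_space UNIV)"
      unfolding sup
    proof (rule SUP_least)
      fix A assume A: "A \<in> {F. finite F \<and> F \<subseteq> J}"
      then have "sum f A = (\<integral>\<^sup>+j. f j * indicator A j \<partial>count_space UNIV)" by (simp add: ind)
      also have "\<dots> \<le> (\<integral>\<^sup>+j. f j * indicator J j \<partial>count_space UNIV)"
        using A by (intro nn_integral_mono) (auto simp: indicator_def)
      finally show "sum f A \<le> (\<integral>\<^sup>+j. f j * indicator J j \<partial>count_space UNIV)" .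
    qed
    show "(\<integral>\<^sup>+j. f j * indicator J j \<partial>count_space UNIV) \<le> (\<Sum>\<^sub>\<infinity>j\<in>J. f j)"
      unfolding eq sup using fin by (intro SUP_mono) (auto simp: F_def)
  qed
qed

lemma infsum_Times_ennreal:
  fixes f :: "'i::countable \<Rightarrow> 'j::countable \<Rightarrow> ennreal"
  shows "(\<Sum>\<^sub>\<infinity>i\<in>A. \<Sum>\<^sub>\<infinity>j\<in>B. f i j) = (\<Sum>\<^sub>\<infinity>(i, j)\<in>A \<times> B. f i j)"
proof -
  have "(\<Sum>\<^sub>\<infinity>i\<in>A. \<Sum>\<^sub>\<infinity>j\<in>B. f i j)
      = (\<integral>\<^sup>+i. \<integral>\<^sup>+j. (\<lambda>(i, j). f i j * indicator (A \<times> B) (i, j)) (i, j) \<partial>count_space UNIV \<partial>count_space UNIV)"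
    unfolding infsum_ennreal_eq_nn_integral
    by (intro nn_integral_cong) (auto simp: indicator_def)
  also have "\<dots> = (\<Sum>\<^sub>\<infinity>(i, j)\<in>A \<times> B. f i j)"
    unfolding infsum_ennreal_eq_nn_integral nn_integral_fst_count_space
    by (intro nn_integral_cong) auto
  finally show ?thesis .
qed

lemma infsum_swap_ennreal:
  fixes f :: "'i::countable \<Rightarrow> 'j::countable \<Rightarrow> ennreal"
  shows "(\<Sum>\<^sub>\<infinity>i\<in>A. \<Sum>\<^sub>\<infinity>j\<in>B. f i j) = (\<Sum>\<^sub>\<infinity>j\<in>B. \<Sum>\<^sub>\<infinity>i\<in>A. f i j)"
proof -
  have "(\<Sum>\<^sub>\<infinity>(i, j)\<in>A \<times> B. f i j) = (\<Sum>\<^sub>\<infinity>(j, i)\<in>B \<times> A. f i j)"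
    by (rule infsum_reindex_bij_witness[where i = prod.swap and j = prod.swap]) auto
  then show ?thesis by (simp add: infsum_Times_ennreal)
qed


section \<open>Hilbert spaces with a carrier\<close>

context hilbert_space
begin

lemma smult_closed_complex [simp]: "u \<in> carrier H \<Longrightarrow> c \<odot> u \<in> carrier H"
  using smult_closed by (simp add: complex_ring_def)

lemma hinner_add_right:
  "\<lbrakk>u \<in> carrier H; v \<in> carrier H; w \<in> carrier H\<rbrakk> \<Longrightarrow>
    hinner H u (v \<oplus> w) = hinner H u v + hinner H u w"
  by (metis M.add.m_closed complex_cnj_add hinner_add_left hinner_commute)

lemma hinner_smult_right:
  "\<lbrakk>u \<in> carrier H; v \<in> carrier H\<rbrakk> \<Longrightarrow> hinner H u (c \<odot> v) = cnj c * hinner H u v"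
  by (metis complex_cnj_mult hinner_commute hinner_smult_left smult_closed_complex)

lemma hinner_zero_left [simp]: "u \<in> carrier H \<Longrightarrow> hinner H \<zero> u = 0"
  by (metis M.add.r_one M.zero_closed add_cancel_right_left hinner_add_left)

lemma hinner_zero_right [simp]: "u \<in> carrier H \<Longrightarrow> hinner H u \<zero> = 0"
  by (metis M.zero_closed complex_cnj_zero hinner_commute hinner_zero_left)

lemma hinner_minus_left:
  assumes "u \<in> carrier H" "v \<in> carrier H" "w \<in> carrier H"
  shows "hinner H (u \<ominus> v) w = hinner H u w - hinner H v w"
proof -
  have "hinner H ((u \<ominus> v) \<oplus> v) w = hinner H (u \<ominus> v) w + hinner H v w"
    using assms by (intro hinner_add_left) auto
  moreover have "(u \<ominus> v) \<oplus> v = u"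
    using assms by (simp add: M.minus_eq M.add.m_assoc M.l_neg)
  ultimately show ?thesis by simp
qed

lemma minus_eq_zero_imp_eq:
  assumes "u \<in> carrier H" "w \<in> carrier H" "u \<ominus> w = \<zero>"
  shows "u = w"
proof -
  have "(u \<ominus> w) \<oplus> w = u"
    using assms(1,2) by (simp add: M.minus_eq M.add.m_assoc M.l_neg)
  moreover have "(u \<ominus> w) \<oplus> w = w"
    unfolding assms(3) using assms(2) by simp
  ultimately show ?thesis by simp
qed

lemma hinner_minus_right:
  assumes "u \<in> carrier H" "v \<in> carrier H" "w \<in> carrier H"
  shows "hinner H w (u \<ominus> v) = hinner H w u - hinner H w v"
  using assms hinner_minus_left[of u v w] hinner_commute[of "u \<ominus> v" w] hinner_commute[of u w]
    hinner_commute[of v w]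
  by simp

lemma hinner_finsum_left:
  assumes "finite F" "b \<in> F \<rightarrow> carrier H" "w \<in> carrier H"
  shows "hinner H (\<Oplus>v\<in>F. c v \<odot> b v) w = (\<Sum>v\<in>F. c v * hinner H (b v) w)"
  using assms
proof (induction F rule: finite_induct)
  case (insert x F)
  have "(\<Oplus>v\<in>insert x F. c v \<odot> b v) = c x \<odot> b x \<oplus> (\<Oplus>v\<in>F. c v \<odot> b v)"
    using insert by (intro M.finsum_insert) (auto simp: Pi_iff)
  moreover have "(\<Oplus>v\<in>F. c v \<odot> b v) \<in> carrier H"
    using insert by (intro M.finsum_closed) (auto simp: Pi_iff)
  ultimately show ?case
    using insert by (simp add: hinner_add_left hinner_smult_left Pi_iff)
qed simp

lemma finsum_smult_closed [simp]:
  "b \<in> F \<rightarrow> carrier H \<Longrightarrow> (\<Oplus>v\<in>F. c v \<odot> b v) \<in> carrier H"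
  by (intro M.finsum_closed) (auto simp: Pi_iff)

lemma hinner_finsum_right:
  assumes "finite F" "b \<in> F \<rightarrow> carrier H" "w \<in> carrier H"
  shows "hinner H w (\<Oplus>v\<in>F. c v \<odot> b v) = (\<Sum>v\<in>F. cnj (c v) * hinner H w (b v))"
proof -
  have "hinner H w (\<Oplus>v\<in>F. c v \<odot> b v) = cnj (hinner H (\<Oplus>v\<in>F. c v \<odot> b v) w)"
    using assms by (intro hinner_commute) auto
  also have "\<dots> = (\<Sum>v\<in>F. cnj (c v) * cnj (hinner H (b v) w))"
    using assms by (simp add: hinner_finsum_left cnj_sum)
  also have "\<dots> = (\<Sum>v\<in>F. cnj (c v) * hinner H w (b v))"
    using assms by (intro sum.cong refl arg_cong2[where f="(*)"] hinner_commute[symmetric]) auto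
  finally show ?thesis .
qed

lemma hinner_self: "u \<in> carrier H \<Longrightarrow> hinner H u u = of_real ((hnorm H u)\<^sup>2)"
  unfolding hnorm_def using hinner_nonneg[of u] hinner_commute[of u u]
  by (simp add: complex_eq_iff)

lemma hnorm_sq: "u \<in> carrier H \<Longrightarrow> (hnorm H u)\<^sup>2 = Re (hinner H u u)"
  by (simp add: hinner_self)

lemma hnorm_nonneg [simp]: "u \<in> carrier H \<Longrightarrow> 0 \<le> hnorm H u"
  unfolding hnorm_def using hinner_nonneg by simp

lemma hnorm_smult_add_sq:
  assumes "u \<in> carrier H" "v \<in> carrier H"
  shows "(hnorm H (u \<oplus> c \<odot> v))\<^sup>2
    = (hnorm H u)\<^sup>2 + 2 * Re (cnj c * hinner H u v) + (cmod c)\<^sup>2 * (hnorm H v)\<^sup>2"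
proof -
  have "complex_of_real ((hnorm H (u \<oplus> c \<odot> v))\<^sup>2) = hinner H (u \<oplus> c \<odot> v) (u \<oplus> c \<odot> v)"
    using assms by (simp add: hinner_self)
  also have "\<dots> = hinner H u u + cnj c * hinner H u v + cnj (cnj c * hinner H u v)
      + c * cnj c * hinner H v v"
    using assms hinner_commute[of u v]
    by (simp add: hinner_add_left hinner_add_right hinner_smult_left hinner_smult_right algebra_simps)
  finally have "Re (complex_of_real ((hnorm H (u \<oplus> c \<odot> v))\<^sup>2)) = Re \<dots>" by simp
  also have "c * cnj c * hinner H v v = of_real ((cmod c)\<^sup>2 * (hnorm H v)\<^sup>2)"
    using assms by (simp add: hinner_self complex_norm_square[symmetric])
  finally show ?thesis
    using assms by (simp add: hnorm_sq)
qed

lemma hnorm_diff_sq: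
  assumes "u \<in> carrier H" "v \<in> carrier H"
  shows "(hnorm H (u \<ominus> v))\<^sup>2 = (hnorm H u)\<^sup>2 - 2 * Re (hinner H u v) + (hnorm H v)\<^sup>2"
proof -
  have "Re (hinner H v u) = Re (hinner H u v)"
    using assms hinner_commute[of u v] by simp
  then show ?thesis
    using assms by (simp add: hnorm_sq hinner_minus_left hinner_minus_right)
qed

lemma hinner_Cauchy_Schwarz:
  assumes "u \<in> carrier H" "v \<in> carrier H"
  shows "cmod (hinner H u v) \<le> hnorm H u * hnorm H v"
proof (cases "hnorm H v = 0")
  case True
  then have "v = \<zero>" using assms by (intro hinner_definite) (auto simp: hinner_self)
  then show ?thesis using assms by simp
next
  case False
  define n where "n = (hnorm H v)\<^sup>2"
  have n: "n > 0" using False by (simp add: n_def)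
  \<comment> \<open>With this \<open>c\<close> the vector \<open>u + c v\<close> is the component of \<open>u\<close> orthogonal to \<open>v\<close>.\<close>
  define c where "c = - hinner H u v / n"
  have "0 \<le> (hnorm H (u \<oplus> c \<odot> v))\<^sup>2" by simp
  also have "\<dots> = (hnorm H u)\<^sup>2 + 2 * Re (cnj c * hinner H u v) + (cmod c)\<^sup>2 * n"
    using assms by (simp add: hnorm_smult_add_sq n_def)
  also have "cnj c * hinner H u v = - of_real ((cmod (hinner H u v))\<^sup>2 / n)"
  proof -
    have "cnj c * hinner H u v = - (hinner H u v * cnj (hinner H u v) / of_real n)"
      by (simp add: c_def)
    then show ?thesis by (simp only: complex_norm_square[symmetric] of_real_divide)
  qed
  also have "(cmod c)\<^sup>2 * n = (cmod (hinner H u v))\<^sup>2 / n"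
  proof -
    have "cmod c = cmod (hinner H u v) / n" using n by (simp add: c_def norm_divide)
    then show ?thesis using n by (simp only: power2_eq_square) simp
  qed
  finally have "(cmod (hinner H u v))\<^sup>2 / n \<le> (hnorm H u)\<^sup>2" by simp
  then have "(cmod (hinner H u v))\<^sup>2 \<le> (hnorm H u)\<^sup>2 * n"
    using n by (simp add: pos_divide_le_eq)
  then have "(cmod (hinner H u v))\<^sup>2 \<le> (hnorm H u * hnorm H v)\<^sup>2"
    by (simp add: n_def power_mult_distrib)
  then show ?thesis
    by (rule power2_le_imp_le) (simp add: assms)
qed

end

text \<open>
  A subfamily of an orthonormal basis is orthonormal, but in general no longer total; finite
  subfamilies carry the computations with partial sums.
\<close>

definition orthonormal_family :: "'h hilb \<Rightarrow> 'i set \<Rightarrow> ('i \<Rightarrow> 'h) \<Rightarrow> bool" where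
  "orthonormal_family H F b \<longleftrightarrow> b \<in> F \<rightarrow> carrier H \<and>
     (\<forall>j\<in>F. \<forall>k\<in>F. hinner H (b j) (b k) = (if j = k then 1 else 0))"

context hilbert_space
begin

lemma hnorm_sq_finsum_orthonormal:
  assumes "finite F" "orthonormal_family H F b"
  shows "(hnorm H (\<Oplus>j\<in>F. c j \<odot> b j))\<^sup>2 = (\<Sum>j\<in>F. (cmod (c j))\<^sup>2)"
proof -
  have b: "b \<in> F \<rightarrow> carrier H" using assms by (simp add: orthonormal_family_def)
  have "hinner H (\<Oplus>j\<in>F. c j \<odot> b j) (\<Oplus>j\<in>F. c j \<odot> b j)
      = (\<Sum>i\<in>F. c i * hinner H (b i) (\<Oplus>j\<in>F. c j \<odot> b j))"
    using assms b by (simp add: hinner_finsum_left)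
  also have "\<dots> = (\<Sum>i\<in>F. c i * (\<Sum>j\<in>F. cnj (c j) * hinner H (b i) (b j)))"
    using assms b by (intro sum.cong refl arg_cong2[where f="(*)"] hinner_finsum_right) auto
  also have "\<dots> = (\<Sum>i\<in>F. c i * cnj (c i))"
    using assms
    by (intro sum.cong refl) (auto simp: orthonormal_family_def if_distrib[of "(*) _"] cong: if_cong)
  also have "\<dots> = of_real (\<Sum>j\<in>F. (cmod (c j))\<^sup>2)"
    by (simp add: complex_norm_square[symmetric])
  finally show ?thesis
    using b by (simp add: hnorm_sq)
qed

text \<open>
  Completing the square in the coefficients: the last sum vanishes exactly for the Fourier
  coefficients, which gives Bessel's inequality and the optimality of these coefficients.
\<close>

lemma hnorm_sq_diff_finsum_orthonormal:
  assumes "finite F" "orthonormal_family H F b" "u \<in> carrier H"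
  shows "(hnorm H (u \<ominus> (\<Oplus>j\<in>F. c j \<odot> b j)))\<^sup>2
    = (hnorm H u)\<^sup>2 - (\<Sum>j\<in>F. (cmod (hinner H u (b j)))\<^sup>2)
      + (\<Sum>j\<in>F. (cmod (hinner H u (b j) - c j))\<^sup>2)"
proof -
  have b: "b \<in> F \<rightarrow> carrier H" using assms by (simp add: orthonormal_family_def)
  have "(hnorm H (u \<ominus> (\<Oplus>j\<in>F. c j \<odot> b j)))\<^sup>2
      = (hnorm H u)\<^sup>2 - 2 * Re (\<Sum>j\<in>F. cnj (c j) * hinner H u (b j)) + (\<Sum>j\<in>F. (cmod (c j))\<^sup>2)"
    using assms b by (simp add: hnorm_diff_sq hnorm_sq_finsum_orthonormal hinner_finsum_right)
  also have "\<dots> = (hnorm H u)\<^sup>2 + (\<Sum>j\<in>F. (cmod (c j))\<^sup>2 - 2 * Re (cnj (c j) * hinner H u (b j)))"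
    by (simp add: sum_subtractf sum_distrib_left)
  also have "(\<Sum>j\<in>F. (cmod (c j))\<^sup>2 - 2 * Re (cnj (c j) * hinner H u (b j)))
      = (\<Sum>j\<in>F. (cmod (hinner H u (b j) - c j))\<^sup>2 - (cmod (hinner H u (b j)))\<^sup>2)"
    by (intro sum.cong refl) (simp add: cmod_power2, simp add: power2_eq_square algebra_simps)
  finally show ?thesis by (simp add: sum_subtractf)
qed

lemma orthonormal_basis_imp_family:
  assumes "orthonormal_basis H J b"
  shows "orthonormal_family H J b"
  using assms by (auto simp: orthonormal_basis_def orthonormal_family_def total_in_def)

lemma orthonormal_family_subset:
  "orthonormal_family H J b \<Longrightarrow> F \<subseteq> J \<Longrightarrow> orthonormal_family H F b"
  unfolding orthonormal_family_def by blast

lemma orthonormal_basis_closed: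
  "orthonormal_basis H J b \<Longrightarrow> j \<in> J \<Longrightarrow> b j \<in> carrier H"
  by (auto simp: orthonormal_basis_def total_in_def)

lemma Bessel_finite:
  assumes "orthonormal_family H F b" "finite F" "u \<in> carrier H"
  shows "(\<Sum>j\<in>F. (cmod (hinner H u (b j)))\<^sup>2) \<le> (hnorm H u)\<^sup>2"
  using hnorm_sq_diff_finsum_orthonormal[OF assms(2,1,3), of "\<lambda>j. hinner H u (b j)"]
    zero_le_power2[of "hnorm H (u \<ominus> (\<Oplus>j\<in>F. hinner H u (b j) \<odot> b j))"]
  by simp

text \<open>
  Total sets are described by combinations of distinct vectors; sums over indices are more
  convenient, and an index set on which \<open>b\<close> is injective converts one into the other.
\<close>

lemma total_approx:
  assumes "total_in H (b ` J)" "u \<in> carrier H" "\<epsilon> > 0"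
  obtains F c where "finite F" "F \<subseteq> J" "inj_on b F" "hdist H u (\<Oplus>j\<in>F. c j \<odot> b j) < \<epsilon>"
proof -
  obtain V c where V: "finite V" "V \<subseteq> b ` J" and d: "hdist H u (\<Oplus>v\<in>V. c v \<odot> v) < \<epsilon>"
    using assms unfolding total_in_def by meson
  obtain F where F: "F \<subseteq> J" "V = b ` F" "inj_on b F"
    using V(2) subset_image_inj[of V b J] by blast
  have cl: "b ` F \<subseteq> carrier H"
    using assms(1) F by (auto simp: total_in_def)
  have "(\<Oplus>v\<in>V. c v \<odot> v) = (\<Oplus>j\<in>F. c (b j) \<odot> b j)"
    unfolding F(2) using cl F(3) by (intro M.finsum_reindex) auto
  with d F V that[of F "\<lambda>j. c (b j)"] show ?thesis
    using finite_image_iff[of b F] by metis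
qed

text \<open>
  Among all combinations of finitely many basis vectors, the one with the Fourier coefficients is
  closest to \<open>u\<close>; totality therefore makes the Bessel defect arbitrarily small.
\<close>

lemma Parseval:
  assumes b: "orthonormal_basis H J b" and u: "u \<in> carrier H"
  shows "(\<Sum>\<^sub>\<infinity>j\<in>J. ennreal ((cmod (hinner H u (b j)))\<^sup>2)) = ennreal ((hnorm H u)\<^sup>2)"
proof (rule antisym)
  have fam: "orthonormal_family H J b" by (rule orthonormal_basis_imp_family[OF b])
  have sup: "(\<Sum>\<^sub>\<infinity>j\<in>J. ennreal ((cmod (hinner H u (b j)))\<^sup>2))
      = (SUP F\<in>{F. finite F \<and> F \<subseteq> J}. \<Sum>j\<in>F. ennreal ((cmod (hinner H u (b j)))\<^sup>2))"
    by (rule nonneg_infsum_complete) simp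
  show "(\<Sum>\<^sub>\<infinity>j\<in>J. ennreal ((cmod (hinner H u (b j)))\<^sup>2)) \<le> ennreal ((hnorm H u)\<^sup>2)"
    unfolding sup
    using Bessel_finite[OF orthonormal_family_subset[OF fam]] u
    by (intro SUP_least) (auto simp: sum_nonneg intro!: ennreal_leI)
  show "ennreal ((hnorm H u)\<^sup>2) \<le> (\<Sum>\<^sub>\<infinity>j\<in>J. ennreal ((cmod (hinner H u (b j)))\<^sup>2))"
  proof (rule ennreal_le_epsilon)
    fix e :: real assume e: "e > 0"
    obtain F c where F: "finite F" "F \<subseteq> J" and d: "hdist H u (\<Oplus>j\<in>F. c j \<odot> b j) < sqrt e"
      using total_approx[of b J u "sqrt e"] b u e unfolding orthonormal_basis_def
      by (metis real_sqrt_gt_zero)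
    have famF: "orthonormal_family H F b" by (rule orthonormal_family_subset[OF fam F(2)])
    then have cl: "(\<Oplus>j\<in>F. c j \<odot> b j) \<in> carrier H"
      by (simp add: orthonormal_family_def)
    have "(hdist H u (\<Oplus>j\<in>F. c j \<odot> b j))\<^sup>2 \<le> (sqrt e)\<^sup>2"
      using d cl u by (intro power_mono) (auto simp: hdist_def)
    then have "(hnorm H u)\<^sup>2 \<le> (\<Sum>j\<in>F. (cmod (hinner H u (b j)))\<^sup>2) + e"
      using hnorm_sq_diff_finsum_orthonormal[OF F(1) famF u, of c] e
        sum_nonneg[of F "\<lambda>j. (cmod (hinner H u (b j) - c j))\<^sup>2"]
      by (simp add: hdist_def)
    then have "ennreal ((hnorm H u)\<^sup>2) \<le> (\<Sum>j\<in>F. ennreal ((cmod (hinner H u (b j)))\<^sup>2)) + ennreal e"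
      using e by (subst sum_ennreal) (auto simp: sum_nonneg simp del: ennreal_plus simp flip: ennreal_plus intro!: ennreal_leI)
    also have "\<dots> \<le> (\<Sum>\<^sub>\<infinity>j\<in>J. ennreal ((cmod (hinner H u (b j)))\<^sup>2)) + ennreal e"
      unfolding sup using F by (intro add_right_mono SUP_upper) auto
    finally show "ennreal ((hnorm H u)\<^sup>2)
        \<le> (\<Sum>\<^sub>\<infinity>j\<in>J. ennreal ((cmod (hinner H u (b j)))\<^sup>2)) + ennreal e" .
  qed
qed

lemma hinner_left_cancel:
  assumes "u \<in> carrier H" "w \<in> carrier H" "\<And>v. v \<in> carrier H \<Longrightarrow> hinner H u v = hinner H w v"
  shows "u = w"
proof -
  have "hinner H (u \<ominus> w) (u \<ominus> w) = 0"
    using assms by (simp add: hinner_minus_left)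
  then have "u \<ominus> w = \<zero>" using assms(1,2) by (intro hinner_definite) auto
  then show ?thesis by (rule minus_eq_zero_imp_eq[OF assms(1,2)])
qed

text \<open>
  If \<open>u\<close> is orthogonal to a total family, then its distance to any combination of the family is at
  least its norm, whereas combinations come arbitrarily close to \<open>u\<close>.
\<close>

lemma total_eq_zeroI:
  assumes "total_in H (b ` J)" "u \<in> carrier H" "\<And>j. j \<in> J \<Longrightarrow> hinner H u (b j) = 0"
  shows "u = \<zero>"
proof (rule ccontr)
  assume "u \<noteq> \<zero>"
  then have pos: "hnorm H u > 0"
    using assms(2) hinner_definite[of u] hnorm_nonneg[of u] hinner_self[of u]
    by (cases "hnorm H u = 0") (auto simp: order_less_le)
  obtain F c where F: "finite F" "F \<subseteq> J" and d: "hdist H u (\<Oplus>j\<in>F. c j \<odot> b j) < hnorm H u"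
    using total_approx[OF assms(1,2) pos] by metis
  have b: "b \<in> F \<rightarrow> carrier H"
    using assms(1) F(2) by (auto simp: total_in_def)
  have "hinner H u (\<Oplus>j\<in>F. c j \<odot> b j) = 0"
    using assms(2,3) F b by (simp add: hinner_finsum_right subset_iff)
  then have "(hnorm H u)\<^sup>2 \<le> (hdist H u (\<Oplus>j\<in>F. c j \<odot> b j))\<^sup>2"
    using assms(2) b by (simp add: hdist_def hnorm_diff_sq)
  moreover have "(hdist H u (\<Oplus>j\<in>F. c j \<odot> b j))\<^sup>2 < (hnorm H u)\<^sup>2"
    using d assms(2) b by (intro power_strict_mono) (auto simp: hdist_def)
  ultimately show False by simp
qed

lemma hinner_tendsto_left:
  assumes "range s \<subseteq> carrier H" "u \<in> carrier H" "v \<in> carrier H"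
    and "(\<lambda>n. hdist H (s n) u) \<longlonglongrightarrow> 0"
  shows "(\<lambda>n. hinner H (s n) v) \<longlonglongrightarrow> hinner H u v"
proof (rule Lim_null_comparison[THEN LIM_zero_cancel])
  show "\<forall>\<^sub>F n in sequentially. norm (hinner H (s n) v - hinner H u v) \<le> hdist H (s n) u * hnorm H v"
  proof (intro always_eventually allI)
    fix n
    have s: "s n \<in> carrier H" using assms(1) by auto
    have "norm (hinner H (s n) v - hinner H u v) = norm (hinner H (s n \<ominus> u) v)"
      using hinner_minus_left[OF s assms(2,3)] by simp
    also have "\<dots> \<le> hnorm H (s n \<ominus> u) * hnorm H v"
      by (rule hinner_Cauchy_Schwarz[OF M.minus_closed[OF s assms(2)] assms(3)])
    finally show "norm (hinner H (s n) v - hinner H u v) \<le> hdist H (s n) u * hnorm H v"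
      unfolding hdist_def .
  qed
  show "(\<lambda>n. hdist H (s n) u * hnorm H v) \<longlonglongrightarrow> 0"
    using tendsto_mult_left_zero[OF assms(4)] .
qed

text \<open>
  The representation theorem of Riesz, with the representing vector written down as the orthogonal
  series of the values of \<open>L\<close> on the basis. Testing \<open>L\<close> on a finite section of that series bounds
  the square sum of its coefficients by \<open>B\<^sup>2\<close>.
\<close>

lemma Riesz_representation:
  assumes b: "orthonormal_basis H J b"
    and add: "\<And>u v. u \<in> carrier H \<Longrightarrow> v \<in> carrier H \<Longrightarrow> L (u \<oplus> v) = L u + L v"
    and smult: "\<And>c u. u \<in> carrier H \<Longrightarrow> L (c \<odot> u) = cnj c * L u"
    and bound: "\<And>u. u \<in> carrier H \<Longrightarrow> cmod (L u) \<le> B * hnorm H u"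
  shows "\<exists>w\<in>carrier H. \<forall>v\<in>carrier H. hinner H w v = L v"
proof -
  have fam: "orthonormal_family H J b" by (rule orthonormal_basis_imp_family[OF b])
  have bJ: "b j \<in> carrier H" if "j \<in> J" for j using fam that by (auto simp: orthonormal_family_def)
  have L_finsum: "L (\<Oplus>j\<in>F. c j \<odot> b j) = (\<Sum>j\<in>F. cnj (c j) * L (b j))"
    if "finite F" "F \<subseteq> J" for F c
    using that
  proof (induction F rule: finite_induct)
    case empty
    have "L (0 \<odot> \<zero>) = 0" by (simp add: smult)
    moreover have "0 \<odot> \<zero> = \<zero>" using smult_r_null[of 0] by (simp add: complex_ring_def)
    ultimately have "L \<zero> = 0" by simp
    then show ?case by simp
  next
    case (insert x F)
    have "(\<Oplus>j\<in>insert x F. c j \<odot> b j) = c x \<odot> b x \<oplus> (\<Oplus>j\<in>F. c j \<odot> b j)"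
      using insert bJ by (intro M.finsum_insert) (auto simp: Pi_iff)
    moreover have "b \<in> F \<rightarrow> carrier H" using bJ insert.prems by auto
    ultimately show ?case using insert bJ by (simp add: add smult)
  qed
  have tot: "total_in H (b ` J)" using b by (simp add: orthonormal_basis_def)
  have B0: "B \<ge> 0 \<or> J = {}"
  proof (cases "J = {}")
    case False
    then obtain j where j: "j \<in> J" by auto
    then have "hnorm H (b j) = 1" using fam by (simp add: orthonormal_family_def hnorm_def)
    then have "cmod (L (b j)) \<le> B" using bound[OF bJ[OF j]] by simp
    then show ?thesis using norm_ge_zero[of "L (b j)"] by linarith
  qed simp
  have sumB: "(\<Sum>j\<in>F. (cmod (L (b j)))\<^sup>2) \<le> B\<^sup>2" if F: "finite F" "F \<subseteq> J" for F
  proof (cases "(\<Sum>j\<in>F. (cmod (L (b j)))\<^sup>2) = 0")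
    case False
    define S where "S = (\<Sum>j\<in>F. (cmod (L (b j)))\<^sup>2)"
    define w where "w = (\<Oplus>j\<in>F. L (b j) \<odot> b j)"
    have famF: "orthonormal_family H F b" by (rule orthonormal_family_subset[OF fam F(2)])
    have w: "w \<in> carrier H" using famF by (simp add: w_def orthonormal_family_def)
    have S0: "S > 0" using False by (simp add: S_def sum_nonneg order_less_le)
    have "L w = of_real S"
      unfolding w_def S_def using F by (simp only: L_finsum of_real_sum complex_norm_square mult.commute)
    then have "S \<le> B * hnorm H w" using bound[OF w] S0 by simp
    moreover have "(hnorm H w)\<^sup>2 = S"
      using F famF by (simp add: w_def S_def hnorm_sq_finsum_orthonormal)
    moreover from this have "hnorm H w > 0"
      using S0 hnorm_nonneg[OF w] by (cases "hnorm H w = 0") auto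
    ultimately have "hnorm H w * hnorm H w \<le> B * hnorm H w" and pos: "hnorm H w > 0"
      by (auto simp: power2_eq_square)
    then have "hnorm H w \<le> B" by simp
    then have "(hnorm H w)\<^sup>2 \<le> B\<^sup>2" using pos by (intro power_mono) auto
    then show ?thesis
      using \<open>(hnorm H w)\<^sup>2 = S\<close> by (simp add: S_def)
  qed simp
  \<comment> \<open>The norms of the differences of the partial sums \<open>s n\<close> are differences of the partial sums
    of the convergent series \<open>t\<close>, so \<open>s\<close> is a Cauchy sequence.\<close>
  define t where "t n = (if n \<in> J then (cmod (L (b n)))\<^sup>2 else 0)" for n
  have t_sum: "sum t A = (\<Sum>j\<in>A \<inter> J. (cmod (L (b j)))\<^sup>2)" if "finite A" for A
    using that by (simp add: t_def sum.inter_restrict)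
  have "summable t"
    by (rule summableI_nonneg_bounded[of _ "B\<^sup>2"]) (auto simp: t_sum intro!: sumB, simp add: t_def)
  then have Cau: "Cauchy (\<lambda>n. sum t {..<n})"
    by (simp add: summable_iff_convergent convergent_Cauchy)
  define s where "s n = (\<Oplus>j\<in>{..<n} \<inter> J. L (b j) \<odot> b j)" for n
  have s_cl: "s n \<in> carrier H" for n unfolding s_def using bJ by (intro finsum_smult_closed) auto
  have s_diff: "(hdist H (s n) (s m))\<^sup>2 = sum t {..<n} - sum t {..<m}" if "m \<le> n" for m n
  proof -
    have sp: "{..<n} \<inter> J = ({..<m} \<inter> J) \<union> ({m..<n} \<inter> J)" using that by auto
    have "s n = s m \<oplus> (\<Oplus>j\<in>{m..<n} \<inter> J. L (b j) \<odot> b j)"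
      unfolding s_def sp using bJ by (intro M.finsum_Un_disjoint) auto
    moreover have cl: "(\<Oplus>j\<in>{m..<n} \<inter> J. L (b j) \<odot> b j) \<in> carrier H"
      using bJ by (intro finsum_smult_closed) auto
    ultimately have "s n \<ominus> s m = (\<Oplus>j\<in>{m..<n} \<inter> J. L (b j) \<odot> b j)"
      using s_cl[of m] by (simp add: M.minus_eq M.add.m_comm M.r_neg1)
    then have "(hdist H (s n) (s m))\<^sup>2 = (\<Sum>j\<in>{m..<n} \<inter> J. (cmod (L (b j)))\<^sup>2)"
      unfolding hdist_def
      by (simp add: hnorm_sq_finsum_orthonormal orthonormal_family_subset[OF fam])
    also have "\<dots> = sum t {m..<n}" by (simp add: t_sum)
    also have "\<dots> = sum t {..<n} - sum t {..<m}"
      using that by (simp add: lessThan_atLeast0 sum_diff_nat_ivl)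
    finally show ?thesis .
  qed
  have sym: "hdist H (s m) (s n) = hdist H (s n) (s m)" for m n
  proof -
    have "(hdist H (s m) (s n))\<^sup>2 = (hdist H (s n) (s m))\<^sup>2"
      unfolding hdist_def using s_cl hinner_commute[of "s m" "s n"]
      by (simp add: hnorm_diff_sq)
    then show ?thesis
      using power2_eq_iff_nonneg[of "hdist H (s m) (s n)" "hdist H (s n) (s m)"] s_cl
      by (simp add: hdist_def)
  qed
  have "\<exists>u\<in>carrier H. (\<lambda>n. hdist H (s n) u) \<longlonglongrightarrow> 0"
  proof (rule hcomplete)
    show "range s \<subseteq> carrier H" using s_cl by auto
    show "\<forall>\<epsilon>>0. \<exists>N. \<forall>m\<ge>N. \<forall>n\<ge>N. hdist H (s m) (s n) < \<epsilon>"
    proof (intro allI impI)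
      fix \<epsilon> :: real assume e: "\<epsilon> > 0"
      then obtain N where N: "\<And>m n. m \<ge> N \<Longrightarrow> n \<ge> N \<Longrightarrow>
          norm (sum t {..<m} - sum t {..<n}) < \<epsilon>\<^sup>2"
        using CauchyD[OF Cau, of "\<epsilon>\<^sup>2"] by auto
      have *: "hdist H (s n) (s m) < \<epsilon>" if "m \<ge> N" "m \<le> n" for m n
      proof -
        have "(hdist H (s n) (s m))\<^sup>2 < \<epsilon>\<^sup>2"
          using N[of n m] that by (simp add: s_diff)
        then show ?thesis using e power2_less_imp_less[of _ \<epsilon>] by simp
      qed
      have "hdist H (s m) (s n) < \<epsilon>" if "m \<ge> N" "n \<ge> N" for m n
        using *[of m n] *[of n m] that sym[of m n] by (cases "m \<le> n") auto
      then show "\<exists>N. \<forall>m\<ge>N. \<forall>n\<ge>N. hdist H (s m) (s n) < \<epsilon>" by blast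
    qed
  qed
  then obtain w where w: "w \<in> carrier H" and lim: "(\<lambda>n. hdist H (s n) w) \<longlonglongrightarrow> 0" by auto
  have coeff: "hinner H w (b k) = L (b k)" if k: "k \<in> J" for k
  proof (rule LIMSEQ_unique)
    show "(\<lambda>n. hinner H (s n) (b k)) \<longlonglongrightarrow> hinner H w (b k)"
      using s_cl w bJ[OF k] lim by (intro hinner_tendsto_left) auto
    have "hinner H (s n) (b k) = L (b k)" if "n > k" for n
    proof -
      have "hinner H (s n) (b k) = (\<Sum>j\<in>{..<n} \<inter> J. L (b j) * hinner H (b j) (b k))"
        unfolding s_def using bJ k by (intro hinner_finsum_left) auto
      also have "\<dots> = (\<Sum>j\<in>{..<n} \<inter> J. if j = k then L (b j) else 0)"
        using fam k by (intro sum.cong refl) (auto simp: orthonormal_family_def)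
      also have "\<dots> = L (b k)" using that k by simp
      finally show ?thesis .
    qed
    then show "(\<lambda>n. hinner H (s n) (b k)) \<longlonglongrightarrow> L (b k)"
      by (intro tendsto_eventually eventually_sequentiallyI[of "Suc k"]) simp
  qed
  have "hinner H w v = L v" if v: "v \<in> carrier H" for v
  proof -
    define C where "C = hnorm H w + \<bar>B\<bar> + 1"
    have C: "C > 0" using w hnorm_nonneg[of w] unfolding C_def by linarith
    have "cmod (hinner H w v - L v) < e" if e: "e > 0" for e :: real
    proof -
      obtain F c where F: "finite F" "F \<subseteq> J" and d: "hdist H v (\<Oplus>j\<in>F. c j \<odot> b j) < e / C"
        using total_approx[OF tot v divide_pos_pos[OF e C]] by metis
      define q where "q = (\<Oplus>j\<in>F. c j \<odot> b j)"
      have q: "q \<in> carrier H" unfolding q_def using F bJ by (intro finsum_smult_closed) auto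
      have qq: "hinner H w q = L q"
      proof -
        have "hinner H w q = (\<Sum>j\<in>F. cnj (c j) * hinner H w (b j))"
          unfolding q_def using F w bJ by (intro hinner_finsum_right) auto
        also have "\<dots> = (\<Sum>j\<in>F. cnj (c j) * L (b j))"
          using F by (intro sum.cong refl) (simp add: coeff subset_iff)
        finally show ?thesis unfolding q_def by (simp add: L_finsum F)
      qed
      define r where "r = v \<ominus> q"
      have r: "r \<in> carrier H" using v q by (simp add: r_def)
      have vr: "v = r \<oplus> q" using v q by (simp add: r_def M.minus_eq M.add.m_assoc M.l_neg)
      have "cmod (hinner H w v - L v) = cmod (hinner H w r - L r)"
        unfolding vr using r q w by (simp add: hinner_add_right add qq)
      also have "\<dots> \<le> hnorm H w * hnorm H r + B * hnorm H r"
        using norm_triangle_ineq4[of "hinner H w r" "L r"] hinner_Cauchy_Schwarz[OF w r] bound[OF r]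
        by linarith
      also have "\<dots> \<le> C * hnorm H r"
      proof -
        have "B * hnorm H r \<le> (\<bar>B\<bar> + 1) * hnorm H r"
          using hnorm_nonneg[OF r] by (intro mult_right_mono) auto
        then show ?thesis by (simp add: C_def distrib_right)
      qed
      also have "\<dots> < e"
        using d C unfolding r_def q_def hdist_def by (simp only: pos_less_divide_eq mult.commute)
      finally show ?thesis .
    qed
    from this[of "cmod (hinner H w v - L v)"] show ?thesis by auto
  qed
  with w show ?thesis by blast
qed

text \<open>
  Whenever an operator has an adjoint, expanding both it and its adjoint by Parseval shows that the
  square sum over one basis equals the square sum over any other.
\<close>

lemma infsum_hnorm_sq_basis:
  assumes b: "orthonormal_basis H J b" and c: "orthonormal_basis H K c"
    and T: "\<And>u. u \<in> carrier H \<Longrightarrow> T u \<in> carrier H" and S: "\<And>u. u \<in> carrier H \<Longrightarrow> S u \<in> carrier H"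
    and adj: "\<And>u v. u \<in> carrier H \<Longrightarrow> v \<in> carrier H \<Longrightarrow> hinner H (T u) v = hinner H u (S v)"
  shows "(\<Sum>\<^sub>\<infinity>j\<in>J. ennreal ((hnorm H (T (b j)))\<^sup>2)) = (\<Sum>\<^sub>\<infinity>k\<in>K. ennreal ((hnorm H (S (c k)))\<^sup>2))"
proof -
  note bJ = orthonormal_basis_closed[OF b] and cK = orthonormal_basis_closed[OF c]
  have "(\<Sum>\<^sub>\<infinity>j\<in>J. ennreal ((hnorm H (T (b j)))\<^sup>2))
      = (\<Sum>\<^sub>\<infinity>j\<in>J. \<Sum>\<^sub>\<infinity>k\<in>K. ennreal ((cmod (hinner H (T (b j)) (c k)))\<^sup>2))"
    by (intro infsum_cong Parseval[OF c, symmetric] T bJ)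
  also have "\<dots> = (\<Sum>\<^sub>\<infinity>k\<in>K. \<Sum>\<^sub>\<infinity>j\<in>J. ennreal ((cmod (hinner H (T (b j)) (c k)))\<^sup>2))"
    by (rule infsum_swap_ennreal)
  also have "\<dots> = (\<Sum>\<^sub>\<infinity>k\<in>K. \<Sum>\<^sub>\<infinity>j\<in>J. ennreal ((cmod (hinner H (S (c k)) (b j)))\<^sup>2))"
  proof (intro infsum_cong)
    fix j k assume jk: "k \<in> K" "j \<in> J"
    have "cmod (hinner H (T (b j)) (c k)) = cmod (cnj (hinner H (S (c k)) (b j)))"
      using adj[OF bJ cK] hinner_commute[OF S[OF cK] bJ] jk by simp
    then show "ennreal ((cmod (hinner H (T (b j)) (c k)))\<^sup>2)
        = ennreal ((cmod (hinner H (S (c k)) (b j)))\<^sup>2)" by simp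
  qed
  also have "\<dots> = (\<Sum>\<^sub>\<infinity>k\<in>K. ennreal ((hnorm H (S (c k)))\<^sup>2))"
    by (intro infsum_cong Parseval[OF b] S cK)
  finally show ?thesis .
qed

lemma hs_norm_sq_eq:
  assumes b: "orthonormal_basis H J b"
    and T: "\<And>u. u \<in> carrier H \<Longrightarrow> T u \<in> carrier H" and S: "\<And>u. u \<in> carrier H \<Longrightarrow> S u \<in> carrier H"
    and adj: "\<And>u v. u \<in> carrier H \<Longrightarrow> v \<in> carrier H \<Longrightarrow> hinner H (T u) v = hinner H u (S v)"
  shows "hs_norm_sq H T = (\<Sum>\<^sub>\<infinity>j\<in>J. ennreal ((hnorm H (T (b j)))\<^sup>2))"
proof -
  \<comment> \<open>The basis \<open>b'\<close> chosen in the definition is unknown. Going from \<open>T\<close> in \<open>b'\<close> to \<open>S\<close> in \<open>b\<close>, and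
    then back to \<open>T\<close> within \<open>b\<close>, replaces it by \<open>b\<close>.\<close>
  define Jb where "Jb = (SOME (J, b). orthonormal_basis H J b)"
  obtain J' b' where Jb': "Jb = (J', b')" by (cases Jb)
  have "case Jb of (J, b) \<Rightarrow> orthonormal_basis H J b"
    unfolding Jb_def by (rule someI[of _ "(J, b)"]) (simp add: b)
  then have b': "orthonormal_basis H J' b'" by (simp add: Jb')
  have "hs_norm_sq H T = (\<Sum>\<^sub>\<infinity>j\<in>J'. ennreal ((hnorm H (T (b' j)))\<^sup>2))"
    unfolding hs_norm_sq_def Jb_def[symmetric] by (simp add: Jb')
  also have "\<dots> = (\<Sum>\<^sub>\<infinity>j\<in>J. ennreal ((hnorm H (S (b j)))\<^sup>2))"
    by (rule infsum_hnorm_sq_basis[OF b' b T S adj])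
  also have "\<dots> = (\<Sum>\<^sub>\<infinity>j\<in>J. ennreal ((hnorm H (T (b j)))\<^sup>2))"
    by (rule infsum_hnorm_sq_basis[OF b b T S adj, symmetric])
  finally show ?thesis .
qed

end


section \<open>Unitary representations and the group Fourier transform\<close>

lemma borel_measurable_cnj [measurable]: "cnj \<in> borel_measurable borel"
  by (intro borel_measurable_continuous_onI continuous_intros)

locale unitary_representation = hilbert_space H for H :: "'h hilb" (structure) +
  fixes \<pi> :: "'g::topological_group_add \<Rightarrow> 'h \<Rightarrow> 'h"
  assumes rep: "unitary_rep H \<pi>"
begin

lemma unitary: "unitary_map H H (\<pi> x)"
  using rep by (simp add: unitary_rep_def)

lemma rep_closed [simp]: "u \<in> carrier H \<Longrightarrow> \<pi> x u \<in> carrier H"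
  using unitary[of x] by (auto simp: unitary_map_def linear_map_def)

lemma rep_add: "u \<in> carrier H \<Longrightarrow> v \<in> carrier H \<Longrightarrow> \<pi> x (u \<oplus> v) = \<pi> x u \<oplus> \<pi> x v"
  using unitary[of x] by (auto simp: unitary_map_def linear_map_def)

lemma rep_smult: "u \<in> carrier H \<Longrightarrow> \<pi> x (c \<odot> u) = c \<odot> \<pi> x u"
  using unitary[of x] by (auto simp: unitary_map_def linear_map_def)

lemma rep_hinner: "u \<in> carrier H \<Longrightarrow> v \<in> carrier H \<Longrightarrow> hinner H (\<pi> x u) (\<pi> x v) = hinner H u v"
  using unitary[of x] by (auto simp: unitary_map_def)

lemma rep_hnorm: "u \<in> carrier H \<Longrightarrow> hnorm H (\<pi> x u) = hnorm H u"
  by (simp add: hnorm_def rep_hinner)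

lemma rep_plus: "u \<in> carrier H \<Longrightarrow> \<pi> (x + y) u = \<pi> x (\<pi> y u)"
  using rep by (simp add: unitary_rep_def)

lemma rep_zero: "u \<in> carrier H \<Longrightarrow> \<pi> 0 u = u"
  using rep by (simp add: unitary_rep_def)

lemma rep_adjoint:
  assumes "u \<in> carrier H" "v \<in> carrier H"
  shows "hinner H (\<pi> x u) v = hinner H u (\<pi> (- x) v)"
proof -
  have "hinner H u (\<pi> (- x) v) = hinner H (\<pi> x u) (\<pi> x (\<pi> (- x) v))"
    using assms by (simp add: rep_hinner)
  also have "\<pi> x (\<pi> (- x) v) = v"
    using assms by (simp add: rep_plus[symmetric] rep_zero)
  finally show ?thesis by simp
qed

text \<open>
  The adjoint is a definite description; uniqueness comes from the definiteness of the inner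
  product, so that exhibiting one vector with the defining property determines it.
\<close>

lemma hadjoint_eqI:
  assumes "u \<in> carrier H" "w \<in> carrier H"
    and "\<And>v. v \<in> carrier H \<Longrightarrow> hinner H (T v) u = hinner H v w"
  shows "hadjoint H T u = w"
  unfolding hadjoint_def
proof (rule the_equality)
  show "w \<in> carrier H \<and> (\<forall>v\<in>carrier H. hinner H (T v) u = hinner H v w)"
    using assms by blast
  fix w' assume w': "w' \<in> carrier H \<and> (\<forall>v\<in>carrier H. hinner H (T v) u = hinner H v w')"
  show "w' = w"
  proof (rule hinner_left_cancel)
    fix v assume v: "v \<in> carrier H"
    have "hinner H v w' = hinner H v w" using w' assms(3) v by metis
    then show "hinner H w' v = hinner H w v"
      using hinner_commute v w' assms(2) by metis
  qed (use w' assms in auto)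
qed

lemma hadjoint_rep: "u \<in> carrier H \<Longrightarrow> hadjoint H (\<pi> x) u = \<pi> (- x) u"
  by (rule hadjoint_eqI) (auto simp: rep_adjoint)

lemma hadjoint_localized_rep:
  assumes "u \<in> carrier H"
  shows "hadjoint H (localized_rep a H \<pi> x y) u = cnj (a (- x + y)) \<odot> \<pi> y u"
proof (rule hadjoint_eqI)
  fix v assume v: "v \<in> carrier H"
  show "hinner H (localized_rep a H \<pi> x y v) u = hinner H v (cnj (a (- x + y)) \<odot> \<pi> y u)"
    using v assms rep_adjoint[of v u "- y"]
    by (simp add: localized_rep_def hadjoint_rep hinner_smult_left hinner_smult_right)
qed (use assms in auto)

lemma frame_fun_eq:
  assumes "b k \<in> carrier H" "b l \<in> carrier H"
  shows "frame_fun a H \<pi> b x k l y = cnj (a (- x + y)) * hinner H (\<pi> y (b k)) (b l)"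
  using assms by (simp add: frame_fun_def hadjoint_localized_rep hinner_smult_left)

lemma cmod_coefficient_le:
  "u \<in> carrier H \<Longrightarrow> v \<in> carrier H \<Longrightarrow> cmod (hinner H (\<pi> x u) v) \<le> hnorm H u * hnorm H v"
  using hinner_Cauchy_Schwarz[of "\<pi> x u" v] by (simp add: rep_hnorm)

lemma continuous_coefficient:
  assumes u: "u \<in> carrier H" and v: "v \<in> carrier H"
  shows "continuous_on UNIV (\<lambda>x. hinner H (\<pi> x u) v)"
  unfolding continuous_on_def
proof (intro ballI)
  fix x
  have lim: "((\<lambda>y. hdist H (\<pi> y u) (\<pi> x u)) \<longlongrightarrow> 0) (at x)"
    using rep u by (simp add: unitary_rep_def)
  show "((\<lambda>x. hinner H (\<pi> x u) v) \<longlongrightarrow> hinner H (\<pi> x u) v) (at x within UNIV)"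
  proof (rule Lim_null_comparison[THEN LIM_zero_cancel])
    show "\<forall>\<^sub>F y in at x. norm (hinner H (\<pi> y u) v - hinner H (\<pi> x u) v)
        \<le> hdist H (\<pi> y u) (\<pi> x u) * hnorm H v"
    proof (intro always_eventually allI)
      fix y
      have "norm (hinner H (\<pi> y u) v - hinner H (\<pi> x u) v)
          = norm (hinner H (\<pi> y u \<ominus> \<pi> x u) v)"
        using u v by (simp add: hinner_minus_left)
      also have "\<dots> \<le> hnorm H (\<pi> y u \<ominus> \<pi> x u) * hnorm H v"
        using u v by (intro hinner_Cauchy_Schwarz) auto
      finally show "norm (hinner H (\<pi> y u) v - hinner H (\<pi> x u) v)
        \<le> hdist H (\<pi> y u) (\<pi> x u) * hnorm H v"
        unfolding hdist_def .
    qed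
    show "((\<lambda>y. hdist H (\<pi> y u) (\<pi> x u) * hnorm H v) \<longlongrightarrow> 0) (at x)"
      by (rule tendsto_mult_left_zero[OF lim])
  qed
qed

lemma coefficient_measurable [measurable]:
  assumes "u \<in> carrier H" "v \<in> carrier H" "sets M = sets borel"
  shows "(\<lambda>x. hinner H (\<pi> x u) v) \<in> borel_measurable M"
  using borel_measurable_continuous_onI[OF continuous_coefficient[OF assms(1,2)]]
    measurable_cong_sets[OF assms(3) refl] by blast

lemma integrable_times_coefficient:
  assumes M: "sets M = sets borel" and f: "integrable M f"
    and u: "u \<in> carrier H" and v: "v \<in> carrier H"
  shows "integrable M (\<lambda>z. f z * cnj (hinner H (\<pi> z v) u))"
proof (rule Bochner_Integration.integrable_bound)
  show "integrable M (\<lambda>z. hnorm H v * hnorm H u * norm (f z))"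
    using f by simp
  show "(\<lambda>z. f z * cnj (hinner H (\<pi> z v) u)) \<in> borel_measurable M"
    using borel_measurable_integrable[OF f] coefficient_measurable[OF v u M] by measurable
  show "AE z in M. norm (f z * cnj (hinner H (\<pi> z v) u)) \<le> norm (hnorm H v * hnorm H u * norm (f z))"
    using cmod_coefficient_le[OF v u] u v
    by (intro AE_I2) (simp add: norm_mult mult.commute mult_left_mono)
qed

lemma cmod_integral_coefficient_le:
  assumes M: "sets M = sets borel" and f: "integrable M f"
    and u: "u \<in> carrier H" and v: "v \<in> carrier H"
  shows "cmod (\<integral>z. f z * cnj (hinner H (\<pi> z v) u) \<partial>M) \<le> (\<integral>z. norm (f z) \<partial>M) * hnorm H u * hnorm H v"
proof -
  have "cmod (\<integral>z. f z * cnj (hinner H (\<pi> z v) u) \<partial>M)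
      \<le> (\<integral>z. norm (f z * cnj (hinner H (\<pi> z v) u)) \<partial>M)"
    by (rule integral_norm_bound)
  also have "\<dots> \<le> (\<integral>z. norm (f z) * (hnorm H v * hnorm H u) \<partial>M)"
    using integrable_times_coefficient[OF assms] f cmod_coefficient_le[OF v u]
    by (intro integral_mono integrable_norm) (auto simp: norm_mult mult_left_mono)
  finally show ?thesis by (simp add: mult_ac)
qed

text \<open>
  The weak integral exists: in \<open>v\<close> it is a conjugate-linear functional bounded by
  \<open>\<parallel>f\<parallel>\<^sub>1 \<parallel>u\<parallel> \<parallel>v\<parallel>\<close>, so Riesz' theorem provides the vector.
\<close>

lemma fourier_transform_weak:
  assumes b: "orthonormal_basis H J b" and M: "sets M = sets borel" and f: "integrable M f"
    and u: "u \<in> carrier H"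
  shows "fourier_transform M f H \<pi> u \<in> carrier H \<and>
    (\<forall>v\<in>carrier H. hinner H (fourier_transform M f H \<pi> u) v
       = (\<integral>z. f z * cnj (hinner H (\<pi> z v) u) \<partial>M))"
proof -
  define L where "L v = (\<integral>z. f z * cnj (hinner H (\<pi> z v) u) \<partial>M)" for v
  have "\<exists>w\<in>carrier H. \<forall>v\<in>carrier H. hinner H w v = L v"
  proof (rule Riesz_representation[OF b])
    fix v w assume v: "v \<in> carrier H" and w: "w \<in> carrier H"
    have "f z * cnj (hinner H (\<pi> z (v \<oplus> w)) u)
        = f z * cnj (hinner H (\<pi> z v) u) + f z * cnj (hinner H (\<pi> z w) u)" for z
      using u v w by (simp add: rep_add hinner_add_left distrib_left)
    then show "L (v \<oplus> w) = L v + L w"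
      unfolding L_def
      using integrable_times_coefficient[OF M f u v] integrable_times_coefficient[OF M f u w]
      by simp
  next
    fix c v assume v: "v \<in> carrier H"
    have "f z * cnj (hinner H (\<pi> z (c \<odot> v)) u) = cnj c * (f z * cnj (hinner H (\<pi> z v) u))" for z
      using u v by (simp add: rep_smult hinner_smult_left)
    then show "L (c \<odot> v) = cnj c * L v"
      unfolding L_def by (simp only: integral_mult_right_zero)
  next
    fix v assume v: "v \<in> carrier H"
    show "cmod (L v) \<le> ((\<integral>z. norm (f z) \<partial>M) * hnorm H u) * hnorm H v"
      unfolding L_def by (rule cmod_integral_coefficient_le[OF M f u v])
  qed
  then obtain w where w: "w \<in> carrier H" "\<And>v. v \<in> carrier H \<Longrightarrow> hinner H w v = L v" by auto
  have kernel: "hinner H (hadjoint H (\<pi> z) u) v = cnj (hinner H (\<pi> z v) u)" if "v \<in> carrier H" for z v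
    using that u rep_adjoint[of u v "- z"] hinner_commute[of "\<pi> z v" u]
    by (simp add: hadjoint_rep)
  have "fourier_transform M f H \<pi> u = w"
    unfolding fourier_transform_def
  proof (rule the_equality)
    show "w \<in> carrier H \<and>
        (\<forall>v\<in>carrier H. hinner H w v = (\<integral>z. f z * hinner H (hadjoint H (\<pi> z) u) v \<partial>M))"
      using w by (simp add: kernel L_def)
    fix w' assume w': "w' \<in> carrier H \<and>
        (\<forall>v\<in>carrier H. hinner H w' v = (\<integral>z. f z * hinner H (hadjoint H (\<pi> z) u) v \<partial>M))"
    show "w' = w"
      using w w' by (intro hinner_left_cancel) (auto simp: kernel L_def)
  qed
  then show ?thesis using w by (simp add: L_def)
qed

text \<open>
  The Fourier transform has an adjoint, again by Riesz' theorem, so its Hilbert--Schmidt norm can be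
  computed in the given basis. Its entry \<open>(T b\<^sub>l, b\<^sub>k)\<close> is the integral of \<open>f\<close> against the conjugate
  matrix coefficient with indices \<open>k\<close>, \<open>l\<close>.
\<close>

lemma hs_norm_sq_fourier_transform:
  assumes b: "orthonormal_basis H J b" and M: "sets M = sets borel" and f: "integrable M f"
  shows "hs_norm_sq H (fourier_transform M f H \<pi>)
    = (\<Sum>\<^sub>\<infinity>(k, l)\<in>J \<times> J. ennreal ((cmod (\<integral>z. f z * cnj (hinner H (\<pi> z (b k)) (b l)) \<partial>M))\<^sup>2))"
proof -
  define T where "T = fourier_transform M f H \<pi>"
  note T = fourier_transform_weak[OF b M f, folded T_def]
  note bJ = orthonormal_basis_closed[OF b]
  have "\<exists>w\<in>carrier H. \<forall>v\<in>carrier H. hinner H w v = cnj (hinner H (T v) u)" if u: "u \<in> carrier H" for u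
  proof (rule Riesz_representation[OF b])
    fix v w assume v: "v \<in> carrier H" and w: "w \<in> carrier H"
    have "f z * cnj (hinner H (\<pi> z u) (v \<oplus> w))
        = f z * cnj (hinner H (\<pi> z u) v) + f z * cnj (hinner H (\<pi> z u) w)" for z
      using u v w by (simp add: hinner_add_right distrib_left)
    then have "hinner H (T (v \<oplus> w)) u = hinner H (T v) u + hinner H (T w) u"
      using T u v w integrable_times_coefficient[OF M f v u] integrable_times_coefficient[OF M f w u]
      by simp
    then show "cnj (hinner H (T (v \<oplus> w)) u) = cnj (hinner H (T v) u) + cnj (hinner H (T w) u)"
      by simp
  next
    fix c v assume v: "v \<in> carrier H"
    have "f z * cnj (hinner H (\<pi> z u) (c \<odot> v)) = c * (f z * cnj (hinner H (\<pi> z u) v))" for z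
      using u v by (simp add: hinner_smult_right)
    then have "(\<integral>z. f z * cnj (hinner H (\<pi> z u) (c \<odot> v)) \<partial>M)
        = c * (\<integral>z. f z * cnj (hinner H (\<pi> z u) v) \<partial>M)"
      by (simp only: integral_mult_right_zero)
    then have "hinner H (T (c \<odot> v)) u = c * hinner H (T v) u"
      using T u v by simp
    then show "cnj (hinner H (T (c \<odot> v)) u) = cnj c * cnj (hinner H (T v) u)"
      by simp
  next
    fix v assume v: "v \<in> carrier H"
    show "cmod (cnj (hinner H (T v) u)) \<le> ((\<integral>z. norm (f z) \<partial>M) * hnorm H u) * hnorm H v"
      using cmod_integral_coefficient_le[OF M f v u] T u v by (simp add: mult_ac)
  qed
  then obtain S where S: "\<And>u. u \<in> carrier H \<Longrightarrow> S u \<in> carrier H"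
      "\<And>u v. u \<in> carrier H \<Longrightarrow> v \<in> carrier H \<Longrightarrow> hinner H (S u) v = cnj (hinner H (T v) u)"
    by metis
  have "hs_norm_sq H T = (\<Sum>\<^sub>\<infinity>l\<in>J. ennreal ((hnorm H (T (b l)))\<^sup>2))"
  proof (rule hs_norm_sq_eq[OF b, where S = S])
    show "T u \<in> carrier H" "S u \<in> carrier H" if "u \<in> carrier H" for u using T S that by auto
    show "hinner H (T u) v = hinner H u (S v)" if "u \<in> carrier H" "v \<in> carrier H" for u v
      using S(2)[OF that(2,1)] hinner_commute[OF S(1)[OF that(2)] that(1)] by simp
  qed
  also have "\<dots> = (\<Sum>\<^sub>\<infinity>l\<in>J. \<Sum>\<^sub>\<infinity>k\<in>J. ennreal ((cmod (hinner H (T (b l)) (b k)))\<^sup>2))"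
    using T bJ by (intro infsum_cong Parseval[OF b, symmetric]) auto
  also have "\<dots> = (\<Sum>\<^sub>\<infinity>k\<in>J. \<Sum>\<^sub>\<infinity>l\<in>J. ennreal ((cmod (hinner H (T (b l)) (b k)))\<^sup>2))"
    by (rule infsum_swap_ennreal)
  also have "\<dots> = (\<Sum>\<^sub>\<infinity>k\<in>J. \<Sum>\<^sub>\<infinity>l\<in>J.
      ennreal ((cmod (\<integral>z. f z * cnj (hinner H (\<pi> z (b k)) (b l)) \<partial>M))\<^sup>2))"
    using T bJ by (intro infsum_cong) auto
  finally show ?thesis
    unfolding T_def by (simp add: infsum_Times_ennreal)
qed

end

lemma unitary_representationI: "unitary_rep H \<pi> \<Longrightarrow> unitary_representation H \<pi>"
  by (simp add: unitary_rep_def unitary_representation_def unitary_representation_axioms_def)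


section \<open>Measurability in fields of Hilbert spaces\<close>

text \<open>
  Since \<open>\<parallel>u\<parallel>\<^sup>2 - \<parallel>u - q\<parallel>\<^sup>2 = 2 Re (u, q) - \<parallel>q\<parallel>\<^sup>2\<close>, the norm of \<open>u\<close> is a supremum over
  combinations \<open>q\<close> of a total sequence. By continuity in the coefficients these may be taken from a
  dense set \<open>D\<close>, so that countably many \<open>q\<close> suffice.
\<close>

lemma (in hilbert_space) less_hnorm_sq_iff:
  fixes e :: "nat \<Rightarrow> 'h" and D :: "complex set"
  assumes tot: "total_in H (range e)" and u: "u \<in> carrier H"
    and D: "\<And>U. open U \<Longrightarrow> U \<noteq> {} \<Longrightarrow> \<exists>d\<in>D. d \<in> U"
  shows "r < (hnorm H u)\<^sup>2 \<longleftrightarrow>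
    (\<exists>(A, c)\<in>(SIGMA A:{A. finite A}. A \<rightarrow>\<^sub>E D).
       r < 2 * Re (\<Sum>j\<in>A. cnj (c j) * hinner H u (e j))
         - Re (\<Sum>i\<in>A. c i * (\<Sum>j\<in>A. cnj (c j) * hinner H (e i) (e j))))"
    (is "_ \<longleftrightarrow> (\<exists>(A, c)\<in>?Q. r < ?\<Phi> A c)")
proof -
  have e: "e j \<in> carrier H" for j using tot by (auto simp: total_in_def)
  have \<Phi>: "?\<Phi> A c = (hnorm H u)\<^sup>2 - (hdist H u (\<Oplus>j\<in>A. c j \<odot> e j))\<^sup>2" if A: "finite A" for A c
  proof -
    let ?q = "\<Oplus>j\<in>A. c j \<odot> e j"
    have q: "?q \<in> carrier H" using e by simp
    have "hinner H u ?q = (\<Sum>j\<in>A. cnj (c j) * hinner H u (e j))"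
      using A e u by (intro hinner_finsum_right) auto
    moreover have "hinner H ?q ?q = (\<Sum>i\<in>A. c i * (\<Sum>j\<in>A. cnj (c j) * hinner H (e i) (e j)))"
    proof -
      have "hinner H ?q ?q = (\<Sum>i\<in>A. c i * hinner H (e i) ?q)"
        using A e q by (intro hinner_finsum_left) auto
      also have "\<dots> = (\<Sum>i\<in>A. c i * (\<Sum>j\<in>A. cnj (c j) * hinner H (e i) (e j)))"
        using A e by (intro sum.cong refl arg_cong2[where f="(*)"] hinner_finsum_right) auto
      finally show ?thesis .
    qed
    moreover have "(hdist H u ?q)\<^sup>2 = (hnorm H u)\<^sup>2 - 2 * Re (hinner H u ?q) + Re (hinner H ?q ?q)"
      unfolding hdist_def hnorm_sq[OF q, symmetric] by (rule hnorm_diff_sq[OF u q])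
    ultimately show ?thesis by simp
  qed
  show ?thesis
  proof
    assume r: "r < (hnorm H u)\<^sup>2"
    define \<epsilon> where "\<epsilon> = sqrt ((hnorm H u)\<^sup>2 - r)"
    have \<epsilon>: "\<epsilon> > 0" "\<epsilon>\<^sup>2 = (hnorm H u)\<^sup>2 - r" using r by (auto simp: \<epsilon>_def)
    obtain A c where A: "finite A" and d: "hdist H u (\<Oplus>j\<in>A. c j \<odot> e j) < \<epsilon>"
      using total_approx[OF tot u \<epsilon>(1)] by metis
    have "0 \<le> hdist H u (\<Oplus>j\<in>A. c j \<odot> e j)"
      using u e by (simp add: hdist_def)
    then have "(hdist H u (\<Oplus>j\<in>A. c j \<odot> e j))\<^sup>2 < \<epsilon>\<^sup>2"
      using d by (intro power_strict_mono) auto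
    then have less: "r < ?\<Phi> A c" using \<Phi>[OF A, of c] \<epsilon>(2) by linarith
    define d where "d n j = (SOME d. d \<in> D \<and> dist d (c j) < 1 / Suc n)" for n j
    have "\<exists>d. d \<in> D \<and> dist d (c j) < 1 / Suc n" for j n
      using D[of "ball (c j) (1 / Suc n)"] by (auto simp: dist_commute)
    then have "d n j \<in> D \<and> dist (d n j) (c j) < 1 / Suc n" for n j
      unfolding d_def by (rule someI_ex)
    then have dD: "\<And>n j. d n j \<in> D" and dd: "\<And>n j. dist (d n j) (c j) < 1 / Suc n"
      by blast+
    have lim: "(\<lambda>n. d n j) \<longlonglongrightarrow> c j" for j
    proof -
      have "(\<lambda>n. dist (d n j) (c j)) \<longlonglongrightarrow> 0"
      proof (rule tendsto_sandwich[OF _ _ tendsto_const LIMSEQ_inverse_real_of_nat])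
        show "\<forall>\<^sub>F n in sequentially. 0 \<le> dist (d n j) (c j)" by simp
        show "\<forall>\<^sub>F n in sequentially. dist (d n j) (c j) \<le> inverse (real (Suc n))"
          by (intro always_eventually allI less_imp_le) (use dd in \<open>simp add: inverse_eq_divide\<close>)
      qed
      then show ?thesis by (rule tendsto_dist_iff[THEN iffD2])
    qed
    have "(\<lambda>n. ?\<Phi> A (d n)) \<longlonglongrightarrow> ?\<Phi> A c"
      by (intro tendsto_diff tendsto_mult tendsto_const tendsto_Re tendsto_sum tendsto_cnj lim)
    then have "\<forall>\<^sub>F n in sequentially. r < ?\<Phi> A (d n)"
      using less by (rule order_tendstoD)
    then obtain n where n: "r < ?\<Phi> A (d n)"
      using eventually_happens'[OF sequentially_bot] by blast
    have "?\<Phi> A (restrict (d n) A) = ?\<Phi> A (d n)"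
      by (intro arg_cong2[where f = "(-)"] arg_cong[where f = Re] arg_cong2[where f = "(*)"]
          sum.cong refl) auto
    then have "r < ?\<Phi> A (restrict (d n) A)" using n by simp
    moreover have "(A, restrict (d n) A) \<in> ?Q" using A dD by auto
    ultimately show "\<exists>(A, c)\<in>?Q. r < ?\<Phi> A c" by blast
  next
    assume "\<exists>(A, c)\<in>?Q. r < ?\<Phi> A c"
    then obtain A c where A: "finite A" and r: "r < ?\<Phi> A c" by auto
    then show "r < (hnorm H u)\<^sup>2"
      using \<Phi>[OF A, of c] zero_le_power2[of "hdist H u (\<Oplus>j\<in>A. c j \<odot> e j)"] by linarith
  qed
qed

lemma measurable_hilbert_fieldD:
  assumes "measurable_hilbert_field \<mu> H e" "p \<in> space \<mu>"
  shows "hilbert_space (H p)" "total_in (H p) (range (\<lambda>j. e j p))" "e j p \<in> carrier (H p)"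
  using assms by (auto simp: measurable_hilbert_field_def separable_hilbert_def total_in_def)

lemma measurable_sectionD:
  assumes "measurable_section \<mu> H e s"
  shows "p \<in> space \<mu> \<Longrightarrow> s p \<in> carrier (H p)"
    and "(\<lambda>p. hinner (H p) (s p) (e j p)) \<in> borel_measurable \<mu>"
  using assms by (auto simp: measurable_section_def)

lemma measurable_section_hnorm_sq:
  assumes F: "measurable_hilbert_field \<mu> H e" and s: "measurable_section \<mu> H e s"
  shows "(\<lambda>p. (hnorm (H p) (s p))\<^sup>2) \<in> borel_measurable \<mu>"
  unfolding borel_measurable_iff_greater
proof
  fix r :: real
  obtain D :: "complex set" where D: "countable D"
      "\<And>U. open U \<Longrightarrow> U \<noteq> {} \<Longrightarrow> \<exists>d\<in>D. d \<in> U"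
    using countable_dense_setE by metis
  define \<Phi> where "\<Phi> q p = (case q of (A, c) \<Rightarrow>
      2 * Re (\<Sum>j\<in>A. cnj (c j) * hinner (H p) (s p) (e j p))
        - Re (\<Sum>i\<in>A. c i * (\<Sum>j\<in>A. cnj (c j) * hinner (H p) (e i p) (e j p))))"
    for q :: "nat set \<times> (nat \<Rightarrow> complex)" and p
  define Q where "Q = (SIGMA A:{A :: nat set. finite A}. A \<rightarrow>\<^sub>E D)"
  have cQ: "countable Q"
    unfolding Q_def using D(1)
    by (intro countable_SIGMA countable_PiE) (auto intro: countable_Collect_finite)
  have [measurable]: "\<Phi> q \<in> borel_measurable \<mu>" for q
  proof -
    have [measurable]: "(\<lambda>p. hinner (H p) (e i p) (e j p)) \<in> borel_measurable \<mu>" for i j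
      using F by (simp add: measurable_hilbert_field_def)
    have [measurable]: "(\<lambda>p. hinner (H p) (s p) (e j p)) \<in> borel_measurable \<mu>" for j
      by (rule measurable_sectionD(2)[OF s])
    show ?thesis unfolding \<Phi>_def by (cases q) simp
  qed
  have eq: "{p \<in> space \<mu>. r < (hnorm (H p) (s p))\<^sup>2} = (\<Union>q\<in>Q. {p \<in> space \<mu>. r < \<Phi> q p})"
  proof (intro Set.set_eqI)
    fix p
    have "r < (hnorm (H p) (s p))\<^sup>2 \<longleftrightarrow> (\<exists>q\<in>Q. r < \<Phi> q p)" if p: "p \<in> space \<mu>"
      using hilbert_space.less_hnorm_sq_iff[OF measurable_hilbert_fieldD(1,2)[OF F p]
          measurable_sectionD(1)[OF s p] D(2), of r]
      unfolding Q_def \<Phi>_def by (simp add: split_def)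
    then show "p \<in> {p \<in> space \<mu>. r < (hnorm (H p) (s p))\<^sup>2}
        \<longleftrightarrow> p \<in> (\<Union>q\<in>Q. {p \<in> space \<mu>. r < \<Phi> q p})" by auto
  qed
  show "{p \<in> space \<mu>. r < (hnorm (H p) (s p))\<^sup>2} \<in> sets \<mu>"
    unfolding eq by (rule sets.countable_UN'[OF cQ]) auto
qed

text \<open>
  By polarization this follows from the measurability of norms: the norms of \<open>s + t\<close> and
  \<open>s + \<i> t\<close> determine the real and the imaginary part.
\<close>

lemma measurable_section_hinner:
  assumes F: "measurable_hilbert_field \<mu> H e"
    and s: "measurable_section \<mu> H e s" and t: "measurable_section \<mu> H e t"
  shows "(\<lambda>p. hinner (H p) (s p) (t p)) \<in> borel_measurable \<mu>"
proof -
  have comb: "measurable_section \<mu> H e (\<lambda>p. s p \<oplus>\<^bsub>H p\<^esub> c \<odot>\<^bsub>H p\<^esub> t p)" for c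
    unfolding measurable_section_def
  proof (intro conjI ballI allI)
    fix p assume p: "p \<in> space \<mu>"
    interpret hilbert_space "H p" by (rule measurable_hilbert_fieldD(1)[OF F p])
    show "s p \<oplus>\<^bsub>H p\<^esub> c \<odot>\<^bsub>H p\<^esub> t p \<in> carrier (H p)"
      using measurable_sectionD(1)[OF s p] measurable_sectionD(1)[OF t p] by simp
  next
    fix j
    have [measurable]: "(\<lambda>p. hinner (H p) (s p) (e j p)) \<in> borel_measurable \<mu>"
        "(\<lambda>p. hinner (H p) (t p) (e j p)) \<in> borel_measurable \<mu>"
      by (rule measurable_sectionD(2)[OF s] measurable_sectionD(2)[OF t])+
    have "(\<lambda>p. hinner (H p) (s p) (e j p) + c * hinner (H p) (t p) (e j p)) \<in> borel_measurable \<mu>"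
      by measurable
    moreover have "hinner (H p) (s p \<oplus>\<^bsub>H p\<^esub> c \<odot>\<^bsub>H p\<^esub> t p) (e j p)
        = hinner (H p) (s p) (e j p) + c * hinner (H p) (t p) (e j p)" if p: "p \<in> space \<mu>" for p
    proof -
      interpret hilbert_space "H p" by (rule measurable_hilbert_fieldD(1)[OF F p])
      show ?thesis
        using measurable_sectionD(1)[OF s p] measurable_sectionD(1)[OF t p]
          measurable_hilbert_fieldD(3)[OF F p]
        by (simp add: hinner_add_left hinner_smult_left)
    qed
    ultimately show "(\<lambda>p. hinner (H p) (s p \<oplus>\<^bsub>H p\<^esub> c \<odot>\<^bsub>H p\<^esub> t p) (e j p)) \<in> borel_measurable \<mu>"
      by (simp cong: measurable_cong)
  qed
  have [measurable]: "(\<lambda>p. (hnorm (H p) (s p \<oplus>\<^bsub>H p\<^esub> c \<odot>\<^bsub>H p\<^esub> t p))\<^sup>2) \<in> borel_measurable \<mu>" for c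
    by (rule measurable_section_hnorm_sq[OF F comb])
  have [measurable]: "(\<lambda>p. (hnorm (H p) (s p))\<^sup>2) \<in> borel_measurable \<mu>"
      "(\<lambda>p. (hnorm (H p) (t p))\<^sup>2) \<in> borel_measurable \<mu>"
    by (rule measurable_section_hnorm_sq[OF F] s t)+
  have "(\<lambda>p. Complex
      (((hnorm (H p) (s p \<oplus>\<^bsub>H p\<^esub> 1 \<odot>\<^bsub>H p\<^esub> t p))\<^sup>2 - (hnorm (H p) (s p))\<^sup>2 - (hnorm (H p) (t p))\<^sup>2) / 2)
      (((hnorm (H p) (s p \<oplus>\<^bsub>H p\<^esub> \<i> \<odot>\<^bsub>H p\<^esub> t p))\<^sup>2 - (hnorm (H p) (s p))\<^sup>2 - (hnorm (H p) (t p))\<^sup>2) / 2))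
      \<in> borel_measurable \<mu>"
    by (subst borel_measurable_complex_iff) simp
  moreover have "hinner (H p) (s p) (t p) = Complex
      (((hnorm (H p) (s p \<oplus>\<^bsub>H p\<^esub> 1 \<odot>\<^bsub>H p\<^esub> t p))\<^sup>2 - (hnorm (H p) (s p))\<^sup>2 - (hnorm (H p) (t p))\<^sup>2) / 2)
      (((hnorm (H p) (s p \<oplus>\<^bsub>H p\<^esub> \<i> \<odot>\<^bsub>H p\<^esub> t p))\<^sup>2 - (hnorm (H p) (s p))\<^sup>2 - (hnorm (H p) (t p))\<^sup>2) / 2)"
    if p: "p \<in> space \<mu>" for p
  proof -
    interpret hilbert_space "H p" by (rule measurable_hilbert_fieldD(1)[OF F p])
    show ?thesis
      using measurable_sectionD(1)[OF s p] measurable_sectionD(1)[OF t p]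
      by (simp add: hnorm_smult_add_sq complex_eq_iff)
  qed
  ultimately show ?thesis by (simp cong: measurable_cong)
qed

text \<open>
  The sets \<open>{F > r}\<close> are countable unions of measurable rectangles: given a countable base and a
  countable dense set, \<open>F y p > r\<close> holds iff for some basic open \<open>B \<ni> y\<close> and some rational \<open>q > r\<close> one
  has \<open>F d p \<ge> q\<close> for all \<open>d \<in> B\<close> in the dense set.
\<close>

lemma continuous_measurable_imp_jointly_measurable_real:
  fixes F :: "'g::second_countable_topology \<Rightarrow> 'p \<Rightarrow> real"
  assumes cont: "\<And>p. p \<in> space \<mu> \<Longrightarrow> continuous_on UNIV (\<lambda>y. F y p)"
    and [measurable]: "\<And>y. F y \<in> borel_measurable \<mu>"
  shows "(\<lambda>(y, p). F y p) \<in> borel_measurable (borel \<Otimes>\<^sub>M \<mu>)"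
  unfolding borel_measurable_iff_greater
proof
  fix r :: real
  obtain \<B> :: "'g set set" where \<B>: "countable \<B>" "topological_basis \<B>"
    using ex_countable_basis by metis
  obtain D :: "'g set" where D: "countable D" "\<And>U. open U \<Longrightarrow> U \<noteq> {} \<Longrightarrow> \<exists>d\<in>D. d \<in> U"
    using countable_dense_setE by metis
  define R where "R B q = B \<times> {p \<in> space \<mu>. \<forall>d\<in>D \<inter> B. real_of_rat q \<le> F d p}" for B q
  have "{z \<in> space (borel \<Otimes>\<^sub>M \<mu>). r < (case z of (y, p) \<Rightarrow> F y p)}
      = (\<Union>B\<in>\<B>. \<Union>q\<in>{q. r < real_of_rat q}. R B q)" (is "?L = ?R")
  proof (rule Set.set_eqI, rule iffI)
    fix z assume "z \<in> ?L"
    then obtain y p where z: "z = (y, p)" and p: "p \<in> space \<mu>" and r: "r < F y p"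
      by (auto simp: space_pair_measure)
    obtain q where q: "r < real_of_rat q" "real_of_rat q < F y p"
      using of_rat_dense[OF r] by auto
    have "open {y. real_of_rat q < F y p}"
      using cont[OF p] by (intro open_Collect_less continuous_on_const)
    then obtain B where B: "B \<in> \<B>" "y \<in> B" "B \<subseteq> {y. real_of_rat q < F y p}"
      by (rule topological_basisE[OF \<B>(2)]) (use q(2) in auto)
    have "\<forall>d\<in>D \<inter> B. real_of_rat q \<le> F d p" using B(3) by (auto intro: less_imp_le)
    then have "z \<in> R B q" using z p B(2) by (simp add: R_def)
    then show "z \<in> ?R" using B(1) q(1) by blast
  next
    fix z assume "z \<in> ?R"
    then obtain B q y p where B: "B \<in> \<B>" and q: "r < real_of_rat q" and z: "z = (y, p)"
        and y: "y \<in> B" and p: "p \<in> space \<mu>" and le: "\<forall>d\<in>D \<inter> B. real_of_rat q \<le> F d p"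
      by (auto simp: R_def)
    have "real_of_rat q \<le> F y p"
    proof (rule ccontr)
      assume "\<not> real_of_rat q \<le> F y p"
      then have "y \<in> B \<inter> {y. F y p < real_of_rat q}" using y by auto
      moreover have "open (B \<inter> {y. F y p < real_of_rat q})"
        using cont[OF p] topological_basis_open[OF \<B>(2) B]
        by (intro open_Int open_Collect_less continuous_on_const)
      ultimately obtain d where "d \<in> D" "d \<in> B \<inter> {y. F y p < real_of_rat q}"
        using D(2)[of "B \<inter> {y. F y p < real_of_rat q}"] by blast
      then show False using le by (auto simp: not_le[symmetric])
    qed
    then show "z \<in> ?L" using q p z by (auto simp: space_pair_measure)
  qed
  moreover have "R B q \<in> sets (borel \<Otimes>\<^sub>M \<mu>)" if "B \<in> \<B>" for B q
  proof -
    have "countable (D \<inter> B)" using D(1) by (rule countable_Int1)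
    have "{p \<in> space \<mu>. \<forall>d\<in>D \<inter> B. real_of_rat q \<le> F d p} \<in> sets \<mu>"
    proof -
      have "(\<Union>d\<in>D \<inter> B. {p \<in> space \<mu>. F d p < real_of_rat q}) \<in> sets \<mu>"
        by (rule sets.countable_UN'[OF \<open>countable (D \<inter> B)\<close>]) auto
      moreover have "{p \<in> space \<mu>. \<forall>d\<in>D \<inter> B. real_of_rat q \<le> F d p}
          = space \<mu> - (\<Union>d\<in>D \<inter> B. {p \<in> space \<mu>. F d p < real_of_rat q})"
        by (auto simp flip: not_le)
      ultimately show ?thesis by simp
    qed
    then show ?thesis
      unfolding R_def using topological_basis_open[OF \<B>(2) that] by (intro pair_measureI) auto
  qed
  moreover have "countable {q. r < real_of_rat q}" by simp
  ultimately show "{z \<in> space (borel \<Otimes>\<^sub>M \<mu>). r < (case z of (y, p) \<Rightarrow> F y p)}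
      \<in> sets (borel \<Otimes>\<^sub>M \<mu>)"
    using \<B>(1) by (auto intro!: sets.countable_UN')
qed

lemma continuous_measurable_imp_jointly_measurable:
  fixes F :: "'g::second_countable_topology \<Rightarrow> 'p \<Rightarrow> complex"
  assumes cont: "\<And>p. p \<in> space \<mu> \<Longrightarrow> continuous_on UNIV (\<lambda>y. F y p)"
    and meas: "\<And>y. F y \<in> borel_measurable \<mu>"
  shows "(\<lambda>(y, p). F y p) \<in> borel_measurable (borel \<Otimes>\<^sub>M \<mu>)"
proof -
  have "(\<lambda>(y, p). Re (F y p)) \<in> borel_measurable (borel \<Otimes>\<^sub>M \<mu>)"
    using meas cont
    by (intro continuous_measurable_imp_jointly_measurable_real continuous_on_Re)
      (auto simp: borel_measurable_complex_iff)
  moreover have "(\<lambda>(y, p). Im (F y p)) \<in> borel_measurable (borel \<Otimes>\<^sub>M \<mu>)"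
    using meas cont
    by (intro continuous_measurable_imp_jointly_measurable_real continuous_on_Im)
      (auto simp: borel_measurable_complex_iff)
  ultimately show ?thesis
    by (subst borel_measurable_complex_iff) (simp add: split_def)
qed

lemma measurable_pair_count_space:
  fixes f :: "'a \<Rightarrow> 'i::countable \<Rightarrow> 'b"
  assumes "\<And>i. (\<lambda>z. f z i) \<in> measurable A B"
  shows "(\<lambda>(z, i). f z i) \<in> measurable (A \<Otimes>\<^sub>M count_space UNIV) B"
proof -
  have "(\<lambda>w. f (fst w) i) \<in> measurable (A \<Otimes>\<^sub>M count_space UNIV) B" for i
    by (rule measurable_compose[OF measurable_fst assms])
  then show ?thesis
    unfolding split_def by (rule measurable_compose_countable) simp
qed


section \<open>Square-integrable functions\<close>

lemma L2_measurable: "f \<in> L2 M \<Longrightarrow> f \<in> borel_measurable M"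
  by (simp add: L2_def)

lemma L2_integrable_sq: "f \<in> L2 M \<Longrightarrow> integrable M (\<lambda>x. (cmod (f x))\<^sup>2)"
  by (simp add: L2_def)

lemma L2_norm_sq: "(L2_norm M f)\<^sup>2 = (\<integral>x. (cmod (f x))\<^sup>2 \<partial>M)"
  by (simp add: L2_norm_def)

lemma nn_integral_L2:
  "f \<in> L2 M \<Longrightarrow> (\<integral>\<^sup>+x. ennreal ((cmod (f x))\<^sup>2) \<partial>M) = ennreal ((L2_norm M f)\<^sup>2)"
  by (simp add: L2_norm_sq nn_integral_eq_integral L2_integrable_sq)

lemma L2I_dominated:
  assumes "f \<in> borel_measurable M" "integrable M (\<lambda>x. (w x)\<^sup>2)" "\<And>x. cmod (f x) \<le> w x"
  shows "f \<in> L2 M"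
  unfolding L2_def
proof (intro CollectI conjI assms(1) Bochner_Integration.integrable_bound[OF assms(2)])
  show "(\<lambda>x. (cmod (f x))\<^sup>2) \<in> borel_measurable M" using assms(1) by measurable
  show "AE x in M. norm ((cmod (f x))\<^sup>2) \<le> norm ((w x)\<^sup>2)"
    using assms(3) by (auto intro!: power_mono)
qed

lemma cmod_sum_sq_le: "(cmod (u + v))\<^sup>2 \<le> 2 * (cmod u)\<^sup>2 + 2 * (cmod v)\<^sup>2"
proof -
  have "(cmod (u + v))\<^sup>2 \<le> (cmod u + cmod v)\<^sup>2"
    by (intro power_mono norm_triangle_ineq) auto
  also have "\<dots> \<le> 2 * (cmod u)\<^sup>2 + 2 * (cmod v)\<^sup>2"
    using sum_squares_ge_zero[of "cmod u - cmod v" 0] by (simp add: power2_eq_square algebra_simps)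
  finally show ?thesis .
qed

lemma L2_cmult: "f \<in> L2 M \<Longrightarrow> (\<lambda>x. c * f x) \<in> L2 M"
  by (auto simp: L2_def norm_mult power_mult_distrib)

lemma L2_add:
  assumes "f \<in> L2 M" "h \<in> L2 M"
  shows "(\<lambda>x. f x + h x) \<in> L2 M"
  unfolding L2_def
proof (intro CollectI conjI)
  have [measurable]: "f \<in> borel_measurable M" "h \<in> borel_measurable M"
    using assms by (auto simp: L2_def)
  show "(\<lambda>x. f x + h x) \<in> borel_measurable M" by measurable
  show "integrable M (\<lambda>x. (cmod (f x + h x))\<^sup>2)"
  proof (rule Bochner_Integration.integrable_bound)
    show "integrable M (\<lambda>x. 2 * (cmod (f x))\<^sup>2 + 2 * (cmod (h x))\<^sup>2)"
      using assms by (simp add: L2_def)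
    show "AE x in M. norm ((cmod (f x + h x))\<^sup>2) \<le> norm (2 * (cmod (f x))\<^sup>2 + 2 * (cmod (h x))\<^sup>2)"
      using cmod_sum_sq_le by (intro AE_I2) simp
  qed measurable
qed

lemma L2_diff: "f \<in> L2 M \<Longrightarrow> h \<in> L2 M \<Longrightarrow> (\<lambda>x. f x - h x) \<in> L2 M"
  using L2_add[of f M "\<lambda>x. (-1) * h x"] L2_cmult[of h M "-1"] by simp

lemma L2_norm_sq_add_le:
  assumes "f \<in> L2 M" "h \<in> L2 M"
  shows "(L2_norm M (\<lambda>x. f x + h x))\<^sup>2 \<le> 2 * (L2_norm M f)\<^sup>2 + 2 * (L2_norm M h)\<^sup>2"
proof -
  have "(L2_norm M (\<lambda>x. f x + h x))\<^sup>2 \<le> (\<integral>x. 2 * (cmod (f x))\<^sup>2 + 2 * (cmod (h x))\<^sup>2 \<partial>M)"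
    unfolding L2_norm_sq using L2_integrable_sq[OF L2_add[OF assms]] assms[THEN L2_integrable_sq]
    by (intro integral_mono) (auto simp: cmod_sum_sq_le)
  also have "\<dots> = 2 * (L2_norm M f)\<^sup>2 + 2 * (L2_norm M h)\<^sup>2"
    using assms[THEN L2_integrable_sq] by (simp add: L2_norm_sq)
  finally show ?thesis .
qed

lemma L2_norm_sq_cmult: "(L2_norm M (\<lambda>x. c * f x))\<^sup>2 = (cmod c)\<^sup>2 * (L2_norm M f)\<^sup>2"
  by (simp add: L2_norm_sq norm_mult power_mult_distrib)

lemma L2_times_integrable:
  assumes "f \<in> L2 M" "h \<in> L2 M"
  shows "integrable M (\<lambda>x. f x * h x)"
proof (rule Bochner_Integration.integrable_bound)
  show "integrable M (\<lambda>x. (cmod (f x))\<^sup>2 + (cmod (h x))\<^sup>2)"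
    using assms by (simp add: L2_def)
  show "(\<lambda>x. f x * h x) \<in> borel_measurable M"
    by (intro borel_measurable_times L2_measurable assms)
  have "cmod (f x) * cmod (h x) \<le> (cmod (f x))\<^sup>2 + (cmod (h x))\<^sup>2" for x
  proof -
    have "2 * (cmod (f x) * cmod (h x)) \<le> (cmod (f x))\<^sup>2 + (cmod (h x))\<^sup>2"
      using sum_squares_bound[of "cmod (f x)" "cmod (h x)"] by simp
    moreover have "0 \<le> cmod (f x) * cmod (h x)" by simp
    ultimately show ?thesis by linarith
  qed
  then show "AE x in M. norm (f x * h x) \<le> norm ((cmod (f x))\<^sup>2 + (cmod (h x))\<^sup>2)"
    by (intro AE_I2) (simp add: norm_mult)
qed

lemma L2_cnj: "f \<in> L2 M \<Longrightarrow> (\<lambda>x. cnj (f x)) \<in> L2 M"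
  by (auto simp: L2_def)

lemma L2_Cauchy_Schwarz:
  assumes f: "f \<in> L2 M" and h: "h \<in> L2 M"
  shows "(\<integral>x. cmod (f x) * cmod (h x) \<partial>M)\<^sup>2 \<le> (L2_norm M f)\<^sup>2 * (L2_norm M h)\<^sup>2"
proof -
  have [measurable]: "f \<in> borel_measurable M" "h \<in> borel_measurable M"
    using assms by (auto simp: L2_def)
  have "integrable M (\<lambda>x. cmod (f x) * cmod (h x))"
    using integrable_norm[OF L2_times_integrable[OF assms]] by (simp add: norm_mult)
  then have "ennreal (\<integral>x. cmod (f x) * cmod (h x) \<partial>M)
      = (\<integral>\<^sup>+x. ennreal (cmod (f x)) * ennreal (cmod (h x)) \<partial>M)"
    by (subst nn_integral_eq_integral[symmetric]) (auto simp: ennreal_mult)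
  then have "ennreal ((\<integral>x. cmod (f x) * cmod (h x) \<partial>M)\<^sup>2)
      = (\<integral>\<^sup>+x. ennreal (cmod (f x)) * ennreal (cmod (h x)) \<partial>M)\<^sup>2"
    by (simp add: ennreal_power[symmetric])
  also have "\<dots> \<le> (\<integral>\<^sup>+x. (ennreal (cmod (f x)))\<^sup>2 \<partial>M) * (\<integral>\<^sup>+x. (ennreal (cmod (h x)))\<^sup>2 \<partial>M)"
    by (rule Cauchy_Schwarz_nn_integral) auto
  also have "\<dots> = ennreal ((L2_norm M f)\<^sup>2 * (L2_norm M h)\<^sup>2)"
    using f h by (simp add: ennreal_power nn_integral_L2 ennreal_mult)
  finally show ?thesis
    by (subst (asm) ennreal_le_iff) auto
qed

text \<open>
  Continuity of the norm, from the pointwise bound of \<open>| |v|\<^sup>2 - |u|\<^sup>2 |\<close> by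
  \<open>|u - v|\<^sup>2 + 2 |u| |u - v|\<close> and the Cauchy--Schwarz inequality for the mixed term.
\<close>

lemma L2_norm_sq_zero_tendsto_imp:
  assumes f: "f \<in> L2 M" and h: "\<And>n. h n \<in> L2 M"
    and lim: "(\<lambda>n. (L2_norm M (\<lambda>x. f x - h n x))\<^sup>2) \<longlonglongrightarrow> 0"
  shows "(\<lambda>n. (L2_norm M (h n))\<^sup>2) \<longlonglongrightarrow> (L2_norm M f)\<^sup>2"
proof -
  define d where "d n = (L2_norm M (\<lambda>x. f x - h n x))\<^sup>2" for n
  define c where "c n = (\<integral>x. cmod (f x) * cmod (f x - h n x) \<partial>M)" for n
  have d: "(\<lambda>n. d n) \<longlonglongrightarrow> 0" using lim by (simp add: d_def)
  note dL2 = L2_diff[OF f h]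
  have int: "integrable M (\<lambda>x. cmod (f x) * cmod (f x - h n x))" for n
    using integrable_norm[OF L2_times_integrable[OF f dL2]] by (simp add: norm_mult)
  have c_le: "c n \<le> sqrt ((L2_norm M f)\<^sup>2 * d n)" for n
    unfolding c_def d_def by (intro real_le_rsqrt L2_Cauchy_Schwarz f dL2)
  have c0: "0 \<le> c n" for n by (simp add: c_def)
  have "(\<lambda>n. sqrt ((L2_norm M f)\<^sup>2 * d n)) \<longlonglongrightarrow> sqrt ((L2_norm M f)\<^sup>2 * 0)"
    by (intro tendsto_real_sqrt tendsto_mult tendsto_const d)
  then have lim0: "(\<lambda>n. sqrt ((L2_norm M f)\<^sup>2 * d n)) \<longlonglongrightarrow> 0" by simp
  have c: "c \<longlonglongrightarrow> 0"
    by (rule tendsto_sandwich[OF _ _ tendsto_const lim0]) (auto intro: always_eventually c0 c_le)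
  have pt: "\<bar>(cmod v)\<^sup>2 - (cmod u)\<^sup>2\<bar> \<le> (cmod (u - v))\<^sup>2 + 2 * (cmod u * cmod (u - v))" for u v
  proof -
    have "\<bar>(cmod v)\<^sup>2 - (cmod u)\<^sup>2\<bar> = \<bar>cmod v - cmod u\<bar> * (cmod v + cmod u)"
      by (simp add: power2_eq_square square_diff_square_factored abs_mult)
    also have "\<dots> \<le> cmod (u - v) * (cmod (u - v) + 2 * cmod u)"
      using norm_triangle_ineq3[of v u] norm_triangle_ineq2[of v u]
      by (intro mult_mono) (auto simp: norm_minus_commute)
    finally show ?thesis by (simp add: power2_eq_square algebra_simps)
  qed
  have "\<bar>(L2_norm M (h n))\<^sup>2 - (L2_norm M f)\<^sup>2\<bar> \<le> d n + 2 * c n" for n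
  proof -
    have "(L2_norm M (h n))\<^sup>2 - (L2_norm M f)\<^sup>2 = (\<integral>x. (cmod (h n x))\<^sup>2 - (cmod (f x))\<^sup>2 \<partial>M)"
      unfolding L2_norm_sq using L2_integrable_sq[OF f] L2_integrable_sq[OF h] by simp
    also have "\<bar>\<dots>\<bar> \<le> (\<integral>x. \<bar>(cmod (h n x))\<^sup>2 - (cmod (f x))\<^sup>2\<bar> \<partial>M)"
      by (rule integral_abs_bound)
    also have "\<dots> \<le> (\<integral>x. (cmod (f x - h n x))\<^sup>2 + 2 * (cmod (f x) * cmod (f x - h n x)) \<partial>M)"
      by (rule integral_mono[OF integrable_abs[OF Bochner_Integration.integrable_diff[OF
          L2_integrable_sq[OF h] L2_integrable_sq[OF f]]]
          Bochner_Integration.integrable_add[OF L2_integrable_sq[OF dL2] integrable_mult_right[OF int]]])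
        (rule pt)
    also have "\<dots> = d n + 2 * c n"
      unfolding c_def d_def L2_norm_sq
      by (simp only: Bochner_Integration.integral_add[OF L2_integrable_sq[OF dL2]
            integrable_mult_right[OF int]] integral_mult_right_zero)
    finally show ?thesis .
  qed
  then have bound: "norm ((L2_norm M (h n))\<^sup>2 - (L2_norm M f)\<^sup>2) \<le> d n + 2 * c n" for n
    by simp
  have "(\<lambda>n. d n + 2 * c n) \<longlonglongrightarrow> 0 + 2 * 0"
    by (intro tendsto_add tendsto_mult tendsto_const c d)
  then have "(\<lambda>n. d n + 2 * c n) \<longlonglongrightarrow> 0" by simp
  then show ?thesis
    by (rule LIM_zero_cancel[OF Lim_null_comparison[OF always_eventually[OF allI[OF bound]]]])
qed


section \<open>Compactly supported continuous functions\<close>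

definition cont_compact_support :: "('a::t2_space \<Rightarrow> complex) \<Rightarrow> bool" where
  "cont_compact_support f \<longleftrightarrow> continuous_on UNIV f \<and> compact (closure {x. f x \<noteq> 0})"

lemma cont_compact_supportI:
  assumes "continuous_on UNIV f" "compact K" "\<And>x. x \<notin> K \<Longrightarrow> f x = 0"
  shows "cont_compact_support f"
proof -
  have "closure {x. f x \<noteq> 0} \<subseteq> K"
    using assms by (intro closure_minimal compact_imp_closed) auto
  then have "closure {x. f x \<noteq> 0} = K \<inter> closure {x. f x \<noteq> 0}" by auto
  then have "compact (closure {x. f x \<noteq> 0})"
    using compact_Int_closed[OF assms(2) closed_closure] by metis
  then show ?thesis using assms(1) by (simp add: cont_compact_support_def)
qed

lemma cont_compact_supportE:
  assumes "cont_compact_support f"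
  obtains K where "continuous_on UNIV f" "compact K" "\<And>x. x \<notin> K \<Longrightarrow> f x = 0"
  using assms closure_subset[of "{x. f x \<noteq> 0}"]
  by (intro that[of "closure {x. f x \<noteq> 0}"]) (auto simp: cont_compact_support_def)

lemma cont_compact_support_add:
  assumes "cont_compact_support f" "cont_compact_support h"
  shows "cont_compact_support (\<lambda>x. f x + h x)"
proof -
  obtain K where K: "continuous_on UNIV f" "compact K" "\<And>x. x \<notin> K \<Longrightarrow> f x = 0"
    using assms(1) by (elim cont_compact_supportE) blast
  obtain L where L: "continuous_on UNIV h" "compact L" "\<And>x. x \<notin> L \<Longrightarrow> h x = 0"
    using assms(2) by (elim cont_compact_supportE) blast
  show ?thesis
    using K L by (intro cont_compact_supportI[of _ "K \<union> L"] continuous_intros compact_Un) auto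
qed

lemma cont_compact_support_mult:
  assumes "cont_compact_support f" "continuous_on UNIV a"
  shows "cont_compact_support (\<lambda>x. f x * a x)"
proof -
  obtain K where K: "continuous_on UNIV f" "compact K" "\<And>x. x \<notin> K \<Longrightarrow> f x = 0"
    using assms(1) by (elim cont_compact_supportE) blast
  show ?thesis
    using K assms(2) by (intro cont_compact_supportI[of _ K] continuous_intros) auto
qed

lemma cont_compact_support_zero: "cont_compact_support (\<lambda>x. 0)"
  by (rule cont_compact_supportI[of _ "{}"]) auto

lemma cont_compact_support_cmult: "cont_compact_support f \<Longrightarrow> cont_compact_support (\<lambda>x. c * f x)"
  using cont_compact_support_mult[of f "\<lambda>_. c"] by (simp add: mult.commute)

lemma cont_compact_support_integrable_L2:
  assumes f: "cont_compact_support f" and M: "sets M = sets borel"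
    and fin: "\<And>K. compact K \<Longrightarrow> emeasure M K < \<infinity>"
  shows "integrable M f" "f \<in> L2 M"
proof -
  obtain K where K: "continuous_on UNIV f" "compact K" "\<And>x. x \<notin> K \<Longrightarrow> f x = 0"
    using f by (elim cont_compact_supportE) blast
  have "bounded (f ` K)"
    using K(2) continuous_on_subset[OF K(1)] by (intro compact_imp_bounded compact_continuous_image) auto
  then obtain B where B: "\<And>x. x \<in> K \<Longrightarrow> cmod (f x) \<le> B" by (auto simp: bounded_iff)
  have le: "cmod (f x) \<le> \<bar>B\<bar> * indicator K x" for x
    using B[of x] K(3)[of x] by (auto simp: indicator_def)
  have Km: "K \<in> sets M" using K(2) by (simp add: M compact_imp_closed)
  have f_meas: "f \<in> borel_measurable M"
    using borel_measurable_continuous_onI[OF K(1)] measurable_cong_sets[OF M refl] by blast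
  have ind: "integrable M (\<lambda>x. indicator K x :: real)"
    using Km fin[OF K(2)] by simp
  show "integrable M f"
  proof (rule Bochner_Integration.integrable_bound[OF _ f_meas])
    show "integrable M (\<lambda>x. \<bar>B\<bar> * indicator K x)" using ind by simp
    show "AE x in M. norm (f x) \<le> norm (\<bar>B\<bar> * indicator K x)" using le by auto
  qed
  show "f \<in> L2 M"
  proof (rule L2I_dominated[OF f_meas _ le])
    have "(\<bar>B\<bar> * indicator K x)\<^sup>2 = B\<^sup>2 * indicator K x" for x
      by (simp add: indicator_def)
    then show "integrable M (\<lambda>x. (\<bar>B\<bar> * indicator K x)\<^sup>2)" using ind by simp
  qed
qed


section \<open>Haar measure on a unimodular group\<close>

locale unimodular_haar =
  fixes M :: "'g::{topological_group_add, t2_space, second_countable_topology} measure"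
  assumes locally_compact: "locally_compact_space (euclidean :: 'g topology)"
    and unimodular: "unimodular TYPE('g)"
    and haar: "haar_measure M"
begin

lemma sets_M [measurable_cong, simp]: "sets M = sets borel"
  using haar by (simp add: haar_measure_def)

lemma space_M [simp]: "space M = UNIV"
  using sets_eq_imp_space_eq[OF sets_M] by simp

lemma emeasure_compact: "compact K \<Longrightarrow> emeasure M K < \<infinity>"
  using haar by (simp add: haar_measure_def)

lemma borel_measurable_M: "f \<in> borel_measurable borel \<Longrightarrow> f \<in> borel_measurable M"
  using measurable_cong_sets[OF sets_M refl] by blast

lemma continuous_measurable: "continuous_on UNIV f \<Longrightarrow> f \<in> borel_measurable M"
  by (intro borel_measurable_M borel_measurable_continuous_onI)

lemma cont_compact_support_integrable: "cont_compact_support f \<Longrightarrow> integrable M f"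
  by (rule cont_compact_support_integrable_L2(1)[OF _ sets_M emeasure_compact])

lemma cont_compact_support_L2: "cont_compact_support f \<Longrightarrow> f \<in> L2 M"
  by (rule cont_compact_support_integrable_L2(2)[OF _ sets_M emeasure_compact])

lemma compact_neighbourhood:
  obtains V K where "open V" "compact K" "x \<in> V" "V \<subseteq> (K :: 'g set)"
proof -
  have "\<exists>V K. open V \<and> compact K \<and> x \<in> V \<and> V \<subseteq> K"
    using locally_compact by (auto simp: locally_compact_space_def)
  then show ?thesis using that by blast
qed

text \<open>
  Locally compact Hausdorff spaces are completely regular, which gives a function \<open>f\<close> with \<open>f x = 0\<close>
  and value \<open>1\<close> outside a relatively compact neighbourhood of \<open>x\<close> in \<open>U\<close>; the positive part of
  \<open>1 - f\<close> is the desired bump.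
\<close>

lemma bump_function:
  assumes "open U" "x \<in> U"
  obtains h :: "'g \<Rightarrow> real" and K where "continuous_on UNIV h" "h x = 1" "\<And>y. 0 \<le> h y"
    "compact K" "\<And>y. y \<notin> K \<Longrightarrow> h y = 0" "\<And>y. y \<notin> U \<Longrightarrow> h y = 0"
proof -
  obtain V K where V: "open V" "compact K" "x \<in> V" "V \<subseteq> K" by (rule compact_neighbourhood)
  have "Hausdorff_space (euclidean :: 'g topology)"
    unfolding Hausdorff_space_def using hausdorff by (auto simp: disjnt_def)
  then have "completely_regular_space (euclidean :: 'g topology)"
    using locally_compact by (intro locally_compact_regular_imp_completely_regular_space) auto
  then have "\<exists>f. continuous_map euclidean euclideanreal f \<and> f x = 0 \<and> f ` (UNIV - (U \<inter> V)) \<subseteq> {1}"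
    using assms V by (auto simp: completely_regular_space_alt')
  then obtain f where f: "continuous_on UNIV f" "f x = 0" "\<And>y. y \<notin> U \<inter> V \<Longrightarrow> f y = (1 :: real)"
    by auto
  show ?thesis
  proof (rule that[of "\<lambda>y. max 0 (1 - f y)" K])
    show "continuous_on UNIV (\<lambda>y. max 0 (1 - f y))"
      using f(1) by (intro continuous_intros)
    show "max 0 (1 - f y) = 0" if "y \<notin> K" for y
    proof -
      have "y \<notin> U \<inter> V" using that V(4) by auto
      then show ?thesis using f(3) by simp
    qed
    show "max 0 (1 - f y) = 0" if "y \<notin> U" for y
    proof -
      have "y \<notin> U \<inter> V" using that by auto
      then show ?thesis using f(3) by simp
    qed
  qed (use f(2) V(2) in auto)
qed

text \<open>
  The relatively compact open sets cover the group, and by the second axiom of countability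
  (Lindelof's theorem) countably many of them suffice. Hence Haar measure is \<open>\<sigma>\<close>-finite.
\<close>

lemma countable_cover:
  obtains \<V> :: "'g set set" where "countable \<V>" "\<Union>\<V> = UNIV"
    "\<And>V. V \<in> \<V> \<Longrightarrow> open V \<and> emeasure M V < \<infinity>"
proof -
  define \<F> where "\<F> = {V :: 'g set. open V \<and> (\<exists>K. compact K \<and> V \<subseteq> K)}"
  have "open V" if "V \<in> \<F>" for V using that by (simp add: \<F>_def)
  then obtain \<V> where \<V>: "\<V> \<subseteq> \<F>" "countable \<V>" "\<Union>\<V> = \<Union>\<F>"
    by (rule Lindelof)
  show ?thesis
  proof (rule that[OF \<V>(2)])
    have "x \<in> \<Union>\<F>" for x
    proof -
      obtain V K where "open V" "compact K" "x \<in> V" "V \<subseteq> K" by (rule compact_neighbourhood)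
      then show ?thesis unfolding \<F>_def by blast
    qed
    then show "\<Union>\<V> = UNIV" using \<V>(3) by auto
    fix V assume "V \<in> \<V>"
    then obtain K where K: "open V" "compact K" "V \<subseteq> K" using \<V>(1) by (auto simp: \<F>_def)
    then have "emeasure M V \<le> emeasure M K"
      by (intro emeasure_mono) (auto simp: compact_imp_closed)
    then show "open V \<and> emeasure M V < \<infinity>"
      using emeasure_compact[OF K(2)] K(1) by (auto intro: le_less_trans)
  qed
qed

sublocale sigma_finite_measure M
proof
  obtain \<V> :: "'g set set" where \<V>: "countable \<V>" "\<Union>\<V> = UNIV"
    "\<And>V. V \<in> \<V> \<Longrightarrow> open V \<and> emeasure M V < \<infinity>" by (rule countable_cover) blast
  show "\<exists>A. countable A \<and> A \<subseteq> sets M \<and> \<Union>A = space M \<and> (\<forall>a\<in>A. emeasure M a \<noteq> \<infinity>)"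
  proof (intro exI conjI ballI)
    show "emeasure M V \<noteq> \<infinity>" if "V \<in> \<V>" for V using \<V>(3)[OF that] by auto
    show "\<V> \<subseteq> sets M" using \<V>(3) by auto
  qed (use \<V>(1,2) in auto)
qed

lemma exhaustion:
  obtains V :: "nat \<Rightarrow> 'g set" where "\<And>n. open (V n)" "\<And>n. emeasure M (V n) < \<infinity>" "incseq V"
    "(\<Union>n. V n) = UNIV"
proof -
  obtain \<V> :: "'g set set" where \<V>: "countable \<V>" "\<Union>\<V> = UNIV"
    "\<And>V. V \<in> \<V> \<Longrightarrow> open V \<and> emeasure M V < \<infinity>" by (rule countable_cover) blast
  have ne: "\<V> \<noteq> {}" using \<V>(2) by auto
  define V where "V n = (\<Union>i<n. from_nat_into \<V> i)" for n
  have inV: "from_nat_into \<V> i \<in> \<V>" for i using ne by (rule from_nat_into)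
  show ?thesis
  proof (rule that[of V])
    show "open (V n)" for n using \<V>(3)[OF inV] by (auto simp: V_def)
    have "emeasure M (V n) \<le> (\<Sum>i<n. emeasure M (from_nat_into \<V> i))" for n
      unfolding V_def using \<V>(3)[OF inV] by (intro emeasure_subadditive_finite) auto
    moreover have "(\<Sum>i<n. emeasure M (from_nat_into \<V> i)) < \<infinity>" for n
      using \<V>(3)[OF inV] by simp
    ultimately show "emeasure M (V n) < \<infinity>" for n using le_less_trans by blast
    show "incseq V" unfolding V_def by (intro incseq_SucI UN_mono) auto
    have "x \<in> (\<Union>n. V n)" for x
    proof -
      have "x \<in> \<Union>\<V>" using \<V>(2) by simp
      then obtain A where A: "A \<in> \<V>" "x \<in> A" by blast
      then obtain i where "from_nat_into \<V> i = A" using from_nat_into_surj[OF \<V>(1)] by metis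
      then have "x \<in> V (Suc i)" using A by (auto simp: V_def)
      then show ?thesis by blast
    qed
    then show "(\<Union>n. V n) = UNIV" by auto
  qed
qed

lemma translate_measurable [measurable]:
  "(\<lambda>y. x + y) \<in> measurable M M" "(\<lambda>y. y + x) \<in> measurable M M" "uminus \<in> measurable M M"
proof -
  have cont: "f \<in> measurable M M" if "continuous_on UNIV f" for f :: "'g \<Rightarrow> 'g"
    using borel_measurable_continuous_onI[OF that] measurable_cong_sets[OF sets_M sets_M] by blast
  show "(\<lambda>y. x + y) \<in> measurable M M" "(\<lambda>y. y + x) \<in> measurable M M"
      "uminus \<in> measurable M M"
    by (rule cont, intro continuous_on_add continuous_on_minus continuous_on_const continuous_on_id)+
qed

lemma minus_plus_measurable [measurable]:
  "(\<lambda>(x, y). - x + y) \<in> measurable (M \<Otimes>\<^sub>M M) M"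
proof -
  have "(\<lambda>z. - fst z + snd z) \<in> borel_measurable (borel :: ('g \<times> 'g) measure)"
    by (intro borel_measurable_continuous_onI continuous_intros)
  moreover have "sets (M \<Otimes>\<^sub>M M) = sets (borel :: ('g \<times> 'g) measure)"
    unfolding borel_prod[symmetric] by (intro sets_pair_measure_cong sets_M)
  ultimately show ?thesis
    unfolding split_def using measurable_cong_sets[OF _ sets_M] by blast
qed

lemma distr_left: "distr M M (\<lambda>y. x + y) = M"
proof -
  have "distr M M (\<lambda>y. x + y) = distr M borel (\<lambda>y. x + y)" by (rule distr_cong) auto
  then show ?thesis using haar by (simp add: haar_measure_def)
qed

lemma distr_right: "distr M M (\<lambda>y. y + x) = M"
proof -
  have "distr M M (\<lambda>y. y + x) = distr M borel (\<lambda>y. y + x)" by (rule distr_cong) auto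
  then show ?thesis using unimodular haar by (simp add: unimodular_def)
qed

lemma nn_integral_left: "f \<in> borel_measurable M \<Longrightarrow> (\<integral>\<^sup>+y. f (x + y) \<partial>M) = (\<integral>\<^sup>+y. f y \<partial>M)"
  using nn_integral_distr[of "\<lambda>y. x + y" M M f] by (simp add: distr_left)

lemma nn_integral_right: "f \<in> borel_measurable M \<Longrightarrow> (\<integral>\<^sup>+y. f (y + x) \<partial>M) = (\<integral>\<^sup>+y. f y \<partial>M)"
  using nn_integral_distr[of "\<lambda>y. y + x" M M f] by (simp add: distr_right)

text \<open>
  Choose \<open>h\<close> such that \<open>c = \<integral>h\<close> is positive and finite, and integrate \<open>h(x) k(x\<^sup>-\<^sup>1y)\<close> in both orders.
  Integration first over \<open>y\<close> gives \<open>c \<integral>k\<close> by left invariance. For the other order, the substitution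
  \<open>x \<mapsto> yx\<close> turns the integrand into \<open>h(yx) k(x\<^sup>-\<^sup>1)\<close>, and right invariance gives \<open>c\<close> times the
  integral of \<open>k(x\<^sup>-\<^sup>1)\<close>.
\<close>

lemma nn_integral_uminus:
  assumes k [measurable]: "k \<in> borel_measurable M"
  shows "(\<integral>\<^sup>+x. k (- x) \<partial>M) = (\<integral>\<^sup>+x. k x \<partial>M)"
proof -
  interpret MM: pair_sigma_finite M M ..
  obtain V where V: "\<And>n. open (V n)" "\<And>n. emeasure M (V n) < \<infinity>" "incseq V" "(\<Union>n. V n) = UNIV"
    by (rule exhaustion) blast
  have "\<exists>n. emeasure M (V n) \<noteq> 0"
  proof (rule ccontr)
    assume "\<not> ?thesis"
    then have "emeasure M (\<Union>n. V n) = 0"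
      using V(1) by (intro emeasure_UN_eq_0) auto
    then show False using haar V(4) by (simp add: haar_measure_def)
  qed
  then obtain n where n: "emeasure M (V n) \<noteq> 0" by blast
  define h :: "'g \<Rightarrow> ennreal" where "h = indicator (V n)"
  have Vn: "V n \<in> sets M" using V(1) by simp
  have h [measurable]: "h \<in> borel_measurable M" using Vn by (simp add: h_def)
  have c: "(\<integral>\<^sup>+x. h x \<partial>M) = emeasure M (V n)" using Vn by (simp add: h_def)
  have kk [measurable]: "(\<lambda>(x, y). k (- x + y)) \<in> borel_measurable (M \<Otimes>\<^sub>M M)"
    using measurable_compose[OF minus_plus_measurable k] by (simp add: split_def)
  have hy [measurable]: "(\<lambda>(x, y). h (y + x)) \<in> borel_measurable (M \<Otimes>\<^sub>M M)"
  proof -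
    have "(\<lambda>z. snd z + fst z) \<in> borel_measurable (borel :: ('g \<times> 'g) measure)"
      by (intro borel_measurable_continuous_onI continuous_intros)
    moreover have "sets (M \<Otimes>\<^sub>M M) = sets (borel :: ('g \<times> 'g) measure)"
      unfolding borel_prod[symmetric] by (intro sets_pair_measure_cong sets_M)
    ultimately have "(\<lambda>z. snd z + fst z) \<in> measurable (M \<Otimes>\<^sub>M M) M"
      using measurable_cong_sets[OF _ sets_M] by blast
    from measurable_compose[OF this h] show ?thesis by (simp add: split_def)
  qed
  have "emeasure M (V n) * (\<integral>\<^sup>+y. k y \<partial>M) = (\<integral>\<^sup>+x. \<integral>\<^sup>+y. h x * k (- x + y) \<partial>M \<partial>M)"
    using nn_integral_left[OF k, of "- _"] by (simp add: nn_integral_cmult nn_integral_multc c)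
  also have "\<dots> = (\<integral>\<^sup>+y. \<integral>\<^sup>+x. h x * k (- x + y) \<partial>M \<partial>M)"
    by (rule MM.Fubini') measurable
  also have "\<dots> = (\<integral>\<^sup>+y. \<integral>\<^sup>+x. h (y + x) * k (- x) \<partial>M \<partial>M)"
  proof (rule nn_integral_cong)
    fix y
    have "(\<lambda>x. h x * k (- x + y)) \<in> borel_measurable M" by measurable
    from nn_integral_left[OF this, of y]
    show "(\<integral>\<^sup>+x. h x * k (- x + y) \<partial>M) = (\<integral>\<^sup>+x. h (y + x) * k (- x) \<partial>M)"
      by (simp add: minus_add add.assoc)
  qed
  also have "\<dots> = (\<integral>\<^sup>+x. \<integral>\<^sup>+y. h (y + x) * k (- x) \<partial>M \<partial>M)"
    by (rule MM.Fubini'[symmetric]) measurable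
  also have "\<dots> = emeasure M (V n) * (\<integral>\<^sup>+x. k (- x) \<partial>M)"
    by (simp add: nn_integral_multc nn_integral_cmult nn_integral_right[OF h] c)
  finally show ?thesis
    using n V(2)[of n, THEN less_imp_neq] by (auto simp: ennreal_mult_cancel_left)
qed

lemma nn_integral_minus_plus:
  assumes k [measurable]: "k \<in> borel_measurable M"
  shows "(\<integral>\<^sup>+x. k (- x + y) \<partial>M) = (\<integral>\<^sup>+x. k x \<partial>M)"
proof -
  have "(\<integral>\<^sup>+x. k (- x + y) \<partial>M) = (\<integral>\<^sup>+x. k (- (- y + x)) \<partial>M)"
    by (simp add: minus_add)
  also have "\<dots> = (\<integral>\<^sup>+x. k (- x) \<partial>M)"
    by (rule nn_integral_left[of "\<lambda>x. k (- x)"]) measurable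
  also have "\<dots> = (\<integral>\<^sup>+x. k x \<partial>M)" by (rule nn_integral_uminus[OF k])
  finally show ?thesis .
qed

lemma L2_translate:
  assumes "f \<in> L2 M"
  shows "(\<lambda>y. f (x + y)) \<in> L2 M" "L2_norm M (\<lambda>y. f (x + y)) = L2_norm M f"
proof -
  have [measurable]: "f \<in> borel_measurable M" using assms by (simp add: L2_def)
  have "integrable (distr M M (\<lambda>y. x + y)) (\<lambda>y. (cmod (f y))\<^sup>2)"
    using assms by (simp add: distr_left L2_def)
  then have "integrable M (\<lambda>y. (cmod (f (x + y)))\<^sup>2)"
    by (subst (asm) integrable_distr_eq) auto
  then show "(\<lambda>y. f (x + y)) \<in> L2 M" by (simp add: L2_def)
  have "(\<integral>y. (cmod (f y))\<^sup>2 \<partial>distr M M (\<lambda>y. x + y)) = (\<integral>y. (cmod (f (x + y)))\<^sup>2 \<partial>M)"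
    by (rule integral_distr) auto
  then show "L2_norm M (\<lambda>y. f (x + y)) = L2_norm M f"
    by (simp add: L2_norm_def distr_left)
qed

text \<open>
  The translates of a non-empty open set cover the group, countably many of them suffice, and they
  all have the same measure; if it were \<open>0\<close>, then so would be the measure of the group.
\<close>

lemma emeasure_open_pos:
  assumes "open U" "x \<in> U"
  shows "emeasure M U \<noteq> 0"
proof
  assume null: "emeasure M U = 0"
  have Um: "U \<in> sets M" using assms by simp
  define T where "T y = (\<lambda>z. y + z) -` U" for y
  have oT: "open (T y)" for y
    unfolding T_def using assms(1) by (intro open_vimage continuous_intros)
  have T0: "emeasure M (T y) = 0" for y
  proof -
    have "emeasure M (T y) = emeasure (distr M M (\<lambda>z. y + z)) U"
      using Um by (subst emeasure_distr) (auto simp: T_def)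
    then show ?thesis by (simp add: distr_left null)
  qed
  have "open A" if "A \<in> range T" for A using that oT by auto
  then obtain \<F> where \<F>: "\<F> \<subseteq> range T" "countable \<F>" "\<Union>\<F> = \<Union>(range T)"
    by (rule Lindelof)
  have "z \<in> T (x - z)" for z using assms(2) by (simp add: T_def)
  then have "\<Union>\<F> = UNIV" using \<F>(3) by blast
  moreover have "emeasure M (\<Union>\<F>) = 0"
  proof -
    have "(\<Union>A\<in>\<F>. A) \<in> null_sets M"
      using \<F>(1,2) T0 oT by (intro null_sets_UN') (auto simp: null_sets_def)
    then show ?thesis by (simp add: null_sets_def)
  qed
  ultimately show False using haar by (simp add: haar_measure_def)
qed

end


section \<open>Density of the compactly supported continuous functions\<close>

context unimodular_haar
begin

text \<open>
  Functions in the closure of the compactly supported continuous ones. The aim is that this closure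
  is all of \<open>L\<^sup>2\<close>.
\<close>

definition approximable :: "('g \<Rightarrow> complex) \<Rightarrow> bool" where
  "approximable f \<longleftrightarrow> f \<in> L2 M \<and>
     (\<forall>\<epsilon>>0. \<exists>h. cont_compact_support h \<and> (L2_norm M (\<lambda>x. f x - h x))\<^sup>2 < \<epsilon>)"

lemma approximableD:
  assumes "approximable f" "\<epsilon> > 0"
  obtains h where "cont_compact_support h" "(L2_norm M (\<lambda>x. f x - h x))\<^sup>2 < \<epsilon>"
  using assms by (auto simp: approximable_def)

lemma approximable_L2: "approximable f \<Longrightarrow> f \<in> L2 M"
  by (simp add: approximable_def)

lemma cont_compact_support_approximable: "cont_compact_support f \<Longrightarrow> approximable f"
  unfolding approximable_def by (auto simp: cont_compact_support_L2 L2_norm_sq intro!: exI[of _ f])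

lemma approximable_cmult:
  assumes "approximable f"
  shows "approximable (\<lambda>x. c * f x)"
  unfolding approximable_def
proof (intro conjI allI impI)
  show "(\<lambda>x. c * f x) \<in> L2 M" using assms by (intro L2_cmult approximable_L2)
  fix \<epsilon> :: real assume e: "\<epsilon> > 0"
  have c: "0 < (cmod c)\<^sup>2 + 1" by (intro add_nonneg_pos) auto
  obtain h where h: "cont_compact_support h" "(L2_norm M (\<lambda>x. f x - h x))\<^sup>2 < \<epsilon> / ((cmod c)\<^sup>2 + 1)"
    using approximableD[OF assms divide_pos_pos[OF e c]] by blast
  have "(L2_norm M (\<lambda>x. c * f x - c * h x))\<^sup>2 = (cmod c)\<^sup>2 * (L2_norm M (\<lambda>x. f x - h x))\<^sup>2"
    by (simp only: L2_norm_sq_cmult right_diff_distrib[symmetric])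
  also have "\<dots> \<le> ((cmod c)\<^sup>2 + 1) * (L2_norm M (\<lambda>x. f x - h x))\<^sup>2"
    by (intro mult_right_mono) auto
  also have "\<dots> < \<epsilon>"
    using h(2) c by (simp only: pos_less_divide_eq mult.commute)
  finally show "\<exists>h. cont_compact_support h \<and> (L2_norm M (\<lambda>x. c * f x - h x))\<^sup>2 < \<epsilon>"
    using cont_compact_support_cmult[OF h(1)] by blast
qed

lemma approximable_add:
  assumes f: "approximable f" and f': "approximable f'"
  shows "approximable (\<lambda>x. f x + f' x)"
  unfolding approximable_def
proof (intro conjI allI impI)
  show "(\<lambda>x. f x + f' x) \<in> L2 M" using assms by (intro L2_add approximable_L2)
  fix \<epsilon> :: real assume "\<epsilon> > 0"
  then have e: "\<epsilon> / 4 > 0" by simp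
  obtain h where h: "cont_compact_support h" "(L2_norm M (\<lambda>x. f x - h x))\<^sup>2 < \<epsilon> / 4"
    using approximableD[OF f e] by blast
  obtain h' where h': "cont_compact_support h'" "(L2_norm M (\<lambda>x. f' x - h' x))\<^sup>2 < \<epsilon> / 4"
    using approximableD[OF f' e] by blast
  have "(L2_norm M (\<lambda>x. (f x - h x) + (f' x - h' x)))\<^sup>2
      \<le> 2 * (L2_norm M (\<lambda>x. f x - h x))\<^sup>2 + 2 * (L2_norm M (\<lambda>x. f' x - h' x))\<^sup>2"
    by (rule L2_norm_sq_add_le[OF
          L2_diff[OF approximable_L2[OF f] cont_compact_support_L2[OF h(1)]]
          L2_diff[OF approximable_L2[OF f'] cont_compact_support_L2[OF h'(1)]]])
  also have "\<dots> < \<epsilon>" using h h' by simp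
  finally have "(L2_norm M (\<lambda>x. f x + f' x - (h x + h' x)))\<^sup>2 < \<epsilon>"
    by (simp add: algebra_simps)
  then show "\<exists>h. cont_compact_support h \<and> (L2_norm M (\<lambda>x. f x + f' x - h x))\<^sup>2 < \<epsilon>"
    using cont_compact_support_add[OF h(1) h'(1)] by blast
qed

lemma approximable_sum:
  assumes "finite I" "\<And>i. i \<in> I \<Longrightarrow> approximable (f i)"
  shows "approximable (\<lambda>x. \<Sum>i\<in>I. f i x)"
  using assms
proof (induction I rule: finite_induct)
  case empty
  then show ?case
    using cont_compact_support_approximable[OF cont_compact_support_zero] by simp
next
  case (insert i I)
  then show ?case using approximable_add[of "f i" "\<lambda>x. \<Sum>i\<in>I. f i x"] by simp
qed

text \<open>
  The closure is stable under dominated pointwise limits. This single principle serves the passage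
  to open sets, to countable disjoint unions and to general functions.
\<close>

lemma approximable_limit:
  assumes f: "f \<in> borel_measurable M" and s: "\<And>n. approximable (s n)"
    and w: "integrable M (\<lambda>x. (w x)\<^sup>2)" and bound: "\<And>n x. cmod (s n x) \<le> w x"
    and lim: "\<And>x. (\<lambda>n. s n x) \<longlonglongrightarrow> f x"
  shows "approximable f"
  unfolding approximable_def
proof (intro conjI allI impI)
  have f_le: "cmod (f x) \<le> w x" for x
    by (rule Lim_bounded[OF tendsto_norm[OF lim]]) (use bound in auto)
  show fL2: "f \<in> L2 M" by (rule L2I_dominated[OF f w f_le])
  have sL2: "s n \<in> L2 M" for n by (rule approximable_L2[OF s])
  have [measurable]: "s n \<in> borel_measurable M" "f \<in> borel_measurable M" for n
    using f L2_measurable[OF sL2] by auto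
  fix \<epsilon> :: real assume "\<epsilon> > 0"
  then have e: "\<epsilon> / 4 > 0" by simp
  have "(\<lambda>n. (\<integral>x. (cmod (f x - s n x))\<^sup>2 \<partial>M)) \<longlonglongrightarrow> (\<integral>x. 0 \<partial>M)"
  proof (rule integral_dominated_convergence[where w = "\<lambda>x. 4 * (w x)\<^sup>2"])
    show "integrable M (\<lambda>x. 4 * (w x)\<^sup>2)" using w by simp
    have "(\<lambda>n. (cmod (f x - s n x))\<^sup>2) \<longlonglongrightarrow> (cmod (f x - f x))\<^sup>2" for x
      by (intro tendsto_power tendsto_norm tendsto_diff tendsto_const lim)
    then show "AE x in M. (\<lambda>n. (cmod (f x - s n x))\<^sup>2) \<longlonglongrightarrow> 0" by simp
    have "(cmod (f x - s n x))\<^sup>2 \<le> 4 * (w x)\<^sup>2" for n x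
    proof -
      have "cmod (f x - s n x) \<le> 2 * w x"
        using norm_triangle_ineq4[of "f x" "s n x"] f_le[of x] bound[of n x] by linarith
      then have "(cmod (f x - s n x))\<^sup>2 \<le> (2 * w x)\<^sup>2" by (intro power_mono) auto
      then show ?thesis by (simp add: power_mult_distrib)
    qed
    then show "AE x in M. norm ((cmod (f x - s n x))\<^sup>2) \<le> 4 * (w x)\<^sup>2" for n by simp
  qed measurable
  then have "(\<lambda>n. (L2_norm M (\<lambda>x. f x - s n x))\<^sup>2) \<longlonglongrightarrow> 0"
    by (simp add: L2_norm_sq)
  from order_tendstoD(2)[OF this e] obtain n where n: "(L2_norm M (\<lambda>x. f x - s n x))\<^sup>2 < \<epsilon> / 4"
    using eventually_happens'[OF sequentially_bot] by blast
  obtain h where h: "cont_compact_support h" "(L2_norm M (\<lambda>x. s n x - h x))\<^sup>2 < \<epsilon> / 4"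
    using approximableD[OF s e] by blast
  have "(L2_norm M (\<lambda>x. (f x - s n x) + (s n x - h x)))\<^sup>2
      \<le> 2 * (L2_norm M (\<lambda>x. f x - s n x))\<^sup>2 + 2 * (L2_norm M (\<lambda>x. s n x - h x))\<^sup>2"
    using h by (intro L2_norm_sq_add_le L2_diff sL2 fL2 cont_compact_support_L2)
  also have "\<dots> < \<epsilon>" using h n by simp
  finally show "\<exists>h. cont_compact_support h \<and> (L2_norm M (\<lambda>x. f x - h x))\<^sup>2 < \<epsilon>"
    using h(1) by auto
qed

text \<open>
  An open set of finite measure is covered by countably many sets \<open>{h\<^sub>i > 0}\<close>, where \<open>h\<^sub>i\<close> is a bump
  function living inside the set; the truncations of \<open>n \<Sum>\<^bsub>i<n\<^esub> h\<^sub>i\<close> at height \<open>1\<close> increase to its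
  indicator.
\<close>

lemma approximable_indicator_open:
  assumes U: "open U" and fin: "emeasure M U < \<infinity>"
  shows "approximable (\<lambda>x. indicator U x)"
proof -
  define P where "P h K \<longleftrightarrow> continuous_on UNIV h \<and> (\<forall>y. 0 \<le> h y) \<and> compact K \<and>
      (\<forall>y. y \<notin> K \<longrightarrow> h y = 0) \<and> (\<forall>y. y \<notin> U \<longrightarrow> h y = 0)" for h :: "'g \<Rightarrow> real" and K
  define \<F> where "\<F> = {{y. 0 < h y} | h. \<exists>K. P h K}"
  have "open A" if A: "A \<in> \<F>" for A
  proof -
    obtain h K where "A = {y. 0 < h y}" "P h K" using A by (auto simp: \<F>_def)
    then show ?thesis by (simp add: P_def open_Collect_less continuous_on_const)
  qed
  then obtain \<G> where \<G>: "\<G> \<subseteq> \<F>" "countable \<G>" "\<Union>\<G> = \<Union>\<F>"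
    by (rule Lindelof)
  have zero: "{} \<in> \<F>"
  proof -
    have "P (\<lambda>_. 0) {}" by (simp add: P_def)
    then show ?thesis unfolding \<F>_def by force
  qed
  define A where "A i = from_nat_into (insert {} \<G>) i" for i
  have cov: "\<Union>(range A) = \<Union>\<F>"
    unfolding A_def using \<G>(2,3) by (simp add: range_from_nat_into)
  have "A i \<in> \<F>" for i
    unfolding A_def using from_nat_into[of "insert {} \<G>" i] \<G>(1) zero by auto
  then have "\<forall>i. \<exists>h K. A i = {y. 0 < h y} \<and> P h K"
    unfolding \<F>_def by blast
  then obtain h K where A: "\<And>i. A i = {y. 0 < h i y}" and P: "\<And>i. P (h i) (K i)"
    by metis
  define s where "s n y = complex_of_real (min 1 (real n * (\<Sum>i<n. h i y)))" for n y
  show ?thesis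
  proof (rule approximable_limit[where s = s and w = "indicator U"])
    show "(\<lambda>x. indicator U x) \<in> borel_measurable M"
      using U by (intro borel_measurable_indicator) simp
    show "integrable M (\<lambda>x. (indicator U x :: real)\<^sup>2)"
      using U fin by (simp add: power2_eq_square flip: indicator_inter_arith)
    show "approximable (s n)" for n
    proof (intro cont_compact_support_approximable cont_compact_supportI)
      show "continuous_on UNIV (s n)"
        unfolding s_def using P by (intro continuous_intros) (auto simp: P_def)
      show "compact (\<Union>i<n. K i)" using P by (intro compact_UN) (auto simp: P_def)
      fix y assume "y \<notin> (\<Union>i<n. K i)"
      then have "(\<Sum>i<n. h i y) = 0" using P by (intro sum.neutral) (auto simp: P_def)
      then show "s n y = 0" by (simp add: s_def)
    qed
    have nonneg: "0 \<le> (\<Sum>i<n. h i y)" for n y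
      using P by (intro sum_nonneg) (simp add: P_def)
    show "cmod (s n y) \<le> indicator U y" for n y
    proof (cases "y \<in> U")
      case True
      have "0 \<le> min 1 (real n * (\<Sum>i<n. h i y))" using nonneg by simp
      then show ?thesis using True by (simp add: s_def)
    next
      case False
      then have "(\<Sum>i<n. h i y) = 0" using P by (intro sum.neutral) (auto simp: P_def)
      then show ?thesis using False by (simp add: s_def)
    qed
    show "(\<lambda>n. s n y) \<longlonglongrightarrow> indicator U y" for y
    proof (cases "y \<in> U")
      case True
      obtain b K' where b: "continuous_on UNIV b" "b y = (1 :: real)" "\<And>z. 0 \<le> b z"
          "compact K'" "\<And>z. z \<notin> K' \<Longrightarrow> b z = 0" "\<And>z. z \<notin> U \<Longrightarrow> b z = 0"
        by (rule bump_function[OF U True]) blast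
      then have "P b K'" by (simp add: P_def)
      then have "{z. 0 < b z} \<in> \<F>" unfolding \<F>_def by blast
      moreover have "y \<in> {z. 0 < b z}" using b(2) by simp
      ultimately have "y \<in> \<Union>(range A)" unfolding cov by blast
      then obtain i where i: "0 < h i y" using A by auto
      obtain m where m: "1 < real m * h i y" using ex_less_of_nat_mult[OF i] by blast
      have "s n y = 1" if n: "n \<ge> max m (Suc i)" for n
      proof -
        have "h i y \<le> (\<Sum>i<n. h i y)"
          using n P by (intro member_le_sum) (auto simp: P_def)
        then have "real m * h i y \<le> real n * (\<Sum>i<n. h i y)"
          using n i by (intro mult_mono) auto
        then show ?thesis using m by (simp add: s_def)
      qed
      then show ?thesis
        using True by (intro tendsto_eventually eventually_sequentiallyI[of "max m (Suc i)"]) simp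
    next
      case False
      then have "(\<Sum>i<n. h i y) = 0" for n using P by (intro sum.neutral) (auto simp: P_def)
      then show ?thesis using False by (simp add: s_def)
    qed
  qed
qed

text \<open>
  The Borel sets whose trace on a fixed open set \<open>V\<close> of finite measure has an approximable indicator
  contain the open sets, and they are closed under complements and countable disjoint unions.
  Intersecting with \<open>V\<close> keeps all measures finite.
\<close>

lemma approximable_indicator:
  assumes B: "B \<in> sets borel" and V: "open V" "emeasure M V < \<infinity>"
  shows "approximable (\<lambda>x. indicator (B \<inter> V) x)"
proof -
  have int: "integrable M (\<lambda>x. (indicator V x :: real)\<^sup>2)"
    using V by (simp add: power2_eq_square flip: indicator_inter_arith)
  have "Int_stable {S :: 'g set. open S}" by (auto simp: Int_stable_def)
  moreover have "{S :: 'g set. open S} \<subseteq> Pow UNIV" by simp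
  moreover have "B \<in> sigma_sets UNIV {S. open S}"
    using B by (simp add: borel_def)
  ultimately show ?thesis
  proof (induction rule: sigma_sets_induct_disjoint)
    case (basic A)
    have "emeasure M (A \<inter> V) \<le> emeasure M V" using V(1) by (intro emeasure_mono) auto
    then show ?case
      using basic V by (intro approximable_indicator_open open_Int) auto
  next
    case empty
    then show ?case using cont_compact_support_approximable[OF cont_compact_support_zero] by simp
  next
    case (compl A)
    have "approximable (\<lambda>x. indicator V x + (-1) * indicator (A \<inter> V) x)"
      using approximable_indicator_open[OF V] compl(2)
      by (intro approximable_add approximable_cmult) auto
    moreover have "(\<lambda>x. indicator V x + (-1) * indicator (A \<inter> V) x :: complex)
        = (\<lambda>x. indicator ((UNIV - A) \<inter> V) x)"
      by (auto simp: indicator_def)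
    ultimately show ?case by simp
  next
    case (union A)
    have Am: "A i \<in> sets borel" for i using union.hyps(2) by (auto simp: borel_def)
    have part: "(\<Sum>i<n. indicator (A i \<inter> V) x) = (indicator ((\<Union>i<n. A i) \<inter> V) x :: complex)" for n x
      using union.hyps(1)
      by (simp add: indicator_UN_disjoint[symmetric] disjoint_family_on_def indicator_inter_arith
          sum_distrib_right[symmetric] sum_indicator_eq_card)
    show ?case
    proof (rule approximable_limit[where s = "\<lambda>n x. indicator ((\<Union>i<n. A i) \<inter> V) x" and w = "indicator V"])
      show "(\<lambda>x. indicator (\<Union> (range A) \<inter> V) x) \<in> borel_measurable M"
        using Am V(1) by (intro borel_measurable_indicator) auto
      show "approximable (\<lambda>x. indicator ((\<Union>i<n. A i) \<inter> V) x)" for n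
        unfolding part[symmetric] using union.IH by (intro approximable_sum) auto
      show "(\<lambda>n. indicator ((\<Union>i<n. A i) \<inter> V) x :: complex) \<longlonglongrightarrow> indicator (\<Union> (range A) \<inter> V) x" for x
      proof (cases "\<exists>i. x \<in> A i")
        case True
        then obtain i where i: "x \<in> A i" by blast
        then show ?thesis
          by (intro tendsto_eventually eventually_sequentiallyI[of "Suc i"])
            (auto simp: indicator_def)
      next
        case False
        then show ?thesis by (simp add: indicator_def)
      qed
    qed (use int in \<open>auto simp: indicator_def\<close>)
  qed
qed

text \<open>
  A square-integrable function is the pointwise limit of simple functions \<open>s\<^sub>n\<close> with
  \<open>|s\<^sub>n| \<le> 2 |f|\<close>; cutting \<open>s\<^sub>n\<close> off outside the \<open>n\<close>-th set of an exhaustion by open sets of finite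
  measure makes it a combination of indicators as above.
\<close>

lemma cont_compact_support_dense_L2:
  assumes f: "f \<in> L2 M"
  shows "approximable f"
proof -
  obtain V where V: "\<And>n. open (V n)" "\<And>n. emeasure M (V n) < \<infinity>" "incseq V" "(\<Union>n. V n) = UNIV"
    by (rule exhaustion) blast
  obtain s where s: "\<And>i. simple_function M (s i)" "\<And>x. (\<lambda>i. s i x) \<longlonglongrightarrow> f x"
      "\<And>i x. dist (s i x) 0 \<le> 2 * dist (f x) 0"
    using borel_measurable_implies_sequence_metric[OF L2_measurable[OF f], of 0] by auto
  show ?thesis
  proof (rule approximable_limit[where s = "\<lambda>n x. s n x * indicator (V n) x" and w = "\<lambda>x. 2 * cmod (f x)"])
    show "f \<in> borel_measurable M" by (rule L2_measurable[OF f])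
    show "integrable M (\<lambda>x. (2 * cmod (f x))\<^sup>2)"
      using L2_integrable_sq[OF f] by (simp add: power_mult_distrib)
    show "cmod (s n x * indicator (V n) x) \<le> 2 * cmod (f x)" for n x
      using s(3)[of n x] by (simp add: indicator_def)
    show "(\<lambda>n. s n x * indicator (V n) x) \<longlonglongrightarrow> f x" for x
    proof -
      obtain m where m: "x \<in> V m" using V(4) by blast
      have "x \<in> V n" if "n \<ge> m" for n using incseqD[OF V(3) that] m by blast
      then have "\<forall>\<^sub>F n in sequentially. s n x = s n x * indicator (V n) x"
        by (intro eventually_sequentiallyI[of m]) simp
      then show ?thesis by (rule Lim_transform_eventually[OF s(2)])
    qed
    show "approximable (\<lambda>x. s n x * indicator (V n) x)" for n
    proof -
      have fin: "finite (range (s n))"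
        using simple_functionD(1)[OF s(1)] by simp
      have "approximable (\<lambda>x. \<Sum>c\<in>range (s n). c * indicator (s n -` {c} \<inter> V n) x)"
        using simple_functionD(2)[OF s(1)] V
        by (intro approximable_sum fin approximable_cmult approximable_indicator) auto
      moreover have "(\<Sum>c\<in>range (s n). c * indicator (s n -` {c} \<inter> V n) x) = s n x * indicator (V n) x" for x
      proof -
        have "(\<Sum>c\<in>range (s n). c * indicator (s n -` {c} \<inter> V n) x)
            = (\<Sum>c\<in>range (s n). if c = s n x then c * indicator (V n) x else 0)"
          by (intro sum.cong refl) (auto simp: indicator_def)
        then show ?thesis using fin by simp
      qed
      ultimately show ?thesis by simp
    qed
  qed
qed

end


section \<open>Polarization\<close>

lemma L2_inner_integrable: "f \<in> L2 M \<Longrightarrow> h \<in> L2 M \<Longrightarrow> integrable M (\<lambda>x. f x * cnj (h x))"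
  by (rule L2_times_integrable[OF _ L2_cnj])

lemma L2_norm_sq_add_cmult:
  assumes f: "f \<in> L2 M" and h: "h \<in> L2 M"
  shows "(L2_norm M (\<lambda>x. f x + c * h x))\<^sup>2
    = (L2_norm M f)\<^sup>2 + 2 * Re (cnj c * L2_inner M f h) + (cmod c)\<^sup>2 * (L2_norm M h)\<^sup>2"
proof -
  have pt: "(cmod (u + c * v))\<^sup>2 = (cmod u)\<^sup>2 + 2 * Re (cnj c * (u * cnj v)) + (cmod c)\<^sup>2 * (cmod v)\<^sup>2" for u v
    by (simp only: cmod_power2) (simp add: power2_eq_square algebra_simps)
  have int: "integrable M (\<lambda>x. Re (cnj c * (f x * cnj (h x))))"
    by (intro integrable_Re integrable_mult_right L2_inner_integrable f h)
  have "(L2_norm M (\<lambda>x. f x + c * h x))\<^sup>2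
      = (\<integral>x. (cmod (f x))\<^sup>2 + 2 * Re (cnj c * (f x * cnj (h x))) + (cmod c)\<^sup>2 * (cmod (h x))\<^sup>2 \<partial>M)"
    by (simp only: L2_norm_sq pt)
  also have "\<dots> = (L2_norm M f)\<^sup>2 + 2 * (\<integral>x. Re (cnj c * (f x * cnj (h x))) \<partial>M)
      + (cmod c)\<^sup>2 * (L2_norm M h)\<^sup>2"
    by (simp only: L2_norm_sq integral_mult_right_zero
        Bochner_Integration.integral_add[OF Bochner_Integration.integrable_add[OF
            L2_integrable_sq[OF f] integrable_mult_right[OF int]]
            integrable_mult_right[OF L2_integrable_sq[OF h]]]
        Bochner_Integration.integral_add[OF L2_integrable_sq[OF f] integrable_mult_right[OF int]])
  also have "(\<integral>x. Re (cnj c * (f x * cnj (h x))) \<partial>M) = Re (cnj c * L2_inner M f h)"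
    using integral_Re[OF integrable_mult_right[OF L2_inner_integrable[OF f h], of "cnj c"]]
    by (simp only: L2_inner_def integral_mult_right_zero)
  finally show ?thesis .
qed

lemma L2_parallelogram:
  assumes "f \<in> L2 M" "h \<in> L2 M"
  shows "(L2_norm M (\<lambda>x. f x + h x))\<^sup>2 + (L2_norm M (\<lambda>x. f x - h x))\<^sup>2
    = 2 * (L2_norm M f)\<^sup>2 + 2 * (L2_norm M h)\<^sup>2"
  using L2_norm_sq_add_cmult[OF assms, of 1] L2_norm_sq_add_cmult[OF assms, of "-1"] by simp

text \<open>
  Polarization, in the form in which it transports an isometry to inner products. The two spaces are
  unrelated; only the norms of \<open>f + c h\<close> and of their images are compared.
\<close>

lemma L2_inner_eqI:
  assumes f: "f \<in> L2 M" "h \<in> L2 M" and f': "f' \<in> L2 N" "h' \<in> L2 N"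
    and norms: "(L2_norm M f)\<^sup>2 = (L2_norm N f')\<^sup>2" "(L2_norm M h)\<^sup>2 = (L2_norm N h')\<^sup>2"
    and comb: "\<And>c. (L2_norm M (\<lambda>x. f x + c * h x))\<^sup>2 = (L2_norm N (\<lambda>x. f' x + c * h' x))\<^sup>2"
  shows "L2_inner M f h = L2_inner N f' h'"
proof -
  have eq: "Re (cnj c * L2_inner M f h) = Re (cnj c * L2_inner N f' h')" for c
    using comb[of c] norms by (simp only: L2_norm_sq_add_cmult[OF f] L2_norm_sq_add_cmult[OF f'])
  show ?thesis using eq[of 1] eq[of \<i>] by (simp add: complex_eq_iff)
qed


section \<open>Matrix coefficients and the Plancherel formula in coordinates\<close>

text \<open>
  The points of the unitary dual enter only through the chosen representatives, so the base space of
  the field is an arbitrary measure space \<open>\<mu>\<close> for which the Plancherel formula holds.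
\<close>

locale plancherel_field = unimodular_haar M
  for M :: "'g::{topological_group_add, t2_space, second_countable_topology} measure" +
  fixes \<mu> :: "'p measure" and H :: "'p \<Rightarrow> 'h hilb" and \<pi> :: "'p \<Rightarrow> 'g \<Rightarrow> 'h \<Rightarrow> 'h"
    and e :: "nat \<Rightarrow> 'p \<Rightarrow> 'h" and I :: "'p \<Rightarrow> nat set" and \<phi> :: "'p \<Rightarrow> nat \<Rightarrow> 'h"
  assumes rep: "p \<in> space \<mu> \<Longrightarrow> unitary_rep (H p) (\<pi> p)"
    and nontrivial: "p \<in> space \<mu> \<Longrightarrow> carrier (H p) \<noteq> {\<zero>\<^bsub>H p\<^esub>}"
    and basis: "p \<in> space \<mu> \<Longrightarrow> orthonormal_basis (H p) (I p) (\<phi> p)"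
    and plancherel: "cont_compact_support h \<Longrightarrow> ennreal ((L2_norm M h)\<^sup>2)
      = (\<integral>\<^sup>+p. hs_norm_sq (H p) (fourier_transform M h (H p) (\<pi> p)) \<partial>\<mu>)"
    and rep_field: "measurable_rep_field \<mu> H e \<pi>"
    and basis_section: "measurable_section \<mu> H e (\<lambda>p. if k \<in> I p then \<phi> p k else \<zero>\<^bsub>H p\<^esub>)"
begin

lemma unitary_representation: "p \<in> space \<mu> \<Longrightarrow> unitary_representation (H p) (\<pi> p)"
  by (rule unitary_representationI[OF rep])

text \<open>The basis extended by zero, so that all indices range over one set.\<close>

definition \<psi> :: "nat \<Rightarrow> 'p \<Rightarrow> 'h" where
  "\<psi> k p = (if k \<in> I p then \<phi> p k else \<zero>\<^bsub>H p\<^esub>)"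

definition coef :: "nat \<times> nat \<Rightarrow> 'p \<Rightarrow> 'g \<Rightarrow> complex" where
  "coef kl p y = hinner (H p) (\<pi> p y (\<psi> (fst kl) p)) (\<psi> (snd kl) p)"

lemma \<psi>_section: "measurable_section \<mu> H e (\<psi> k)"
  unfolding \<psi>_def by (rule basis_section)

lemma \<psi>_closed: "p \<in> space \<mu> \<Longrightarrow> \<psi> k p \<in> carrier (H p)"
  by (rule measurable_sectionD(1)[OF \<psi>_section])

lemma \<psi>_norm:
  assumes p: "p \<in> space \<mu>"
  shows "hnorm (H p) (\<psi> k p) = (if k \<in> I p then 1 else 0)"
proof -
  interpret unitary_representation "H p" "\<pi> p" by (rule unitary_representation[OF p])
  show ?thesis
    using basis[OF p] by (simp add: \<psi>_def hnorm_def orthonormal_basis_def)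
qed

lemma cmod_coef_le:
  assumes p: "p \<in> space \<mu>"
  shows "cmod (coef kl p y) \<le> (if kl \<in> I p \<times> I p then 1 else 0)"
proof -
  interpret unitary_representation "H p" "\<pi> p" by (rule unitary_representation[OF p])
  have "cmod (coef kl p y) \<le> hnorm (H p) (\<psi> (fst kl) p) * hnorm (H p) (\<psi> (snd kl) p)"
    unfolding coef_def by (intro cmod_coefficient_le \<psi>_closed p)
  then show ?thesis by (cases kl) (auto simp: \<psi>_norm[OF p] split: if_splits)
qed

lemma cmod_coef_le_1: "p \<in> space \<mu> \<Longrightarrow> cmod (coef kl p y) \<le> 1"
  using cmod_coef_le[of p kl y] by (auto split: if_splits)

lemma coef_outside: "p \<in> space \<mu> \<Longrightarrow> kl \<notin> I p \<times> I p \<Longrightarrow> coef kl p y = 0"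
  using cmod_coef_le[of p kl y] by simp

lemma coef_continuous:
  assumes p: "p \<in> space \<mu>"
  shows "continuous_on UNIV (coef kl p)"
proof -
  interpret unitary_representation "H p" "\<pi> p" by (rule unitary_representation[OF p])
  show ?thesis
    unfolding coef_def by (intro continuous_coefficient \<psi>_closed p)
qed

lemma coef_measurable [measurable]: "(\<lambda>(y, p). coef kl p y) \<in> borel_measurable (M \<Otimes>\<^sub>M \<mu>)"
proof -
  have "(\<lambda>p. coef kl p y) \<in> borel_measurable \<mu>" for y
    unfolding coef_def
  proof (rule measurable_section_hinner)
    show "measurable_hilbert_field \<mu> H e" using rep_field by (simp add: measurable_rep_field_def)
    show "measurable_section \<mu> H e (\<lambda>p. \<pi> p y (\<psi> (fst kl) p))"
      using rep_field \<psi>_section by (simp add: measurable_rep_field_def)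
  qed (rule \<psi>_section)
  then have "(\<lambda>(y, p). coef kl p y) \<in> borel_measurable (borel \<Otimes>\<^sub>M \<mu>)"
    by (intro continuous_measurable_imp_jointly_measurable coef_continuous)
  moreover have "sets (M \<Otimes>\<^sub>M \<mu>) = sets (borel \<Otimes>\<^sub>M \<mu>)"
    by (intro sets_pair_measure_cong) auto
  ultimately show ?thesis using measurable_cong_sets[OF _ refl] by blast
qed

text \<open>
  The entries of the group Fourier transform of \<open>F\<close> at \<open>p\<close> in the basis \<open>\<phi> p\<close>, extended by zero.
\<close>

definition transform :: "('g \<Rightarrow> complex) \<Rightarrow> 'p \<Rightarrow> nat \<times> nat \<Rightarrow> complex" where
  "transform F p kl = (\<integral>y. F y * cnj (coef kl p y) \<partial>M)"

lemma coef_measurable_section [measurable]: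
  assumes p: "p \<in> space \<mu>"
  shows "coef kl p \<in> borel_measurable M"
  by (rule continuous_measurable[OF coef_continuous[OF p]])

lemma transform_integrable:
  assumes F: "integrable M F" and p: "p \<in> space \<mu>"
  shows "integrable M (\<lambda>y. F y * cnj (coef kl p y))"
proof (rule Bochner_Integration.integrable_bound[OF F])
  show "(\<lambda>y. F y * cnj (coef kl p y)) \<in> borel_measurable M"
    using borel_measurable_integrable[OF F] coef_measurable_section[OF p] by measurable
  show "AE y in M. norm (F y * cnj (coef kl p y)) \<le> norm (F y)"
    using cmod_coef_le_1[OF p] by (intro AE_I2) (simp add: norm_mult mult_left_le)
qed

lemma cmod_transform_le:
  assumes F: "integrable M F" and p: "p \<in> space \<mu>"
  shows "cmod (transform F p kl) \<le> (\<integral>y. cmod (F y) \<partial>M)"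
proof -
  have "cmod (transform F p kl) \<le> (\<integral>y. norm (F y * cnj (coef kl p y)) \<partial>M)"
    unfolding transform_def by (rule integral_norm_bound)
  also have "\<dots> \<le> (\<integral>y. cmod (F y) \<partial>M)"
    using transform_integrable[OF assms] F cmod_coef_le_1[OF p]
    by (intro integral_mono integrable_norm) (auto simp: norm_mult mult_left_le)
  finally show ?thesis .
qed

lemma transform_outside: "p \<in> space \<mu> \<Longrightarrow> kl \<notin> I p \<times> I p \<Longrightarrow> transform F p kl = 0"
  by (simp add: transform_def coef_outside)

lemma hs_norm_sq_transform:
  assumes F: "integrable M F" and p: "p \<in> space \<mu>"
  shows "hs_norm_sq (H p) (fourier_transform M F (H p) (\<pi> p))
    = (\<integral>\<^sup>+kl. ennreal ((cmod (transform F p kl))\<^sup>2) \<partial>count_space UNIV)"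
proof -
  interpret unitary_representation "H p" "\<pi> p" by (rule unitary_representation[OF p])
  have "hs_norm_sq (H p) (fourier_transform M F (H p) (\<pi> p))
      = (\<Sum>\<^sub>\<infinity>kl\<in>I p \<times> I p. ennreal ((cmod (transform F p kl))\<^sup>2))"
    unfolding hs_norm_sq_fourier_transform[OF basis[OF p] sets_M F]
    by (intro infsum_cong) (auto simp: transform_def coef_def \<psi>_def)
  also have "\<dots> = (\<integral>\<^sup>+kl. ennreal ((cmod (transform F p kl))\<^sup>2) \<partial>count_space UNIV)"
    unfolding infsum_ennreal_eq_nn_integral
    by (intro nn_integral_cong) (auto simp: transform_outside[OF p] split: split_indicator)
  finally show ?thesis .
qed

lemma plancherel_transform:
  assumes "cont_compact_support h"
  shows "ennreal ((L2_norm M h)\<^sup>2)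
    = (\<integral>\<^sup>+p. \<integral>\<^sup>+kl. ennreal ((cmod (transform h p kl))\<^sup>2) \<partial>count_space UNIV \<partial>\<mu>)"
  unfolding plancherel[OF assms]
  by (intro nn_integral_cong hs_norm_sq_transform cont_compact_support_integrable assms)

lemma sigma_finite_count: "sigma_finite_measure (count_space (UNIV :: (nat \<times> nat) set))"
  by (rule sigma_finite_measure_count_space)

lemma transform_measurable:
  assumes [measurable]: "F \<in> borel_measurable M"
  shows "(\<lambda>p. transform F p kl) \<in> borel_measurable \<mu>"
proof -
  have [measurable]: "(\<lambda>(p, y). coef kl p y) \<in> borel_measurable (\<mu> \<Otimes>\<^sub>M M)"
    using measurable_pair_swap[OF coef_measurable[of kl]] by (simp add: split_def)
  have "(\<lambda>(p, y). F y * cnj (coef kl p y)) \<in> borel_measurable (\<mu> \<Otimes>\<^sub>M M)" by measurable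
  then show ?thesis
    unfolding transform_def by (rule borel_measurable_lebesgue_integral)
qed

lemma transform_norm_measurable:
  assumes "F \<in> borel_measurable M"
  shows "(\<lambda>p. \<integral>\<^sup>+kl. ennreal ((cmod (transform F p kl))\<^sup>2) \<partial>count_space UNIV) \<in> borel_measurable \<mu>"
proof -
  have "(\<lambda>(p, kl). ennreal ((cmod (transform F p kl))\<^sup>2)) \<in> borel_measurable (\<mu> \<Otimes>\<^sub>M count_space UNIV)"
    using transform_measurable[OF assms] by (intro measurable_pair_count_space) measurable
  then show ?thesis
    by (rule sigma_finite_measure.borel_measurable_nn_integral[OF sigma_finite_count])
qed

text \<open>
  Bumps shrinking to the neutral element are approximate units: for every \<open>p\<close> one of them, taken from
  a countable family, has a non-zero Fourier transform at \<open>p\<close>, since a diagonal matrix coefficient is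
  continuous with value \<open>1\<close> at \<open>0\<close>.
\<close>

lemma transform_separates:
  obtains \<B> where "countable \<B>" "\<And>h. h \<in> \<B> \<Longrightarrow> cont_compact_support h"
    "\<And>p. p \<in> space \<mu> \<Longrightarrow> \<exists>h\<in>\<B>. \<exists>kl. transform h p kl \<noteq> 0"
proof -
  obtain \<U> :: "'g set set" where \<U>: "countable \<U>" "topological_basis \<U>"
    using ex_countable_basis by metis
  have "\<exists>h. continuous_on UNIV h \<and> h 0 = (1 :: real) \<and> (\<forall>y. 0 \<le> h y) \<and> (\<forall>y. y \<notin> U \<longrightarrow> h y = 0) \<and>
      (\<exists>K. compact K \<and> (\<forall>y. y \<notin> K \<longrightarrow> h y = 0))" if "U \<in> {U \<in> \<U>. 0 \<in> U}" for U :: "'g set"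
  proof -
    have U: "open U" "0 \<in> U" using that topological_basis_open[OF \<U>(2)] by auto
    obtain h :: "'g \<Rightarrow> real" and K where "continuous_on UNIV h" "h 0 = 1" "\<And>y. 0 \<le> h y"
        "compact K" "\<And>y. y \<notin> K \<Longrightarrow> h y = 0" "\<And>y. y \<notin> U \<Longrightarrow> h y = 0"
      by (rule bump_function[OF U]) blast
    then show ?thesis by (intro exI[of _ h] conjI exI[of _ K]) auto
  qed
  then have "\<forall>U\<in>{U \<in> \<U>. 0 \<in> U}. \<exists>h. continuous_on UNIV h \<and> h 0 = (1 :: real) \<and> (\<forall>y. 0 \<le> h y) \<and>
      (\<forall>y. y \<notin> U \<longrightarrow> h y = 0) \<and> (\<exists>K. compact K \<and> (\<forall>y. y \<notin> K \<longrightarrow> h y = 0))"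
    by (rule ballI)
  then obtain b :: "'g set \<Rightarrow> 'g \<Rightarrow> real" where
    "\<forall>U\<in>{U \<in> \<U>. 0 \<in> U}. continuous_on UNIV (b U) \<and> b U 0 = 1 \<and> (\<forall>y. 0 \<le> b U y) \<and>
      (\<forall>y. y \<notin> U \<longrightarrow> b U y = 0) \<and> (\<exists>K. compact K \<and> (\<forall>y. y \<notin> K \<longrightarrow> b U y = 0))"
    by (rule bchoice[THEN exE])
  note b = bspec[OF this]
  define \<B> where "\<B> = (\<lambda>U y. complex_of_real (b U y)) ` {U \<in> \<U>. 0 \<in> U}"
  have cc: "cont_compact_support (\<lambda>y. complex_of_real (b U y))" if U: "U \<in> {U \<in> \<U>. 0 \<in> U}" for U
  proof -
    obtain K where K: "compact K" "\<And>y. y \<notin> K \<Longrightarrow> b U y = 0" using b[OF U] by blast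
    show ?thesis
    proof (rule cont_compact_supportI[OF _ K(1)])
      show "continuous_on UNIV (\<lambda>y. complex_of_real (b U y))"
        using b[OF U] by (intro continuous_on_of_real) blast
    qed (use K(2) in simp)
  qed
  show ?thesis
  proof (rule that[of \<B>])
    show "countable \<B>" unfolding \<B>_def using \<U>(1) by (intro countable_image) simp
    show "cont_compact_support h" if "h \<in> \<B>" for h
      using that cc unfolding \<B>_def by blast
    fix p assume p: "p \<in> space \<mu>"
    interpret unitary_representation "H p" "\<pi> p" by (rule unitary_representation[OF p])
    have "I p \<noteq> {}"
    proof
      assume "I p = {}"
      then have "u = \<zero>\<^bsub>H p\<^esub>" if "u \<in> carrier (H p)" for u
        using basis[OF p] that by (intro total_eq_zeroI[of "\<phi> p" "I p"]) (auto simp: orthonormal_basis_def)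
      moreover have "\<zero>\<^bsub>H p\<^esub> \<in> carrier (H p)" by (rule M.zero_closed)
      ultimately show False using nontrivial[OF p] by blast
    qed
    then obtain k where k: "k \<in> I p" by blast
    define c where "c = coef (k, k) p"
    have c_cont: "continuous_on UNIV c" unfolding c_def by (rule coef_continuous[OF p])
    have c0: "c 0 = 1"
      using k basis[OF p] \<psi>_closed[OF p, of k]
      by (simp add: c_def coef_def rep_zero \<psi>_def orthonormal_basis_def)
    have "open {y. 0 < Re (c y)}"
      by (intro open_Collect_less continuous_on_const continuous_on_Re c_cont)
    then obtain U where U: "U \<in> \<U>" "0 \<in> U" "U \<subseteq> {y. 0 < Re (c y)}"
      by (rule topological_basisE[OF \<U>(2)]) (use c0 in auto)
    then have U': "U \<in> {U \<in> \<U>. 0 \<in> U}" by simp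
    define h where "h y = complex_of_real (b U y)" for y
    have h: "cont_compact_support h" unfolding h_def by (rule cc[OF U'])
    \<comment> \<open>The bump lives where \<open>Re c > 0\<close>, so \<open>w \<ge> 0\<close> is continuous with \<open>w 0 = 1\<close>; its integral, the real
      part of the transform, is positive.\<close>
    define w where "w y = b U y * Re (c y)" for y
    have w0: "0 \<le> w y" for y
      using b[OF U'] U(3) by (cases "y \<in> U") (auto simp: w_def less_imp_le)
    have w_cont: "continuous_on UNIV w"
      unfolding w_def using b[OF U'] by (intro continuous_on_mult continuous_on_Re c_cont) blast
    note int = transform_integrable[OF cont_compact_support_integrable[OF h] p, of "(k, k)"]
    have w_eq: "Re (h y * cnj (coef (k, k) p y)) = w y" for y by (simp add: h_def w_def c_def)
    have w_int: "integrable M w" using integrable_Re[OF int] by (simp only: w_eq)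
    have "(\<integral>y. w y \<partial>M) \<noteq> 0"
    proof
      assume "(\<integral>y. w y \<partial>M) = 0"
      then have "AE y in M. w y = 0"
        using integral_nonneg_eq_0_iff_AE[OF w_int] w0 by simp
      then have "emeasure M {y. w y \<noteq> 0} = 0"
        using continuous_measurable[OF w_cont] by (subst (asm) AE_iff_measurable[OF _ refl]) auto
      moreover have "open {y. w y \<noteq> 0}"
        by (intro open_Collect_neq continuous_on_const w_cont)
      moreover have "0 \<in> {y. w y \<noteq> 0}" using b[OF U'] c0 by (simp add: w_def)
      ultimately show False using emeasure_open_pos by blast
    qed
    moreover have "Re (transform h p (k, k)) = (\<integral>y. w y \<partial>M)"
      unfolding transform_def using integral_Re[OF int] by (simp only: w_eq)
    ultimately have "transform h p (k, k) \<noteq> 0" by auto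
    moreover have "h \<in> \<B>" unfolding \<B>_def h_def using U' by blast
    ultimately show "\<exists>h\<in>\<B>. \<exists>kl. transform h p kl \<noteq> 0" by blast
  qed
qed

text \<open>
  For \<open>h\<close> in the countable separating family the squared Hilbert--Schmidt norm \<open>q h\<close> of its transform
  is integrable, so by Markov's inequality \<open>q h \<ge> 1/n\<close> holds on a set of finite measure; as one of
  the transforms is non-zero at each point, these countably many sets cover the space.
\<close>

lemma sigma_finite_mu: "sigma_finite_measure \<mu>"
proof
  obtain \<B> where \<B>: "countable \<B>" "\<And>h. h \<in> \<B> \<Longrightarrow> cont_compact_support h"
    "\<And>p. p \<in> space \<mu> \<Longrightarrow> \<exists>h\<in>\<B>. \<exists>kl. transform h p kl \<noteq> 0"
    by (rule transform_separates) blast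
  define q where "q h p = (\<integral>\<^sup>+kl. ennreal ((cmod (transform h p kl))\<^sup>2) \<partial>count_space UNIV)" for h p
  define A where "A h n = {p \<in> space \<mu>. 1 \<le> of_nat n * q h p}" for h and n :: nat
  have q_meas [measurable]: "q h \<in> borel_measurable \<mu>" if "h \<in> \<B>" for h
    unfolding q_def
    by (intro transform_norm_measurable borel_measurable_integrable cont_compact_support_integrable \<B>(2) that)
  have A_meas: "A h n \<in> sets \<mu>" if "h \<in> \<B>" for h n
    using q_meas[OF that] unfolding A_def by measurable
  have A_fin: "emeasure \<mu> (A h n) \<noteq> \<infinity>" if h: "h \<in> \<B>" for h n
  proof -
    have "emeasure \<mu> (A h n) \<le> of_nat n * (\<integral>\<^sup>+p. q h p * indicator (space \<mu>) p \<partial>\<mu>)"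
      unfolding A_def using q_meas[OF h] by (intro nn_integral_Markov_inequality) auto
    also have "(\<integral>\<^sup>+p. q h p * indicator (space \<mu>) p \<partial>\<mu>) = (\<integral>\<^sup>+p. q h p \<partial>\<mu>)"
      by (intro nn_integral_cong) auto
    also have "\<dots> = ennreal ((L2_norm M h)\<^sup>2)"
      unfolding q_def by (rule plancherel_transform[OF \<B>(2)[OF h], symmetric])
    also have "of_nat n * ennreal ((L2_norm M h)\<^sup>2) < \<infinity>"
      by (simp add: ennreal_mult_less_top ennreal_of_nat_eq_real_of_nat)
    finally show ?thesis by simp
  qed
  have A_cov: "\<exists>h\<in>\<B>. \<exists>n. p \<in> A h n" if p: "p \<in> space \<mu>" for p
  proof -
    obtain h kl where h: "h \<in> \<B>" "transform h p kl \<noteq> 0" using \<B>(3)[OF p] by blast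
    have "ennreal ((cmod (transform h p kl))\<^sup>2)
        = (\<integral>\<^sup>+j. ennreal ((cmod (transform h p j))\<^sup>2) * indicator {kl} j \<partial>count_space UNIV)"
      by simp
    also have "\<dots> \<le> q h p"
      unfolding q_def by (intro nn_integral_mono) (auto split: split_indicator)
    finally have le_q: "ennreal ((cmod (transform h p kl))\<^sup>2) \<le> q h p" .
    obtain n where n: "1 < real n * (cmod (transform h p kl))\<^sup>2"
      using ex_less_of_nat_mult[of "(cmod (transform h p kl))\<^sup>2" 1] h(2) by auto
    have "ennreal 1 \<le> ennreal (real n * (cmod (transform h p kl))\<^sup>2)"
      using n by (intro ennreal_leI) simp
    then have "1 \<le> of_nat n * ennreal ((cmod (transform h p kl))\<^sup>2)"
      by (simp add: ennreal_mult ennreal_of_nat_eq_real_of_nat)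
    also have "\<dots> \<le> of_nat n * q h p" by (intro mult_left_mono le_q) simp
    finally have "1 \<le> of_nat n * q h p" .
    then show ?thesis using p h(1) by (auto simp: A_def)
  qed
  define \<A> where "\<A> = (\<lambda>(h, n). A h n) ` (\<B> \<times> UNIV)"
  show "\<exists>\<A>. countable \<A> \<and> \<A> \<subseteq> sets \<mu> \<and> \<Union>\<A> = space \<mu> \<and> (\<forall>a\<in>\<A>. emeasure \<mu> a \<noteq> \<infinity>)"
  proof (intro exI[of _ \<A>] conjI ballI)
    show "countable \<A>" unfolding \<A>_def using \<B>(1) by (intro countable_image countable_SIGMA) auto
    show "\<A> \<subseteq> sets \<mu>" unfolding \<A>_def using A_meas by auto
    show "emeasure \<mu> a \<noteq> \<infinity>" if "a \<in> \<A>" for a using that A_fin by (auto simp: \<A>_def)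
    show "\<Union>\<A> = space \<mu>"
    proof (rule Set.set_eqI)
      fix p
      have "p \<in> \<Union>\<A> \<longleftrightarrow> (\<exists>h\<in>\<B>. \<exists>n. p \<in> A h n)" unfolding \<A>_def by auto
      also have "\<dots> \<longleftrightarrow> p \<in> space \<mu>" using A_cov by (auto simp: A_def)
      finally show "p \<in> \<Union>\<A> \<longleftrightarrow> p \<in> space \<mu>" .
    qed
  qed
qed

end


section \<open>The analysis operator of the frame\<close>

locale frame_field = plancherel_field M \<mu> H \<pi> e I \<phi>
  for M :: "'g::{topological_group_add, t2_space, second_countable_topology} measure"
    and \<mu> :: "'p measure" and H :: "'p \<Rightarrow> 'h hilb" and \<pi> e I \<phi> +
  fixes a :: "'g \<Rightarrow> complex"
  assumes a_continuous: "continuous_on UNIV a" and a_L2: "a \<in> L2 M" and a_norm: "L2_norm M a = 1"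
begin

text \<open>
  All frame coefficients of \<open>f\<close> as one function on \<open>G \<times> dual \<times> \<nat>\<^sup>2\<close>, extended by zero to the indices
  outside \<open>I p\<close>. Treating the sum over \<open>k\<close>, \<open>l\<close> as a third integration makes the frame identity the
  statement that \<open>analysis\<close> is an isometry into \<open>L\<^sup>2\<close> of a product measure.
\<close>

definition analysis :: "('g \<Rightarrow> complex) \<Rightarrow> ('g \<times> 'p) \<times> nat \<times> nat \<Rightarrow> complex" where
  "analysis f = (\<lambda>((x, p), kl). transform (\<lambda>y. f y * a (- x + y)) p kl)"

abbreviation N :: "(('g \<times> 'p) \<times> nat \<times> nat) measure" where
  "N \<equiv> (M \<Otimes>\<^sub>M \<mu>) \<Otimes>\<^sub>M count_space UNIV"

lemma window_integrable: "f \<in> L2 M \<Longrightarrow> integrable M (\<lambda>y. f y * a (- x + y))"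
  by (rule L2_times_integrable[OF _ L2_translate(1)[OF a_L2]])

lemma pair_sigma_finite_MM: "pair_sigma_finite M M"
  by (simp add: pair_sigma_finite_def sigma_finite_measure_axioms)

lemma pair_sigma_finite_M\<mu>: "pair_sigma_finite M \<mu>"
  by (simp add: pair_sigma_finite_def sigma_finite_measure_axioms sigma_finite_mu)

lemma pair_sigma_finite_N: "pair_sigma_finite (M \<Otimes>\<^sub>M \<mu>) (count_space (UNIV :: (nat \<times> nat) set))"
proof -
  interpret P: pair_sigma_finite M \<mu> by (rule pair_sigma_finite_M\<mu>)
  have "sigma_finite_measure (M \<Otimes>\<^sub>M \<mu>)" by unfold_locales
  then show ?thesis using sigma_finite_count by (simp add: pair_sigma_finite_def)
qed

lemma analysis_measurable [measurable]:
  assumes [measurable]: "f \<in> borel_measurable M"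
  shows "analysis f \<in> borel_measurable N"
proof -
  have a_meas [measurable]: "a \<in> borel_measurable M" by (rule continuous_measurable[OF a_continuous])
  have "(\<lambda>z. transform (\<lambda>y. f y * a (- fst z + y)) (snd z) kl) \<in> borel_measurable (M \<Otimes>\<^sub>M \<mu>)" for kl
    unfolding transform_def
  proof (rule borel_measurable_lebesgue_integral)
    have "(\<lambda>w. (fst (fst w), snd w)) \<in> measurable ((M \<Otimes>\<^sub>M \<mu>) \<Otimes>\<^sub>M M) (M \<Otimes>\<^sub>M M)"
      by measurable
    from measurable_compose[OF measurable_compose[OF this minus_plus_measurable] a_meas]
    have [measurable]: "(\<lambda>w. a (- fst (fst w) + snd w)) \<in> borel_measurable ((M \<Otimes>\<^sub>M \<mu>) \<Otimes>\<^sub>M M)"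
      by simp
    have "(\<lambda>w. (snd w, snd (fst w))) \<in> measurable ((M \<Otimes>\<^sub>M \<mu>) \<Otimes>\<^sub>M M) (M \<Otimes>\<^sub>M \<mu>)"
      by measurable
    from measurable_compose[OF this coef_measurable]
    have [measurable]: "(\<lambda>w. coef kl (snd (fst w)) (snd w)) \<in> borel_measurable ((M \<Otimes>\<^sub>M \<mu>) \<Otimes>\<^sub>M M)"
      by simp
    show "(\<lambda>(z, y). f y * a (- fst z + y) * cnj (coef kl (snd z) y))
        \<in> borel_measurable ((M \<Otimes>\<^sub>M \<mu>) \<Otimes>\<^sub>M M)"
      unfolding split_def by measurable
  qed
  from measurable_pair_count_space[OF this] show ?thesis
    by (simp add: analysis_def split_def)
qed

lemma analysis_add_cmult:
  assumes "f \<in> L2 M" "h \<in> L2 M" "z \<in> space N"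
  shows "analysis (\<lambda>y. f y + c * h y) z = analysis f z + c * analysis h z"
proof -
  obtain x p kl where z: "z = ((x, p), kl)" and p: "p \<in> space \<mu>"
    using assms(3) by (auto simp: space_pair_measure)
  note int = transform_integrable[OF window_integrable p]
  have "(\<lambda>y. (f y + c * h y) * a (- x + y) * cnj (coef kl p y))
      = (\<lambda>y. f y * a (- x + y) * cnj (coef kl p y) + c * (h y * a (- x + y) * cnj (coef kl p y)))"
    by (simp add: algebra_simps)
  then show ?thesis
    unfolding z analysis_def transform_def
    using int[OF assms(1)] int[OF assms(2)] by (simp add: mult.assoc)
qed

text \<open>
  Matrix coefficients are bounded by \<open>1\<close> and all translates of \<open>a\<close> have norm \<open>1\<close>, so evaluation of
  the coefficients is a contraction at every point.
\<close>

lemma cmod_analysis_sq_le: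
  assumes f: "f \<in> L2 M" and z: "z \<in> space N"
  shows "(cmod (analysis f z))\<^sup>2 \<le> (L2_norm M f)\<^sup>2"
proof -
  obtain x p kl where z: "z = ((x, p), kl)" and p: "p \<in> space \<mu>"
    using z by (auto simp: space_pair_measure)
  have "cmod (analysis f z) \<le> (\<integral>y. cmod (f y * a (- x + y)) \<partial>M)"
    unfolding z analysis_def using cmod_transform_le[OF window_integrable[OF f] p] by simp
  then have "(cmod (analysis f z))\<^sup>2 \<le> (\<integral>y. cmod (f y) * cmod (a (- x + y)) \<partial>M)\<^sup>2"
    by (intro power_mono) (simp_all add: norm_mult)
  also have "\<dots> \<le> (L2_norm M f)\<^sup>2 * (L2_norm M (\<lambda>y. a (- x + y)))\<^sup>2"
    by (rule L2_Cauchy_Schwarz[OF f L2_translate(1)[OF a_L2]])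
  also have "\<dots> = (L2_norm M f)\<^sup>2"
    by (simp add: L2_translate(2)[OF a_L2] a_norm)
  finally show ?thesis .
qed

lemma nn_integral_N:
  assumes [measurable]: "F \<in> borel_measurable N"
  shows "(\<integral>\<^sup>+z. F z \<partial>N) = (\<integral>\<^sup>+x. \<integral>\<^sup>+p. \<integral>\<^sup>+kl. F ((x, p), kl) \<partial>count_space UNIV \<partial>\<mu> \<partial>M)"
proof -
  have "(\<integral>\<^sup>+z. F z \<partial>N) = (\<integral>\<^sup>+w. \<integral>\<^sup>+kl. F (w, kl) \<partial>count_space UNIV \<partial>(M \<Otimes>\<^sub>M \<mu>))"
    by (rule sigma_finite_measure.nn_integral_fst[OF sigma_finite_count assms, symmetric])
  also have "\<dots> = (\<integral>\<^sup>+x. \<integral>\<^sup>+p. \<integral>\<^sup>+kl. F ((x, p), kl) \<partial>count_space UNIV \<partial>\<mu> \<partial>M)"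
    by (rule sigma_finite_measure.nn_integral_fst[OF sigma_finite_mu, symmetric])
      (rule sigma_finite_measure.borel_measurable_nn_integral_fst[OF sigma_finite_count assms])
  finally show ?thesis .
qed

text \<open>
  For compactly supported continuous \<open>h\<close> each product \<open>h(y) a(x\<^sup>-\<^sup>1y)\<close> is again of this kind, so the
  Plancherel formula applies to it for every \<open>x\<close>; integrating over \<open>x\<close> first turns the square of
  the window into \<open>\<parallel>a\<parallel>\<^sup>2 = 1\<close>.
\<close>

lemma nn_integral_analysis_cont_compact_support:
  assumes h: "cont_compact_support h"
  shows "(\<integral>\<^sup>+z. ennreal ((cmod (analysis h z))\<^sup>2) \<partial>N) = ennreal ((L2_norm M h)\<^sup>2)"
proof -
  interpret MM: pair_sigma_finite M M by (rule pair_sigma_finite_MM)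
  have hL2: "h \<in> L2 M" by (rule cont_compact_support_L2[OF h])
  have h_meas [measurable]: "h \<in> borel_measurable M" by (rule L2_measurable[OF hL2])
  have a_meas [measurable]: "a \<in> borel_measurable M" by (rule L2_measurable[OF a_L2])
  have [measurable]: "(\<lambda>(x, y). a (- x + y)) \<in> borel_measurable (M \<Otimes>\<^sub>M M)"
    using measurable_compose[OF minus_plus_measurable a_meas] by (simp add: split_def)
  have meas: "(\<lambda>z. ennreal ((cmod (analysis h z))\<^sup>2)) \<in> borel_measurable N" by measurable
  have ccx: "cont_compact_support (\<lambda>y. h y * a (- x + y))" for x
  proof (rule cont_compact_support_mult[OF h])
    show "continuous_on UNIV (\<lambda>y. a (- x + y))"
      by (rule continuous_on_compose2[OF a_continuous])
        (auto intro: continuous_on_add continuous_on_const continuous_on_id)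
  qed
  have "(\<integral>\<^sup>+z. ennreal ((cmod (analysis h z))\<^sup>2) \<partial>N)
      = (\<integral>\<^sup>+x. \<integral>\<^sup>+p. \<integral>\<^sup>+kl. ennreal ((cmod (transform (\<lambda>y. h y * a (- x + y)) p kl))\<^sup>2)
          \<partial>count_space UNIV \<partial>\<mu> \<partial>M)"
    unfolding nn_integral_N[OF meas] by (simp add: analysis_def)
  also have "\<dots> = (\<integral>\<^sup>+x. ennreal ((L2_norm M (\<lambda>y. h y * a (- x + y)))\<^sup>2) \<partial>M)"
    by (intro nn_integral_cong plancherel_transform[symmetric] ccx)
  also have "\<dots> = (\<integral>\<^sup>+x. \<integral>\<^sup>+y. ennreal ((cmod (h y))\<^sup>2) * ennreal ((cmod (a (- x + y)))\<^sup>2) \<partial>M \<partial>M)"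
  proof (rule nn_integral_cong)
    fix x
    have "ennreal ((L2_norm M (\<lambda>y. h y * a (- x + y)))\<^sup>2)
        = (\<integral>\<^sup>+y. ennreal ((cmod (h y * a (- x + y)))\<^sup>2) \<partial>M)"
      by (rule nn_integral_L2[OF cont_compact_support_L2[OF ccx], symmetric])
    also have "\<dots> = (\<integral>\<^sup>+y. ennreal ((cmod (h y))\<^sup>2) * ennreal ((cmod (a (- x + y)))\<^sup>2) \<partial>M)"
      by (intro nn_integral_cong) (simp add: norm_mult power_mult_distrib ennreal_mult)
    finally show "ennreal ((L2_norm M (\<lambda>y. h y * a (- x + y)))\<^sup>2)
        = (\<integral>\<^sup>+y. ennreal ((cmod (h y))\<^sup>2) * ennreal ((cmod (a (- x + y)))\<^sup>2) \<partial>M)" .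
  qed
  also have "\<dots> = (\<integral>\<^sup>+y. \<integral>\<^sup>+x. ennreal ((cmod (h y))\<^sup>2) * ennreal ((cmod (a (- x + y)))\<^sup>2) \<partial>M \<partial>M)"
    by (rule MM.Fubini'[symmetric]) measurable
  also have "\<dots> = (\<integral>\<^sup>+y. ennreal ((cmod (h y))\<^sup>2) * (\<integral>\<^sup>+x. ennreal ((cmod (a (- x + y)))\<^sup>2) \<partial>M) \<partial>M)"
    by (intro nn_integral_cong nn_integral_cmult) measurable
  also have "\<dots> = (\<integral>\<^sup>+y. ennreal ((cmod (h y))\<^sup>2) \<partial>M)"
  proof (rule nn_integral_cong)
    fix y
    have "(\<integral>\<^sup>+x. ennreal ((cmod (a (- x + y)))\<^sup>2) \<partial>M) = (\<integral>\<^sup>+x. ennreal ((cmod (a x))\<^sup>2) \<partial>M)"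
      by (rule nn_integral_minus_plus[of "\<lambda>x. ennreal ((cmod (a x))\<^sup>2)"]) measurable
    then show "ennreal ((cmod (h y))\<^sup>2) * (\<integral>\<^sup>+x. ennreal ((cmod (a (- x + y)))\<^sup>2) \<partial>M)
        = ennreal ((cmod (h y))\<^sup>2)"
      by (simp add: nn_integral_L2[OF a_L2] a_norm)
  qed
  also have "\<dots> = ennreal ((L2_norm M h)\<^sup>2)" by (rule nn_integral_L2[OF hL2])
  finally show ?thesis .
qed

text \<open>
  Approximating \<open>f\<close> in \<open>L\<^sup>2\<close> makes \<open>analysis\<close> converge at every point, so Fatou's lemma extends the
  upper bound from the dense subspace to all of \<open>L\<^sup>2\<close>.
\<close>

lemma nn_integral_analysis_le:
  assumes f: "f \<in> L2 M"
  shows "(\<integral>\<^sup>+z. ennreal ((cmod (analysis f z))\<^sup>2) \<partial>N) \<le> ennreal ((L2_norm M f)\<^sup>2)"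
proof -
  have "\<forall>n. \<exists>h. cont_compact_support h \<and> (L2_norm M (\<lambda>x. f x - h x))\<^sup>2 < inverse (real (Suc n))"
    using cont_compact_support_dense_L2[OF f] unfolding approximable_def by simp
  then obtain h where h: "\<And>n. cont_compact_support (h n)"
      and d: "\<And>n. (L2_norm M (\<lambda>x. f x - h n x))\<^sup>2 < inverse (real (Suc n))"
    by metis
  have hL2: "h n \<in> L2 M" for n by (rule cont_compact_support_L2[OF h])
  have [measurable]: "h n \<in> borel_measurable M" for n by (rule L2_measurable[OF hL2])
  have dL2: "(\<lambda>x. f x - h n x) \<in> L2 M" for n by (rule L2_diff[OF f hL2])
  have d0: "(\<lambda>n. (L2_norm M (\<lambda>x. f x - h n x))\<^sup>2) \<longlonglongrightarrow> 0"
  proof (rule tendsto_sandwich[OF _ _ tendsto_const LIMSEQ_inverse_real_of_nat])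
    show "\<forall>\<^sub>F n in sequentially. (L2_norm M (\<lambda>x. f x - h n x))\<^sup>2 \<le> inverse (real (Suc n))"
      by (intro always_eventually allI less_imp_le d)
  qed simp
  have norms: "(\<lambda>n. ennreal ((L2_norm M (h n))\<^sup>2)) \<longlonglongrightarrow> ennreal ((L2_norm M f)\<^sup>2)"
    by (rule tendsto_ennrealI[OF L2_norm_sq_zero_tendsto_imp[OF f hL2 d0]])
  have pt: "(\<lambda>n. ennreal ((cmod (analysis (h n) z))\<^sup>2)) \<longlonglongrightarrow> ennreal ((cmod (analysis f z))\<^sup>2)"
    if z: "z \<in> space N" for z
  proof -
    have "(cmod (analysis f z - analysis (h n) z))\<^sup>2 \<le> (L2_norm M (\<lambda>x. f x - h n x))\<^sup>2" for n
      using cmod_analysis_sq_le[OF dL2 z] analysis_add_cmult[OF f hL2 z, of "-1"] by simp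
    then have "(\<lambda>n. (cmod (analysis f z - analysis (h n) z))\<^sup>2) \<longlonglongrightarrow> 0"
      by (intro tendsto_sandwich[OF _ _ tendsto_const d0] always_eventually allI) auto
    then have "(\<lambda>n. sqrt ((cmod (analysis f z - analysis (h n) z))\<^sup>2)) \<longlonglongrightarrow> sqrt 0"
      by (rule tendsto_real_sqrt)
    then have "(\<lambda>n. cmod (analysis (h n) z - analysis f z)) \<longlonglongrightarrow> 0"
      by (simp add: norm_minus_commute)
    then have "(\<lambda>n. analysis (h n) z) \<longlonglongrightarrow> analysis f z"
      by (rule LIM_zero_cancel[OF tendsto_norm_zero_cancel])
    then show ?thesis by (intro tendsto_ennrealI tendsto_power tendsto_norm)
  qed
  have "(\<integral>\<^sup>+z. ennreal ((cmod (analysis f z))\<^sup>2) \<partial>N)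
      = (\<integral>\<^sup>+z. liminf (\<lambda>n. ennreal ((cmod (analysis (h n) z))\<^sup>2)) \<partial>N)"
    by (intro nn_integral_cong lim_imp_Liminf[symmetric] pt) auto
  also have "\<dots> \<le> liminf (\<lambda>n. \<integral>\<^sup>+z. ennreal ((cmod (analysis (h n) z))\<^sup>2) \<partial>N)"
    by (intro nn_integral_liminf) measurable
  also have "\<dots> = liminf (\<lambda>n. ennreal ((L2_norm M (h n))\<^sup>2))"
    by (simp only: nn_integral_analysis_cont_compact_support[OF h])
  also have "\<dots> = ennreal ((L2_norm M f)\<^sup>2)"
    by (rule lim_imp_Liminf[OF _ norms]) simp
  finally show ?thesis .
qed

lemma analysis_L2:
  assumes f: "f \<in> L2 M"
  shows "analysis f \<in> L2 N" "(L2_norm N (analysis f))\<^sup>2 \<le> (L2_norm M f)\<^sup>2"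
proof -
  have [measurable]: "analysis f \<in> borel_measurable N"
    by (rule analysis_measurable[OF L2_measurable[OF f]])
  have "integrable N (\<lambda>z. (cmod (analysis f z))\<^sup>2)"
    using nn_integral_analysis_le[OF f]
    by (intro integrableI_bounded) (auto intro: le_less_trans)
  then show L2: "analysis f \<in> L2 N" by (simp add: L2_def)
  show "(L2_norm N (analysis f))\<^sup>2 \<le> (L2_norm M f)\<^sup>2"
    using nn_integral_analysis_le[OF f] nn_integral_L2[OF L2]
    by (simp add: ennreal_le_iff)
qed

lemma L2_norm_N_cong:
  "(\<And>z. z \<in> space N \<Longrightarrow> F z = G z) \<Longrightarrow> L2_norm N F = L2_norm N G"
  unfolding L2_norm_def by (simp cong: Bochner_Integration.integral_cong)

text \<open>
  The defect \<open>D(f) = \<parallel>f\<parallel>\<^sup>2 - \<parallel>analysis f\<parallel>\<^sup>2\<close> is a non-negative quadratic form vanishing on the dense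
  subspace. By the parallelogram law \<open>D(f) \<le> 2 D(f - h) + 2 D(h) \<le> 2 \<parallel>f - h\<parallel>\<^sup>2\<close> for \<open>h\<close> in that
  subspace, so it vanishes everywhere.
\<close>

lemma analysis_isometry:
  assumes f: "f \<in> L2 M"
  shows "(L2_norm N (analysis f))\<^sup>2 = (L2_norm M f)\<^sup>2"
proof (rule antisym[OF analysis_L2(2)[OF f]], rule field_le_epsilon)
  fix \<epsilon> :: real assume "\<epsilon> > 0"
  then have "\<epsilon> / 2 > 0" by simp
  then obtain h where h: "cont_compact_support h" "(L2_norm M (\<lambda>x. f x - h x))\<^sup>2 < \<epsilon> / 2"
    using approximableD[OF cont_compact_support_dense_L2[OF f]] by blast
  define d where "d = (\<lambda>x. f x - h x)"
  have hL2: "h \<in> L2 M" by (rule cont_compact_support_L2[OF h(1)])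
  have dL2: "d \<in> L2 M" unfolding d_def by (rule L2_diff[OF f hL2])
  have dh: "(\<lambda>x. d x - h x) \<in> L2 M" by (rule L2_diff[OF dL2 hL2])
  have "(L2_norm N (analysis h))\<^sup>2 = (L2_norm M h)\<^sup>2"
    using nn_integral_analysis_cont_compact_support[OF h(1)] nn_integral_L2[OF analysis_L2(1)[OF hL2]]
    by simp
  moreover have "(L2_norm M f)\<^sup>2 + (L2_norm M (\<lambda>x. d x - h x))\<^sup>2 = 2 * (L2_norm M d)\<^sup>2 + 2 * (L2_norm M h)\<^sup>2"
    using L2_parallelogram[OF dL2 hL2] by (simp add: d_def)
  moreover have "(L2_norm N (analysis f))\<^sup>2 + (L2_norm N (analysis (\<lambda>x. d x - h x)))\<^sup>2
      = 2 * (L2_norm N (analysis d))\<^sup>2 + 2 * (L2_norm N (analysis h))\<^sup>2"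
  proof -
    have "L2_norm N (analysis f) = L2_norm N (\<lambda>z. analysis d z + analysis h z)"
      using analysis_add_cmult[OF dL2 hL2, of _ 1] by (intro L2_norm_N_cong) (simp add: d_def)
    moreover have "L2_norm N (analysis (\<lambda>x. d x - h x)) = L2_norm N (\<lambda>z. analysis d z - analysis h z)"
      using analysis_add_cmult[OF dL2 hL2, of _ "-1"] by (intro L2_norm_N_cong) simp
    ultimately show ?thesis
      using L2_parallelogram[OF analysis_L2(1)[OF dL2] analysis_L2(1)[OF hL2]] by simp
  qed
  moreover have "0 \<le> (L2_norm N (analysis d))\<^sup>2" by simp
  moreover have "(L2_norm N (analysis (\<lambda>x. d x - h x)))\<^sup>2 \<le> (L2_norm M (\<lambda>x. d x - h x))\<^sup>2"
    by (rule analysis_L2(2)[OF dh])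
  moreover have "(L2_norm M d)\<^sup>2 < \<epsilon> / 2" using h(2) by (simp add: d_def)
  ultimately show "(L2_norm M f)\<^sup>2 \<le> (L2_norm N (analysis f))\<^sup>2 + \<epsilon>"
    by linarith
qed

lemma L2_inner_analysis:
  assumes f: "f \<in> L2 M" and h: "h \<in> L2 M"
  shows "L2_inner N (analysis f) (analysis h) = L2_inner M f h"
proof (rule L2_inner_eqI[symmetric, OF f h analysis_L2(1)[OF f] analysis_L2(1)[OF h]])
  fix c
  have "L2_norm N (\<lambda>z. analysis f z + c * analysis h z) = L2_norm N (analysis (\<lambda>x. f x + c * h x))"
    using analysis_add_cmult[OF f h] by (intro L2_norm_N_cong) simp
  then show "(L2_norm M (\<lambda>x. f x + c * h x))\<^sup>2 = (L2_norm N (\<lambda>z. analysis f z + c * analysis h z))\<^sup>2"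
    using analysis_isometry[OF L2_add[OF f L2_cmult[OF h]]] by simp
qed (simp_all add: analysis_isometry f h)


section \<open>The frame functions\<close>

abbreviation g :: "'g \<Rightarrow> 'p \<Rightarrow> nat \<Rightarrow> nat \<Rightarrow> 'g \<Rightarrow> complex" where
  "g x p k l \<equiv> frame_fun a (H p) (\<pi> p) (\<phi> p) x k l"

lemma frame_fun_coef:
  assumes p: "p \<in> space \<mu>" and k: "k \<in> I p" and l: "l \<in> I p"
  shows "g x p k l = (\<lambda>y. cnj (a (- x + y)) * coef (k, l) p y)"
proof -
  interpret unitary_representation "H p" "\<pi> p" by (rule unitary_representation[OF p])
  have "\<phi> p k \<in> carrier (H p)" "\<phi> p l \<in> carrier (H p)"
    using k l basis[OF p] orthonormal_basis_closed by blast+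
  then show ?thesis
    using k l by (auto simp: frame_fun_eq coef_def \<psi>_def)
qed

lemma frame_fun_L2:
  assumes p: "p \<in> space \<mu>" and k: "k \<in> I p" and l: "l \<in> I p"
  shows "g x p k l \<in> L2 M"
proof (rule L2I_dominated[where w = "\<lambda>y. cmod (a (- x + y))"])
  have ax: "(\<lambda>y. a (- x + y)) \<in> L2 M" by (rule L2_translate(1)[OF a_L2])
  show "integrable M (\<lambda>y. (cmod (a (- x + y)))\<^sup>2)" by (rule L2_integrable_sq[OF ax])
  show "g x p k l \<in> borel_measurable M"
    unfolding frame_fun_coef[OF assms]
    using L2_measurable[OF ax] coef_measurable_section[OF p] by measurable
  show "cmod (g x p k l y) \<le> cmod (a (- x + y))" for y
    unfolding frame_fun_coef[OF assms] using cmod_coef_le_1[OF p] by (simp add: norm_mult mult_left_le)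
qed

lemma L2_inner_frame_fun:
  assumes "p \<in> space \<mu>" "k \<in> I p" "l \<in> I p"
  shows "L2_inner M f (g x p k l) = analysis f ((x, p), (k, l))"
  unfolding frame_fun_coef[OF assms] by (simp add: L2_inner_def analysis_def transform_def mult.assoc)

lemma analysis_outside: "p \<in> space \<mu> \<Longrightarrow> kl \<notin> I p \<times> I p \<Longrightarrow> analysis f ((x, p), kl) = 0"
  by (simp add: analysis_def transform_outside)

lemma infsum_frame_coefficients_sq:
  assumes p: "p \<in> space \<mu>"
  shows "(\<Sum>\<^sub>\<infinity>(k, l)\<in>I p \<times> I p. ennreal ((cmod (L2_inner M f (g x p k l)))\<^sup>2))
    = (\<integral>\<^sup>+kl. ennreal ((cmod (analysis f ((x, p), kl)))\<^sup>2) \<partial>count_space UNIV)"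
proof -
  have "(\<Sum>\<^sub>\<infinity>(k, l)\<in>I p \<times> I p. ennreal ((cmod (L2_inner M f (g x p k l)))\<^sup>2))
      = (\<Sum>\<^sub>\<infinity>kl\<in>I p \<times> I p. ennreal ((cmod (analysis f ((x, p), kl)))\<^sup>2))"
    by (intro infsum_cong) (auto simp: L2_inner_frame_fun[OF p])
  also have "\<dots> = (\<integral>\<^sup>+kl. ennreal ((cmod (analysis f ((x, p), kl)))\<^sup>2) \<partial>count_space UNIV)"
    unfolding infsum_ennreal_eq_nn_integral
    by (intro nn_integral_cong) (auto simp: analysis_outside[OF p] split: split_indicator)
  finally show ?thesis .
qed

lemma frame_norm_identity:
  assumes f: "f \<in> L2 M"
  shows "(\<lambda>(x, p). \<Sum>\<^sub>\<infinity>(k, l)\<in>I p \<times> I p. ennreal ((cmod (L2_inner M f (g x p k l)))\<^sup>2))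
      \<in> borel_measurable (M \<Otimes>\<^sub>M \<mu>)"
    and "ennreal ((L2_norm M f)\<^sup>2) =
      (\<integral>\<^sup>+(x, p). (\<Sum>\<^sub>\<infinity>(k, l)\<in>I p \<times> I p. ennreal ((cmod (L2_inner M f (g x p k l)))\<^sup>2)) \<partial>(M \<Otimes>\<^sub>M \<mu>))"
proof -
  define S where "S = (\<lambda>(x, p). \<Sum>\<^sub>\<infinity>(k, l)\<in>I p \<times> I p. ennreal ((cmod (L2_inner M f (g x p k l)))\<^sup>2))"
  define R where "R w = (\<integral>\<^sup>+kl. ennreal ((cmod (analysis f (w, kl)))\<^sup>2) \<partial>count_space UNIV)" for w
  have SR: "S w = R w" if "w \<in> space (M \<Otimes>\<^sub>M \<mu>)" for w
    using that infsum_frame_coefficients_sq by (auto simp: S_def R_def space_pair_measure)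
  have meas: "(\<lambda>z. ennreal ((cmod (analysis f z))\<^sup>2)) \<in> borel_measurable N"
    using analysis_measurable[OF L2_measurable[OF f]] by measurable
  have "R \<in> borel_measurable (M \<Otimes>\<^sub>M \<mu>)"
    unfolding R_def
    by (rule sigma_finite_measure.borel_measurable_nn_integral_fst[OF sigma_finite_count meas])
  then show "S \<in> borel_measurable (M \<Otimes>\<^sub>M \<mu>)"
    using measurable_cong[of "M \<Otimes>\<^sub>M \<mu>" S R] SR by blast
  have "(\<integral>\<^sup>+w. S w \<partial>(M \<Otimes>\<^sub>M \<mu>)) = (\<integral>\<^sup>+w. R w \<partial>(M \<Otimes>\<^sub>M \<mu>))"
    by (rule nn_integral_cong) (rule SR)
  also have "\<dots> = (\<integral>\<^sup>+z. ennreal ((cmod (analysis f z))\<^sup>2) \<partial>N)"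
    unfolding R_def by (rule sigma_finite_measure.nn_integral_fst[OF sigma_finite_count meas])
  also have "\<dots> = ennreal ((L2_norm M f)\<^sup>2)"
    by (simp add: nn_integral_L2[OF analysis_L2(1)[OF f]] analysis_isometry[OF f])
  finally show "ennreal ((L2_norm M f)\<^sup>2) = (\<integral>\<^sup>+w. S w \<partial>(M \<Otimes>\<^sub>M \<mu>))" by simp
qed

text \<open>
  On a countable index set the unconditional sum and the integral for the counting measure agree,
  also in the degenerate case, where both are \<open>0\<close>. The integral is measurable in its parameters.
\<close>

lemma infsum_frame_products:
  fixes f1 f2 :: "'g \<Rightarrow> complex" and x :: 'g
  assumes p: "p \<in> space \<mu>"
  defines "P \<equiv> \<lambda>kl. analysis f1 ((x, p), kl) * cnj (analysis f2 ((x, p), kl))"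
  shows "(\<lambda>(k, l). L2_inner M f1 (g x p k l) * cnj (L2_inner M f2 (g x p k l))) summable_on I p \<times> I p
      \<longleftrightarrow> integrable (count_space UNIV) P"
    and "(\<Sum>\<^sub>\<infinity>(k, l)\<in>I p \<times> I p. L2_inner M f1 (g x p k l) * cnj (L2_inner M f2 (g x p k l)))
      = (\<integral>kl. P kl \<partial>count_space UNIV)"
proof -
  let ?G = "\<lambda>(k, l). L2_inner M f1 (g x p k l) * cnj (L2_inner M f2 (g x p k l))"
  have summ: "P summable_on UNIV \<longleftrightarrow> integrable (count_space UNIV) P"
    using abs_summable_equivalent[of P UNIV] summable_on_iff_abs_summable_on_complex[of P UNIV]
    by (simp add: Infinite_Set_Sum.abs_summable_on_def)
  have G: "?G summable_on I p \<times> I p \<longleftrightarrow> P summable_on UNIV"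
    by (rule summable_on_cong_neutral)
      (auto simp: P_def L2_inner_frame_fun[OF p] analysis_outside[OF p])
  show "?G summable_on I p \<times> I p \<longleftrightarrow> integrable (count_space UNIV) P"
    using G summ by simp
  have "infsum ?G (I p \<times> I p) = infsum P UNIV"
    by (rule infsum_cong_neutral)
      (auto simp: P_def L2_inner_frame_fun[OF p] analysis_outside[OF p])
  also have "\<dots> = (\<integral>kl. P kl \<partial>count_space UNIV)"
  proof (cases "P summable_on UNIV")
    case True
    then show ?thesis
      using infsetsum_infsum[of P UNIV] summ
      by (simp add: Infinite_Set_Sum.abs_summable_on_def infsetsum_def)
  next
    case False
    then show ?thesis
      using summ by (simp add: infsum_not_exists not_integrable_integral_eq)
  qed
  finally show "infsum ?G (I p \<times> I p) = (\<integral>kl. P kl \<partial>count_space UNIV)" .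
qed

text \<open>
  The product of the two coefficient functions is integrable over the product space. Fubini's
  theorem gives summability in \<open>k\<close>, \<open>l\<close> for almost every \<open>(x, p)\<close> and evaluates the iterated integral.
\<close>

lemma frame_inner_identity:
  assumes f1: "f1 \<in> L2 M" and f2: "f2 \<in> L2 M"
  shows "AE (x, p) in M \<Otimes>\<^sub>M \<mu>.
      (\<lambda>(k, l). L2_inner M f1 (g x p k l) * cnj (L2_inner M f2 (g x p k l))) summable_on I p \<times> I p"
    and "has_bochner_integral (M \<Otimes>\<^sub>M \<mu>)
      (\<lambda>(x, p). \<Sum>\<^sub>\<infinity>(k, l)\<in>I p \<times> I p. L2_inner M f1 (g x p k l) * cnj (L2_inner M f2 (g x p k l)))
      (L2_inner M f1 f2)"
proof -
  interpret N: pair_sigma_finite "M \<Otimes>\<^sub>M \<mu>" "count_space (UNIV :: (nat \<times> nat) set)"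
    by (rule pair_sigma_finite_N)
  define P where "P = (\<lambda>z. analysis f1 z * cnj (analysis f2 z))"
  have P: "integrable N P"
    unfolding P_def by (rule L2_inner_integrable[OF analysis_L2(1)[OF f1] analysis_L2(1)[OF f2]])
  have "AE w in M \<Otimes>\<^sub>M \<mu>. integrable (count_space UNIV) (\<lambda>kl. P (w, kl))"
    by (rule N.AE_integrable_fst'[OF P])
  then show "AE (x, p) in M \<Otimes>\<^sub>M \<mu>.
      (\<lambda>(k, l). L2_inner M f1 (g x p k l) * cnj (L2_inner M f2 (g x p k l))) summable_on I p \<times> I p"
    by (rule AE_mp, intro AE_I2) (auto simp: space_pair_measure P_def infsum_frame_products(1))
  define S where "S = (\<lambda>(x, p). \<Sum>\<^sub>\<infinity>(k, l)\<in>I p \<times> I p. L2_inner M f1 (g x p k l) * cnj (L2_inner M f2 (g x p k l)))"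
  have S: "S w = (\<integral>kl. P (w, kl) \<partial>count_space UNIV)" if "w \<in> space (M \<Otimes>\<^sub>M \<mu>)" for w
    using that by (auto simp: S_def P_def space_pair_measure infsum_frame_products(2))
  have "has_bochner_integral (M \<Otimes>\<^sub>M \<mu>) (\<lambda>w. \<integral>kl. P (w, kl) \<partial>count_space UNIV) (L2_inner M f1 f2)"
    using N.integrable_fst'[OF P] N.integral_fst'[OF P] L2_inner_analysis[OF f1 f2]
    by (simp add: has_bochner_integral_iff L2_inner_def P_def)
  then show "has_bochner_integral (M \<Otimes>\<^sub>M \<mu>) S (L2_inner M f1 f2)"
    using has_bochner_integral_cong[of "M \<Otimes>\<^sub>M \<mu>" "M \<Otimes>\<^sub>M \<mu>" S, OF refl S refl] by simp
qed

end


section \<open>The frame decomposition over the unitary dual\<close>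

lemma space_dual_borel: "space dual_borel = unitary_dual"
  unfolding dual_borel_def by (rule space_measure_of) auto

lemma unitary_dual_subset_irreps:
  assumes "p \<in> unitary_dual" "r \<in> p"
  shows "r \<in> irreps"
  using assms by (auto simp: unitary_dual_def quotient_def)

theorem corollary2p4:
  fixes M :: "'g::{topological_group_add, t2_space, second_countable_topology} measure"
    and \<mu> :: "'g rep set measure"
    and H :: "'g rep set \<Rightarrow> vec hilb"
    and \<pi> :: "'g rep set \<Rightarrow> 'g \<Rightarrow> vec \<Rightarrow> vec"
    and e :: "nat \<Rightarrow> 'g rep set \<Rightarrow> vec"
    and I :: "'g rep set \<Rightarrow> nat set"
    and \<phi> :: "'g rep set \<Rightarrow> nat \<Rightarrow> vec"
    and a :: "'g \<Rightarrow> complex"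
  defines "g \<equiv> \<lambda>x p k l. frame_fun a (H p) (\<pi> p) (\<phi> p) x k l"
  assumes "locally_compact_space (euclidean :: 'g topology)"
    and "unimodular TYPE('g)"
    and "type_I TYPE('g)"
    and "haar_measure M"
    and "\<And>p. p \<in> unitary_dual \<Longrightarrow> (H p, \<pi> p) \<in> p"
    and "plancherel_measure M H \<pi> \<mu>"
    and "measurable_rep_field \<mu> H e \<pi>"
    and "\<And>p. p \<in> unitary_dual \<Longrightarrow> orthonormal_basis (H p) (I p) (\<phi> p)"
    and "\<And>k. measurable_section \<mu> H e (\<lambda>p. if k \<in> I p then \<phi> p k else \<zero>\<^bsub>H p\<^esub>)"
    and "continuous_on UNIV a" and "bounded (range a)"
    and "a \<in> L2 M" and "L2_norm M a = 1"
  shows "(\<forall>x. \<forall>p\<in>unitary_dual. \<forall>k\<in>I p. \<forall>l\<in>I p. g x p k l \<in> L2 M) \<and>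
    (\<forall>f\<in>L2 M.
      (\<lambda>(x, p). \<Sum>\<^sub>\<infinity>(k, l)\<in>I p \<times> I p. ennreal ((cmod (L2_inner M f (g x p k l)))\<^sup>2))
        \<in> borel_measurable (M \<Otimes>\<^sub>M \<mu>) \<and>
      ennreal ((L2_norm M f)\<^sup>2) =
        (\<integral>\<^sup>+(x, p). (\<Sum>\<^sub>\<infinity>(k, l)\<in>I p \<times> I p. ennreal ((cmod (L2_inner M f (g x p k l)))\<^sup>2))
          \<partial>(M \<Otimes>\<^sub>M \<mu>))) \<and>
    (\<forall>f1\<in>L2 M. \<forall>f2\<in>L2 M.
      (AE (x, p) in M \<Otimes>\<^sub>M \<mu>.
        (\<lambda>(k, l). L2_inner M f1 (g x p k l) * cnj (L2_inner M f2 (g x p k l)))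
          summable_on I p \<times> I p) \<and>
      has_bochner_integral (M \<Otimes>\<^sub>M \<mu>)
        (\<lambda>(x, p). \<Sum>\<^sub>\<infinity>(k, l)\<in>I p \<times> I p.
          L2_inner M f1 (g x p k l) * cnj (L2_inner M f2 (g x p k l)))
        (L2_inner M f1 f2))"
proof -
  have sp: "space \<mu> = unitary_dual"
    using assms(7) sets_eq_imp_space_eq[of \<mu> dual_borel]
    by (simp add: plancherel_measure_def space_dual_borel)
  have irr: "irreducible_rep (H p) (\<pi> p)" if "p \<in> unitary_dual" for p
    using unitary_dual_subset_irreps[OF that assms(6)[OF that]] by (simp add: irreps_def)
  interpret frame_field M \<mu> H \<pi> e I \<phi> a
  proof
    show "locally_compact_space (euclidean :: 'g topology)" "unimodular TYPE('g)" "haar_measure M"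
      by (fact assms)+
    show "measurable_rep_field \<mu> H e \<pi>" "continuous_on UNIV a" "a \<in> L2 M" "L2_norm M a = 1"
      by (fact assms)+
    show "measurable_section \<mu> H e (\<lambda>p. if k \<in> I p then \<phi> p k else \<zero>\<^bsub>H p\<^esub>)" for k
      by (fact assms)
    show "orthonormal_basis (H p) (I p) (\<phi> p)" if "p \<in> space \<mu>" for p
      using that unfolding sp by (rule assms)
    show "unitary_rep (H p) (\<pi> p)" "carrier (H p) \<noteq> {\<zero>\<^bsub>H p\<^esub>}" if "p \<in> space \<mu>" for p
      using irr that unfolding sp irreducible_rep_def by blast+
    show "ennreal ((L2_norm M h)\<^sup>2)
        = (\<integral>\<^sup>+p. hs_norm_sq (H p) (fourier_transform M h (H p) (\<pi> p)) \<partial>\<mu>)"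
      if "cont_compact_support h" for h
      using assms(7) that unfolding plancherel_measure_def cont_compact_support_def by blast
  qed
  show ?thesis
    unfolding g_def
  proof (intro conjI allI ballI)
    fix x p k l assume "p \<in> unitary_dual" "k \<in> I p" "l \<in> I p"
    then show "frame_fun a (H p) (\<pi> p) (\<phi> p) x k l \<in> L2 M"
      by (intro frame_fun_L2) (simp add: sp)
  qed (fact frame_norm_identity frame_inner_identity)+
qed

end
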